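(* Every locally finite connected graph $G$ admits a linked rooted tree-cut decomposition $(T,\mathcal{V})$ of finite adhesion such that every bag $V_t$ is finite, the tree $T$ is locally finite, and $(T,\mathcal{V})$ displays all ends of $G$ (equivalently all edge-ends of $G$) together with their edge-degrees: for every $\omega\in\Omega_E(G)$, with corresponding ray $R_\omega=t_0t_1t_2\dots$ in $T$ starting at the root $t_0$ (the ray from the root representing the end $\varphi(\omega)$ of $T$), $\deg(\omega)=\liminf_n|\delta(C_{t_n})|$.
   Context: Graphs are multigraphs with parallel edges allowed; locally finite means every vertex has finite degree. For $C\subseteq V(G)$, $\delta(C)$ is the set of edges with exactly one endpoint in $C$. Edge-ends. A ray is a one-way infinite path; its tails are its infinite connected subgraphs. Two rays $R,S$ are edge-equivalent if no tail of $S$ can be separated from a tail of $R$ by a finite set of edges. The equivalence classes are the edge-ends of $G$, and $\Omega_E(G)$ is their set; in a locally finite graph the edge-ends coincide with the usual (vertex-)ends. An edge-end $\omega$ lives in $C\subseteq V(G)$ if every ray of $\omega$ has a tail in $C$. The edge-degree of $\omega$ is $\deg(\omega)=\sup\{|\mathcal{R}|:\mathcal{R}\subseteq\omega$ a family of edge-disjoint rays$\}\in\mathbb{N}\cup\{\infty\}$. Tree-cut decompositions. A rooted tree-cut decomposition $(T,\mathcal{V})$ of $G$ consists of a rooted tree $T$ and a family $\mathcal{V}=(V_t)_{t\in T}$ of pairwise disjoint, possibly empty sets (bags, or parts) $V_t\subseteq V(G)$ with $\bigsqcup_{t\in T}V_t=V(G)$. Let $\le$ be the tree-order of $T$ (the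 root is the least element) and $C_t:=\bigcup_{s\ge t}V_s$. For an edge $e\in E(T)$ with $T_1,T_2$ the two components of $T-e$, the adhesion set $F_e$ is the set of edges of $G$ between $\bigcup_{t\in T_1}V_t$ and $\bigcup_{t\in T_2}V_t$. The decomposition has finite adhesion if every $F_e$ is finite. It is linked if for every finite path $t_0t_1\dots t_n$ in $T$ with $t_0<t_1<\dots<t_n$ and $n\ge 1$ there are $\min\{|F_{t_{i-1}t_i}|:1\le i\le n\}$ edge-disjoint paths in $G$ from $F_{t_0t_1}$ to $F_{t_{n-1}t_n}$, i.e. paths connecting an edge of $F_{t_0t_1}$ to an edge of $F_{t_{n-1}t_n}$ and containing these edges (single-edge paths allowed). Displaying. Let $(T,\mathcal{V})$ have finite adhesion and let $\Omega(T)$ be the set of ends of $T$. Each $\omega\in\Omega_E(G)$ orients every edge $e$ of $T$ towards the component $T_i$ of $T-e$ such that $\omega$ lives in $\bigcup_{t\in T_i}V_t$; all edges then point towards a unique node or a unique end of $T$, and $\varphi(\omega)\in V(T)\cup\Omega(T)$ denotes this node or end. The decomposition displays a set $\Psi\subseteq\Omega_E(G)$ if $\varphi^{-1}(\Omega(T))=\Psi$ and $\varphi|_\Psi:\Psi\to\Omega(T)$ is a bijection. *)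

theory Defs
  imports
    Main
    "HOL-Library.Extended_Nat"
    "HOL-Library.Liminf_Limsup"
    "HOL-Library.Disjoint_Sets"
begin

text \<open>
  The AFP entry Graph\_Theory treats directed graphs only, so undirected multigraphs are
  introduced here: edges are abstract objects carrying a set of two endvertices (parallel edges
  are allowed, loops are not).
\<close>

record ('v, 'e) mgraph =
  verts :: "'v set"
  edges :: "'e set"
  endpts :: "'e \<Rightarrow> 'v set"

definition multigraph :: "('v, 'e) mgraph \<Rightarrow> bool" where
  "multigraph G \<longleftrightarrow> (\<forall>e\<in>edges G. endpts G e \<subseteq> verts G \<and> card (endpts G e) = 2)"

definition incident_edges :: "('v, 'e) mgraph \<Rightarrow> 'v \<Rightarrow> 'e set" where
  "incident_edges G v = {e \<in> edges G. v \<in> endpts G e}"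

definition locally_finite :: "('v, 'e) mgraph \<Rightarrow> bool" where
  "locally_finite G \<longleftrightarrow> (\<forall>v\<in>verts G. finite (incident_edges G v))"

definition del_edges :: "('v, 'e) mgraph \<Rightarrow> 'e set \<Rightarrow> ('v, 'e) mgraph" where
  "del_edges G F = G\<lparr>edges := edges G - F\<rparr>"

definition del_verts :: "('v, 'e) mgraph \<Rightarrow> 'v set \<Rightarrow> ('v, 'e) mgraph" where
  "del_verts G X =
     G\<lparr>verts := verts G - X, edges := {e \<in> edges G. endpts G e \<inter> X = {}}\<rparr>"

definition edge_cut :: "('v, 'e) mgraph \<Rightarrow> 'v set \<Rightarrow> 'e set" where
  "edge_cut G C = {e \<in> edges G. card (endpts G e \<inter> C) = 1}"

definition edges_between :: "('v, 'e) mgraph \<Rightarrow> 'v set \<Rightarrow> 'v set \<Rightarrow> 'e set" where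
  "edges_between G A B = {e \<in> edges G. \<exists>a\<in>A. \<exists>b\<in>B. endpts G e = {a, b}}"

text \<open>A finite path is given by the list of its vertices together with the list of its edges.\<close>

definition is_path :: "('v, 'e) mgraph \<Rightarrow> 'v list \<Rightarrow> 'e list \<Rightarrow> bool" where
  "is_path G vs es \<longleftrightarrow>
     length vs = Suc (length es) \<and> distinct vs \<and> set vs \<subseteq> verts G \<and> set es \<subseteq> edges G \<and>
     (\<forall>i<length es. endpts G (es ! i) = {vs ! i, vs ! Suc i})"

definition joined :: "('v, 'e) mgraph \<Rightarrow> 'v set \<Rightarrow> 'v set \<Rightarrow> bool" where
  "joined G A B \<longleftrightarrow> (\<exists>vs es. is_path G vs es \<and> hd vs \<in> A \<and> last vs \<in> B)"

definition connected_graph :: "('v, 'e) mgraph \<Rightarrow> bool" where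
  "connected_graph G \<longleftrightarrow> verts G \<noteq> {} \<and> (\<forall>x\<in>verts G. \<forall>y\<in>verts G. joined G {x} {y})"

text \<open>The vertex sets of the connected components.\<close>

definition graph_components :: "('v, 'e) mgraph \<Rightarrow> 'v set set" where
  "graph_components G = (\<lambda>x. {y \<in> verts G. joined G {x} {y}}) ` verts G"

text \<open>Two parallel edges form a cycle of length two.\<close>

definition is_cycle :: "('v, 'e) mgraph \<Rightarrow> 'v list \<Rightarrow> 'e list \<Rightarrow> 'e \<Rightarrow> bool" where
  "is_cycle G vs es e \<longleftrightarrow>
     is_path G vs es \<and> es \<noteq> [] \<and> e \<in> edges G - set es \<and> endpts G e = {last vs, hd vs}"

definition tree_graph :: "('v, 'e) mgraph \<Rightarrow> bool" where
  "tree_graph T \<longleftrightarrow> multigraph T \<and> connected_graph T \<and> \<not> (\<exists>vs es e. is_cycle T vs es e)"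


section \<open>Rays, ends and edge-ends\<close>

text \<open>
  A ray is represented by the sequences of its vertices and of its edges, starting at its unique
  vertex of degree one; hence distinct rays (as subgraphs) correspond to distinct pairs, and the
  tails are exactly the shifted sequences.
\<close>

type_synonym ('v, 'e) ray = "(nat \<Rightarrow> 'v) \<times> (nat \<Rightarrow> 'e)"

definition rays :: "('v, 'e) mgraph \<Rightarrow> ('v, 'e) ray set" where
  "rays G = {(v, e). inj v \<and> range v \<subseteq> verts G \<and> range e \<subseteq> edges G \<and>
                     (\<forall>i. endpts G (e i) = {v i, v (Suc i)})}"

definition ray_verts :: "('v, 'e) ray \<Rightarrow> 'v set" where
  "ray_verts R = range (fst R)"

definition ray_edges :: "('v, 'e) ray \<Rightarrow> 'e set" where
  "ray_edges R = range (snd R)"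

definition ray_tail :: "nat \<Rightarrow> ('v, 'e) ray \<Rightarrow> ('v, 'e) ray" where
  "ray_tail n R = (\<lambda>i. fst R (n + i), \<lambda>i. snd R (n + i))"

definition edge_equiv :: "('v, 'e) mgraph \<Rightarrow> ('v, 'e) ray \<Rightarrow> ('v, 'e) ray \<Rightarrow> bool" where
  "edge_equiv G R S \<longleftrightarrow>
     (\<forall>F m n. finite F \<and> F \<subseteq> edges G \<longrightarrow>
        joined (del_edges G F) (ray_verts (ray_tail m R)) (ray_verts (ray_tail n S)))"

definition vertex_equiv :: "('v, 'e) mgraph \<Rightarrow> ('v, 'e) ray \<Rightarrow> ('v, 'e) ray \<Rightarrow> bool" where
  "vertex_equiv G R S \<longleftrightarrow>
     (\<forall>X m n. finite X \<and> X \<subseteq> verts G \<longrightarrow>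
        joined (del_verts G X) (ray_verts (ray_tail m R)) (ray_verts (ray_tail n S)))"

definition edge_ends :: "('v, 'e) mgraph \<Rightarrow> ('v, 'e) ray set set" where
  "edge_ends G = rays G // {(R, S). R \<in> rays G \<and> S \<in> rays G \<and> edge_equiv G R S}"

definition graph_ends :: "('v, 'e) mgraph \<Rightarrow> ('v, 'e) ray set set" where
  "graph_ends G = rays G // {(R, S). R \<in> rays G \<and> S \<in> rays G \<and> vertex_equiv G R S}"

definition lives_in :: "('v, 'e) ray set \<Rightarrow> 'v set \<Rightarrow> bool" where
  "lives_in \<omega> C \<longleftrightarrow> (\<forall>R\<in>\<omega>. \<exists>n. ray_verts (ray_tail n R) \<subseteq> C)"

definition ecard :: "'a set \<Rightarrow> enat" where
  "ecard A = (if finite A then enat (card A) else \<infinity>)"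

definition edge_degree :: "('v, 'e) ray set \<Rightarrow> enat" where
  "edge_degree \<omega> =
     (SUP \<R> \<in> {\<R>. \<R> \<subseteq> \<omega> \<and> pairwise (\<lambda>R S. disjnt (ray_edges R) (ray_edges S)) \<R>}. ecard \<R>)"


section \<open>Rooted tree-cut decompositions\<close>

text \<open>In a tree the path between two given vertices is unique.\<close>

definition tree_le :: "('n, 'f) mgraph \<Rightarrow> 'n \<Rightarrow> 'n \<Rightarrow> 'n \<Rightarrow> bool" where
  "tree_le T r s t \<longleftrightarrow> (\<exists>vs es. is_path T vs es \<and> hd vs = r \<and> last vs = t \<and> s \<in> set vs)"

definition bags_of :: "('n \<Rightarrow> 'v set) \<Rightarrow> 'n set \<Rightarrow> 'v set" where
  "bags_of V A = (\<Union>t\<in>A. V t)"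

definition rooted_tree_cut_decomposition ::
  "('v, 'e) mgraph \<Rightarrow> ('n, 'f) mgraph \<Rightarrow> 'n \<Rightarrow> ('n \<Rightarrow> 'v set) \<Rightarrow> bool" where
  "rooted_tree_cut_decomposition G T r V \<longleftrightarrow>
     tree_graph T \<and> r \<in> verts T \<and> disjoint_family_on V (verts T) \<and> bags_of V (verts T) = verts G"

definition part_above :: "('n, 'f) mgraph \<Rightarrow> 'n \<Rightarrow> ('n \<Rightarrow> 'v set) \<Rightarrow> 'n \<Rightarrow> 'v set" where
  "part_above T r V t = bags_of V {s \<in> verts T. tree_le T r t s}"

definition adhesion_set ::
  "('v, 'e) mgraph \<Rightarrow> ('n, 'f) mgraph \<Rightarrow> ('n \<Rightarrow> 'v set) \<Rightarrow> 'f \<Rightarrow> 'e set" where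
  "adhesion_set G T V e =
     {g. \<exists>A B. A \<in> graph_components (del_edges T {e}) \<and> B \<in> graph_components (del_edges T {e}) \<and>
               A \<noteq> B \<and> g \<in> edges_between G (bags_of V A) (bags_of V B)}"

definition finite_adhesion ::
  "('v, 'e) mgraph \<Rightarrow> ('n, 'f) mgraph \<Rightarrow> ('n \<Rightarrow> 'v set) \<Rightarrow> bool" where
  "finite_adhesion G T V \<longleftrightarrow> (\<forall>e\<in>edges T. finite (adhesion_set G T V e))"

text \<open>
  A path from an edge set \<open>A\<close> to an edge set \<open>B\<close> starts with an edge of \<open>A\<close> and finishes with
  an edge of \<open>B\<close>; these two edges may coincide.
\<close>

definition edge_set_paths ::
  "('v, 'e) mgraph \<Rightarrow> 'e set \<Rightarrow> 'e set \<Rightarrow> ('v list \<times> 'e list) set" where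
  "edge_set_paths G A B =
     {(vs, es). is_path G vs es \<and> es \<noteq> [] \<and> hd es \<in> A \<and> last es \<in> B}"

definition linked ::
  "('v, 'e) mgraph \<Rightarrow> ('n, 'f) mgraph \<Rightarrow> 'n \<Rightarrow> ('n \<Rightarrow> 'v set) \<Rightarrow> bool" where
  "linked G T r V \<longleftrightarrow>
     (\<forall>ts fs. is_path T ts fs \<and> fs \<noteq> [] \<and>
        (\<forall>i<length fs. tree_le T r (ts ! i) (ts ! Suc i) \<and> ts ! i \<noteq> ts ! Suc i) \<longrightarrow>
        (\<exists>\<P> \<subseteq> edge_set_paths G (adhesion_set G T V (hd fs)) (adhesion_set G T V (last fs)).
           pairwise (\<lambda>P Q. disjnt (set (snd P)) (set (snd Q))) \<P> \<and>
           ecard \<P> = Min ((\<lambda>f. ecard (adhesion_set G T V f)) ` set fs)))"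

text \<open>
  Left injections stand for nodes of \<open>T\<close> and right injections for ends of \<open>T\<close>. The predicate
  says that every edge \<open>e\<close> of \<open>T\<close>, oriented towards the component of \<open>T - e\<close> in whose part
  \<open>\<omega>\<close> lives, points towards the given node or end.
\<close>

definition oriented_towards ::
  "('n, 'f) mgraph \<Rightarrow> ('n \<Rightarrow> 'v set) \<Rightarrow> ('v, 'e) ray set \<Rightarrow> 'n + ('n, 'f) ray set \<Rightarrow> bool" where
  "oriented_towards T V \<omega> x \<longleftrightarrow>
     (\<forall>e\<in>edges T. \<exists>A\<in>graph_components (del_edges T {e}).
        lives_in \<omega> (bags_of V A) \<and> (case x of Inl t \<Rightarrow> t \<in> A | Inr \<eta> \<Rightarrow> lives_in \<eta> A))"

definition end_map ::
  "('n, 'f) mgraph \<Rightarrow> ('n \<Rightarrow> 'v set) \<Rightarrow> ('v, 'e) ray set \<Rightarrow> 'n + ('n, 'f) ray set" where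
  "end_map T V \<omega> = (THE x. x \<in> verts T <+> graph_ends T \<and> oriented_towards T V \<omega> x)"

definition displays ::
  "('v, 'e) mgraph \<Rightarrow> ('n, 'f) mgraph \<Rightarrow> ('n \<Rightarrow> 'v set) \<Rightarrow> ('v, 'e) ray set set \<Rightarrow> bool" where
  "displays G T V \<Psi> \<longleftrightarrow>
     {\<omega> \<in> edge_ends G. end_map T V \<omega> \<in> Inr ` graph_ends T} = \<Psi> \<and>
     bij_betw (end_map T V) \<Psi> (Inr ` graph_ends T)"

text \<open>\<open>R\<close> is the ray of \<open>T\<close> from the root representing the end of \<open>T\<close> to which \<open>\<omega>\<close> is mapped.\<close>

definition corresponding_ray ::
  "('n, 'f) mgraph \<Rightarrow> 'n \<Rightarrow> ('n \<Rightarrow> 'v set) \<Rightarrow> ('v, 'e) ray set \<Rightarrow> ('n, 'f) ray \<Rightarrow> bool" where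
  "corresponding_ray T r V \<omega> R \<longleftrightarrow>
     R \<in> rays T \<and> fst R 0 = r \<and> (\<exists>\<eta>\<in>graph_ends T. end_map T V \<omega> = Inr \<eta> \<and> R \<in> \<eta>)"

end

theory Submission
  imports Defs "HOL-Library.Countable_Set"
begin

text \<open>
  The sets \<open>C\<^sub>t\<close> of the decomposition form a laminar family that is chosen greedily by cut size.
  Call \<open>C\<close> good if it contains a tail of a ray that cannot be separated from the outside of \<open>C\<close>, by
  a set inside \<open>C\<close>, with fewer edges than the cut of \<open>C\<close> has. If \<open>F\<close> is good and crosses a set \<open>Z\<close>
  with finite cut, then the cut of \<open>Z \<union> F\<close> or of \<open>Z - F\<close> is at most as large as that of \<open>Z\<close>.

  Below a node \<open>P\<close> with first vertex \<open>x\<close> take a laminar family of good subsets of \<open>P\<close> that is maximal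
  size by size, where only the sets with a smaller cut than \<open>P\<close> may contain \<open>x\<close>. The children of \<open>P\<close>
  are the maximal members of this family, and a child \<open>D\<close> inherits the members inside \<open>D\<close> whose cut
  is smaller than that of \<open>D\<close>. By Koenig's lemma and uncrossing, the children cover all ends of
  \<open>P\<close>, so they are finite in number and leave only a finite bag. Along a branch the vertex \<open>x\<close> is
  lost as soon as the cut sizes stop decreasing, so the intersection of a branch is empty.

  If a cut \<open>Z\<close> with \<open>C\<^sub>t \<subseteq> Z \<subseteq> C\<^sub>s\<close> were smaller than all cuts on the path from \<open>s\<close> to \<open>t\<close>, then a smallest
  such \<open>Z\<close>, uncrossed from the family inherited by \<open>s\<close>, would belong to that family; but its members
  of this size lie properly inside \<open>C\<^sub>t\<close> or are disjoint from \<open>C\<^sub>t\<close>. Hence the decomposition is linked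
  by Menger's theorem. Concatenating the linking paths between the successive smallest cuts along
  a branch gives the edge-disjoint rays that witness the edge-degree.
\<close>

section \<open>Cuts\<close>

text \<open>Two demands pull against each other. Linkedness wants a node to take every good set it
  can, while empty branch intersections want the sets to move away from each vertex. Forbidding the
  first vertex \<open>x\<close> to all sets would destroy the maximality on which linkedness rests.
  The way out: linkedness at a node \<open>P\<close> is only tested against cuts smaller than that
  of \<open>P\<close>, so the ban is confined to sets whose cut is at least as large, and for
  smaller cuts the family stays maximal in all of \<open>P\<close>. The price is that a child must
  receive a family that is already greedy inside the child (\<open>inherited_greedy\<close>),
  because its own step adds no set with a smaller cut than its own. Coverage of the ends survives
  the ban because not just \<open>x\<close> but a whole set \<open>E\<close> around it is banned: no
  member crosses \<open>E\<close>, so uncrossing stays inside \<open>P - E\<close>, and a ray with a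
  tail in \<open>E\<close> is covered by \<open>E\<close> itself, as \<open>E\<close> is a member
  unless it is a single vertex.\<close>

definition conn_in :: "('v, 'e) mgraph \<Rightarrow> 'v set \<Rightarrow> bool" where
  "conn_in G A \<longleftrightarrow>
     (\<forall>B\<subseteq>A. B \<noteq> {} \<and> B \<noteq> A \<longrightarrow> (\<exists>e\<in>edges G. \<exists>a\<in>B. \<exists>b\<in>A - B. endpts G e = {a, b}))"

lemma conn_inD:
  assumes "conn_in G A" "B \<subseteq> A" "B \<noteq> {}" "B \<noteq> A"
  obtains e a b where "e \<in> edges G" "a \<in> B" "b \<in> A - B" "endpts G e = {a, b}"
proof -
  have "\<exists>e\<in>edges G. \<exists>a\<in>B. \<exists>b\<in>A - B. endpts G e = {a, b}"
    using assms unfolding conn_in_def by simp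
  then show ?thesis using that by metis
qed

text \<open>An infinite cut gets size 0, the value of \<open>card\<close> there. Comparisons of
  sizes are therefore paired with finiteness of the cuts, and minimisers range over finite
  cuts.\<close>

definition cut_size :: "('v, 'e) mgraph \<Rightarrow> 'v set \<Rightarrow> nat" where
  "cut_size G C = card (edge_cut G C)"

lemma multigraph_endptsE:
  assumes "multigraph G" "e \<in> edges G"
  obtains a b where "a \<noteq> b" "a \<in> verts G" "b \<in> verts G" "endpts G e = {a, b}"
proof -
  have e: "endpts G e \<subseteq> verts G" "card (endpts G e) = 2"
    using assms by (simp_all add: multigraph_def)
  then obtain a b where "endpts G e = {a, b}" "a \<noteq> b"
    by (meson card_2_iff)
  then show ?thesis using that e by simp
qed

lemma mem_edge_cut:
  assumes "multigraph G"
  shows "e \<in> edge_cut G C \<longleftrightarrow> e \<in> edges G \<and> (\<exists>a\<in>C. \<exists>b. b \<notin> C \<and> endpts G e = {a, b})"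
proof (cases "e \<in> edges G")
  case True
  then obtain x y where xy: "x \<noteq> y" "endpts G e = {x, y}"
    using assms by (metis multigraph_endptsE)
  have "card ({x, y} \<inter> C) = 1 \<longleftrightarrow> (\<exists>a\<in>C. \<exists>b. b \<notin> C \<and> {x, y} = {a, b})"
    using xy(1) by (cases "x \<in> C"; cases "y \<in> C") (auto simp: doubleton_eq_iff)
  then show ?thesis
    using True xy by (simp add: edge_cut_def)
qed (simp add: edge_cut_def)

lemma edge_cut_pair:
  assumes "multigraph G" "e \<in> edges G" "endpts G e = {a, b}"
  shows "e \<in> edge_cut G C \<longleftrightarrow> (a \<in> C) \<noteq> (b \<in> C)"
proof -
  have "(\<exists>x\<in>C. \<exists>y. y \<notin> C \<and> {a, b} = {x, y}) \<longleftrightarrow> (a \<in> C) \<noteq> (b \<in> C)"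
    by (auto simp: doubleton_eq_iff)
  then show ?thesis using assms by (simp add: mem_edge_cut)
qed

lemma edge_cut_compl:
  assumes "multigraph G"
  shows "edge_cut G (verts G - C) = edge_cut G C"
proof -
  have "e \<in> edge_cut G (verts G - C) \<longleftrightarrow> e \<in> edge_cut G C" for e
  proof (cases "e \<in> edges G")
    case True
    then obtain a b where "a \<in> verts G" "b \<in> verts G" "endpts G e = {a, b}"
      using assms by (metis multigraph_endptsE)
    then show ?thesis
      using assms True by (auto simp: edge_cut_pair)
  qed (simp add: edge_cut_def)
  then show ?thesis by blast
qed

lemma edge_cut_subset_edges: "edge_cut G C \<subseteq> edges G"
  by (auto simp: edge_cut_def)

text \<open>Inclusion-exclusion on both sides: the hypotheses say that no element is counted more
  often by \<open>A\<close> and \<open>B\<close> than by \<open>X\<close> and \<open>Y\<close>. Both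
  inequalities for cuts below reduce to this by looking at a single edge.\<close>

lemma card_inequality_of_un_int:
  assumes "finite X" "finite Y" "A \<union> B \<subseteq> X \<union> Y" "A \<inter> B \<subseteq> X \<inter> Y"
  shows "finite A \<and> finite B \<and> card A + card B \<le> card X + card Y"
proof -
  have fin: "finite A" "finite B"
    using assms by (auto intro: finite_subset)
  have "card A + card B = card (A \<union> B) + card (A \<inter> B)"
    using fin by (rule card_Un_Int)
  also have "\<dots> \<le> card (X \<union> Y) + card (X \<inter> Y)"
    using assms by (intro add_mono card_mono) auto
  also have "\<dots> = card X + card Y"
    by (rule card_Un_Int[OF assms(1,2), symmetric])
  finally show ?thesis using fin by blast
qed

lemma edge_cut_submodular:
  assumes "multigraph G" "finite (edge_cut G A)" "finite (edge_cut G B)"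
  shows "finite (edge_cut G (A \<inter> B)) \<and> finite (edge_cut G (A \<union> B)) \<and>
         cut_size G (A \<inter> B) + cut_size G (A \<union> B) \<le> cut_size G A + cut_size G B"
  unfolding cut_size_def
proof (rule card_inequality_of_un_int[OF assms(2,3)])
  have *: "(e \<in> edge_cut G (A \<inter> B) \<or> e \<in> edge_cut G (A \<union> B) \<longrightarrow> e \<in> edge_cut G A \<or> e \<in> edge_cut G B) \<and>
      (e \<in> edge_cut G (A \<inter> B) \<and> e \<in> edge_cut G (A \<union> B) \<longrightarrow> e \<in> edge_cut G A \<and> e \<in> edge_cut G B)" for e
  proof (cases "e \<in> edges G")
    case True
    then obtain a b where "endpts G e = {a, b}"
      using assms by (metis multigraph_endptsE)
    then show ?thesis
      using assms(1) True by (auto simp: edge_cut_pair)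
  qed (simp add: edge_cut_def)
  show "edge_cut G (A \<inter> B) \<union> edge_cut G (A \<union> B) \<subseteq> edge_cut G A \<union> edge_cut G B"
    using * by blast
  show "edge_cut G (A \<inter> B) \<inter> edge_cut G (A \<union> B) \<subseteq> edge_cut G A \<inter> edge_cut G B"
    using * by blast
qed

text \<open>This is submodularity for \<open>A\<close> and the complement of \<open>B\<close>, since
  a set and its complement have the same cut. It serves where uncrossing keeps the differences
  instead of the intersection and the union.\<close>

lemma edge_cut_posimodular:
  assumes "multigraph G" "finite (edge_cut G A)" "finite (edge_cut G B)"
  shows "finite (edge_cut G (A - B)) \<and> finite (edge_cut G (B - A)) \<and>
         cut_size G (A - B) + cut_size G (B - A) \<le> cut_size G A + cut_size G B"
  unfolding cut_size_def
proof (rule card_inequality_of_un_int[OF assms(2,3)])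
  have *: "(e \<in> edge_cut G (A - B) \<or> e \<in> edge_cut G (B - A) \<longrightarrow> e \<in> edge_cut G A \<or> e \<in> edge_cut G B) \<and>
      (e \<in> edge_cut G (A - B) \<and> e \<in> edge_cut G (B - A) \<longrightarrow> e \<in> edge_cut G A \<and> e \<in> edge_cut G B)" for e
  proof (cases "e \<in> edges G")
    case True
    then obtain a b where "endpts G e = {a, b}"
      using assms by (metis multigraph_endptsE)
    then show ?thesis
      using assms(1) True by (auto simp: edge_cut_pair)
  qed (simp add: edge_cut_def)
  show "edge_cut G (A - B) \<union> edge_cut G (B - A) \<subseteq> edge_cut G A \<union> edge_cut G B"
    using * by blast
  show "edge_cut G (A - B) \<inter> edge_cut G (B - A) \<subseteq> edge_cut G A \<inter> edge_cut G B"
    using * by blast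
qed

lemma finite_cut_endpoints:
  assumes "multigraph G" "finite F" "F \<subseteq> edges G"
  shows "finite (\<Union>e\<in>F. endpts G e)"
proof -
  have "finite (endpts G e)" if "e \<in> F" for e
    using that assms by (metis multigraph_endptsE finite.simps subsetD)
  then show ?thesis using assms(2) by blast
qed

section \<open>Paths\<close>

definition adj :: "('v, 'e) mgraph \<Rightarrow> ('v \<times> 'v) set" where
  "adj G = {(u, v). \<exists>e\<in>edges G. endpts G e = {u, v}}"

text \<open>Loop erasure while the walk is extended at its front: if the new first point already
  occurs, the list is cut back to the suffix starting there.\<close>

lemma rtrancl_imp_distinct_list:
  assumes "(a, b) \<in> r\<^sup>*"
  shows "\<exists>vs. vs \<noteq> [] \<and> hd vs = a \<and> last vs = b \<and> distinct vs \<and> successively (\<lambda>u v. (u, v) \<in> r) vs"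
  using assms
proof (induction rule: converse_rtrancl_induct)
  case base
  show ?case by (rule exI[of _ "[b]"]) simp
next
  case (step a c)
  then obtain vs where vs: "vs \<noteq> []" "hd vs = c" "last vs = b" "distinct vs"
    "successively (\<lambda>u v. (u, v) \<in> r) vs" by blast
  show ?case
  proof (cases "a \<in> set vs")
    case True
    then obtain xs ys where "vs = xs @ a # ys"
      by (meson split_list)
    then show ?thesis
      using vs by (intro exI[of _ "a # ys"]) (auto simp: successively_append_iff)
  next
    case False
    then show ?thesis
      using vs step.hyps by (intro exI[of _ "a # vs"]) (auto simp: successively_Cons)
  qed
qed

text \<open>With parallel edges a vertex list does not determine the edges. \<open>Q\<close> records
  a property of the edge chosen at each step and of its direction; the flow arguments use it to
  control which darts a path traverses.\<close>

lemma path_of_distinct_list: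
  assumes "vs \<noteq> []" "distinct vs" "successively (\<lambda>u v. \<exists>e\<in>edges G. endpts G e = {u, v} \<and> Q e u v) vs"
    "set vs \<subseteq> verts G"
  obtains es where "is_path G vs es" "\<And>i. i < length es \<Longrightarrow> Q (es ! i) (vs ! i) (vs ! Suc i)"
proof -
  define n where "n = length vs - 1"
  have len: "length vs = Suc n" using assms(1) n_def by (cases vs) auto
  have "\<forall>i<n. \<exists>e\<in>edges G. endpts G e = {vs ! i, vs ! Suc i} \<and> Q e (vs ! i) (vs ! Suc i)"
    using assms(3) len by (simp add: successively_conv_nth)
  then obtain f where f: "\<And>i. i < n \<Longrightarrow> f i \<in> edges G \<and> endpts G (f i) = {vs ! i, vs ! Suc i} \<and> Q (f i) (vs ! i) (vs ! Suc i)"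
    by metis
  show ?thesis
    by (rule that[of "map f [0..<n]"]) (use len f assms in \<open>auto simp: is_path_def\<close>)
qed

lemma distinct_list_verts:
  assumes "multigraph G" "vs \<noteq> []" "hd vs \<in> verts G" "successively (\<lambda>u v. (u, v) \<in> adj G) vs"
  shows "set vs \<subseteq> verts G"
  using assms(2-)
proof (induction vs)
  case (Cons a vs)
  then show ?case
    using assms(1) by (cases vs) (auto simp: adj_def multigraph_def)
qed simp

text \<open>The reflexive closure also relates points outside the graph to themselves, hence the
  intersection of \<open>A\<close> with \<open>verts G\<close>.\<close>

lemma joined_iff:
  assumes "multigraph G"
  shows "joined G A B \<longleftrightarrow> (\<exists>a\<in>A \<inter> verts G. \<exists>b\<in>B. (a, b) \<in> (adj G)\<^sup>*)"
proof
  assume "joined G A B"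
  then obtain vs es where p: "is_path G vs es" "hd vs \<in> A" "last vs \<in> B"
    by (auto simp: joined_def)
  have len: "length vs = Suc (length es)" using p by (simp add: is_path_def)
  have "i \<le> length es \<Longrightarrow> (vs ! 0, vs ! i) \<in> (adj G)\<^sup>*" for i
  proof (induction i)
    case (Suc i)
    have "(vs ! i, vs ! Suc i) \<in> adj G"
    proof -
      have i: "i < length es" using Suc.prems by simp
      then have "es ! i \<in> edges G"
        using p(1) unfolding is_path_def by (meson nth_mem subsetD)
      moreover have "endpts G (es ! i) = {vs ! i, vs ! Suc i}"
        using p(1) i by (simp add: is_path_def)
      ultimately show ?thesis unfolding adj_def by blast
    qed
    then show ?case using Suc by auto
  qed simp
  then have "(hd vs, last vs) \<in> (adj G)\<^sup>*"
    using len by (metis diff_Suc_1 hd_conv_nth last_conv_nth le_refl length_0_conv nat.distinct(1))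
  moreover have "hd vs \<in> verts G"
    using p(1) len unfolding is_path_def by (metis hd_in_set length_0_conv nat.distinct(1) subsetD)
  ultimately show "\<exists>a\<in>A \<inter> verts G. \<exists>b\<in>B. (a, b) \<in> (adj G)\<^sup>*"
    using p by blast
next
  assume "\<exists>a\<in>A \<inter> verts G. \<exists>b\<in>B. (a, b) \<in> (adj G)\<^sup>*"
  then obtain a b where ab: "a \<in> A" "a \<in> verts G" "b \<in> B" "(a, b) \<in> (adj G)\<^sup>*" by blast
  obtain vs where vs: "vs \<noteq> []" "hd vs = a" "last vs = b" "distinct vs"
      "successively (\<lambda>u v. (u, v) \<in> adj G) vs"
    using rtrancl_imp_distinct_list[OF ab(4)] by blast
  have V: "set vs \<subseteq> verts G"
    using distinct_list_verts[OF assms vs(1) _ vs(5)] ab vs by simp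
  have S: "successively (\<lambda>u v. \<exists>e\<in>edges G. endpts G e = {u, v} \<and> True) vs"
    using vs(5) by (simp add: adj_def)
  obtain es where "is_path G vs es"
    by (rule path_of_distinct_list[OF vs(1) vs(4) S V])
  then show "joined G A B"
    using vs ab unfolding joined_def by blast
qed

lemma reach_closed_edges:
  assumes "e \<in> edges G" "endpts G e = {a, b}" "(x, a) \<in> (adj G)\<^sup>*"
  shows "(x, b) \<in> (adj G)\<^sup>*"
proof -
  have "(a, b) \<in> adj G" using assms by (auto simp: adj_def)
  then show ?thesis using assms(3) by (rule rtrancl_into_rtrancl[rotated])
qed

lemma conn_in_reach:
  assumes "conn_in G A" "x \<in> A" "y \<in> A"
  shows "(x, y) \<in> (adj G)\<^sup>*"
proof (rule ccontr)
  assume n: "(x, y) \<notin> (adj G)\<^sup>*"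
  define B where "B = {z \<in> A. (x, z) \<in> (adj G)\<^sup>*}"
  have "B \<subseteq> A" "B \<noteq> {}" "B \<noteq> A"
    using n assms by (auto simp: B_def)
  then obtain e a b where e: "e \<in> edges G" "a \<in> B" "b \<in> A - B" "endpts G e = {a, b}"
    using assms(1) by (meson conn_inD)
  have "(x, b) \<in> (adj G)\<^sup>*"
    by (rule reach_closed_edges[OF e(1,4)]) (use e(2) B_def in simp)
  then show False
    using e(3) B_def by simp
qed

lemma reach_within:
  assumes "(x, y) \<in> (adj G)\<^sup>*" "x \<in> A" "\<And>e a b. e \<in> edges G \<Longrightarrow> endpts G e = {a, b} \<Longrightarrow> a \<in> A \<Longrightarrow> b \<in> A"
  shows "y \<in> A"
  using assms(1,2)
proof (induction rule: rtrancl_induct)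
  case base
  then show ?case by simp
next
  case (step y z)
  from step.hyps(2) have "\<exists>e. e \<in> edges G \<and> endpts G e = {y, z}"
    by (simp add: adj_def Bex_def)
  then obtain e where e: "e \<in> edges G" "endpts G e = {y, z}" by (elim exE conjE)
  have "y \<in> A" using step.IH step.prems by simp
  show ?case
    by (rule assms(3)[OF e \<open>y \<in> A\<close>])
qed

lemma connected_graph_iff:
  assumes "multigraph G"
  shows "connected_graph G \<longleftrightarrow> verts G \<noteq> {} \<and> conn_in G (verts G)"
proof
  assume c: "connected_graph G"
  have "conn_in G (verts G)"
    unfolding conn_in_def
  proof (intro allI impI)
    fix B assume B: "B \<subseteq> verts G" "B \<noteq> {} \<and> B \<noteq> verts G"
    then obtain x y where xy: "x \<in> B" "y \<in> verts G - B" by blast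
    then have "(x, y) \<in> (adj G)\<^sup>*"
      using c B unfolding connected_graph_def joined_iff[OF assms] by blast
    then have "\<not> (\<forall>e a b. e \<in> edges G \<longrightarrow> endpts G e = {a, b} \<longrightarrow> a \<in> B \<longrightarrow> b \<in> B)"
      using reach_within[of x y G B] xy by (metis DiffD2)
    then obtain e a b where e: "e \<in> edges G" "endpts G e = {a, b}" "a \<in> B" "b \<notin> B" by blast
    moreover have "b \<in> verts G" using e assms by (auto simp: multigraph_def)
    ultimately show "\<exists>e\<in>edges G. \<exists>a\<in>B. \<exists>b\<in>verts G - B. endpts G e = {a, b}" by blast
  qed
  then show "verts G \<noteq> {} \<and> conn_in G (verts G)"
    using c by (auto simp: connected_graph_def)
next
  assume c: "verts G \<noteq> {} \<and> conn_in G (verts G)"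
  then have "(x, y) \<in> (adj G)\<^sup>*" if "x \<in> verts G" "y \<in> verts G" for x y
    using conn_in_reach that by metis
  then show "connected_graph G"
    using c unfolding connected_graph_def joined_iff[OF assms] by blast
qed

text \<open>An empty cut keeps every walk on its side, and connectedness lets it reach the whole
  side. The intended graph is a tree with one edge deleted.\<close>

lemma graph_components_two:
  assumes mg: "multigraph G" and AB: "verts G = A \<union> B" "A \<inter> B = {}" "A \<noteq> {}" "B \<noteq> {}"
    and conn: "conn_in G A" "conn_in G B" and cut: "edge_cut G A = {}"
  shows "graph_components G = {A, B}"
proof -
  have edge: "a \<in> A \<longleftrightarrow> b \<in> A" if "e \<in> edges G" "endpts G e = {a, b}" for e a b
    using edge_cut_pair[OF mg that, of A] cut by blast
  have edgeB: "a \<in> B \<longleftrightarrow> b \<in> B" if "e \<in> edges G" "endpts G e = {a, b}" for e a b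
  proof -
    have "a \<in> verts G" "b \<in> verts G" using mg that by (auto simp: multigraph_def)
    then show ?thesis using edge[OF that] AB by blast
  qed
  have A: "{y \<in> verts G. joined G {x} {y}} = A" if "x \<in> A" for x
  proof -
    have "y \<in> A" if "(x, y) \<in> (adj G)\<^sup>*" for y
      using reach_within[OF that \<open>x \<in> A\<close>] edge by blast
    then show ?thesis
      using conn_in_reach[OF conn(1) that] that AB(1) unfolding joined_iff[OF mg] by blast
  qed
  have B: "{y \<in> verts G. joined G {x} {y}} = B" if "x \<in> B" for x
  proof -
    have "y \<in> B" if "(x, y) \<in> (adj G)\<^sup>*" for y
      using reach_within[OF that \<open>x \<in> B\<close>] edgeB by blast
    then show ?thesis
      using conn_in_reach[OF conn(2) that] that AB(1) unfolding joined_iff[OF mg] by blast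
  qed
  obtain a b where ab: "a \<in> A" "b \<in> B" using AB by blast
  have "graph_components G = (\<lambda>x. {y \<in> verts G. joined G {x} {y}}) ` A \<union> (\<lambda>x. {y \<in> verts G. joined G {x} {y}}) ` B"
    unfolding graph_components_def AB(1)[symmetric] image_Un[symmetric] by simp
  also have "\<dots> = {A, B}"
    using A B ab by auto
  finally show ?thesis .
qed

lemma multigraph_del_edges: "multigraph G \<Longrightarrow> multigraph (del_edges G F)"
  by (auto simp: multigraph_def del_edges_def)

lemma multigraph_del_verts: "multigraph G \<Longrightarrow> multigraph (del_verts G X)"
  by (auto simp: multigraph_def del_verts_def)

section \<open>Rays and ends\<close>

abbreviation ev_in :: "(nat \<Rightarrow> 'v) \<Rightarrow> 'v set \<Rightarrow> bool" where
  "ev_in v C \<equiv> \<forall>\<^sub>F i in sequentially. v i \<in> C"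

text \<open>Where the tails of a ray lie depends on its vertices alone, so the edges are forgotten
  here; \<open>vray_ray\<close> chooses them again where edges matter.\<close>

definition vrays :: "('v, 'e) mgraph \<Rightarrow> (nat \<Rightarrow> 'v) set" where
  "vrays G = {v. inj v \<and> range v \<subseteq> verts G \<and> (\<forall>i. \<exists>e\<in>edges G. endpts G e = {v i, v (Suc i)})}"

lemma ray_vray:
  assumes "R \<in> rays G"
  shows "fst R \<in> vrays G"
proof -
  have "\<exists>e\<in>edges G. endpts G e = {fst R i, fst R (Suc i)}" for i
    using assms by (intro bexI[of _ "snd R i"]) (auto simp: rays_def)
  then show ?thesis using assms by (auto simp: rays_def vrays_def)
qed

lemma vray_ray:
  assumes "v \<in> vrays G"
  obtains e where "(v, e) \<in> rays G"
proof -
  obtain e where "\<forall>i. e i \<in> edges G \<and> endpts G (e i) = {v i, v (Suc i)}"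
    using assms unfolding vrays_def mem_Collect_eq Bex_def by metis
  then have "(v, e) \<in> rays G"
    using assms by (auto simp: rays_def vrays_def)
  then show ?thesis by (rule that)
qed

text \<open>Consecutive pairs of an injective sequence determine their index: matching two of them
  crosswise would need \<open>i = Suc j\<close> and \<open>Suc i = j\<close>. Consequently a ray
  crosses a finite cut only finitely often.\<close>

lemma ray_edges_inj:
  assumes "(v, e) \<in> rays G"
  shows "inj e"
proof (rule injI)
  fix i j assume eq: "e i = e j"
  have "inj v" "endpts G (e i) = {v i, v (Suc i)}" "endpts G (e j) = {v j, v (Suc j)}"
    using assms by (auto simp: rays_def)
  then have "{v i, v (Suc i)} = {v j, v (Suc j)}" using eq by simp
  then have "v i = v j \<or> v i = v (Suc j) \<and> v (Suc i) = v j"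
    by (auto simp: doubleton_eq_iff)
  then have "i = j \<or> i = Suc j \<and> Suc i = j"
    using \<open>inj v\<close> by (auto simp: inj_eq)
  then show "i = j" by linarith
qed

lemma vrays_verts: "v \<in> vrays G \<Longrightarrow> v i \<in> verts G"
  by (auto simp: vrays_def)

lemma vrays_inj: "v \<in> vrays G \<Longrightarrow> inj v"
  by (auto simp: vrays_def)

lemma ev_in_mono: "ev_in v A \<Longrightarrow> A \<subseteq> B \<Longrightarrow> ev_in v B"
  by (auto elim: eventually_mono)

lemma ev_in_Int: "ev_in v A \<Longrightarrow> ev_in v B \<Longrightarrow> ev_in v (A \<inter> B)"
  by (auto intro: eventually_conj)

lemma ev_in_nonempty: "ev_in v A \<Longrightarrow> A \<noteq> {}"
  by (auto dest: eventually_happens)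

lemma ev_in_disjoint: "ev_in v A \<Longrightarrow> ev_in v B \<Longrightarrow> A \<inter> B \<noteq> {}"
  using ev_in_Int ev_in_nonempty by metis

lemma inj_not_ev_in_finite:
  assumes "inj (v :: nat \<Rightarrow> 'v)" "finite A"
  shows "\<not> ev_in v A"
proof
  assume "ev_in v A"
  then obtain N where N: "\<And>i. i \<ge> N \<Longrightarrow> v i \<in> A"
    by (auto simp: eventually_sequentially)
  have "infinite (v ` {N..})"
    using assms(1) by (simp add: finite_image_iff inj_on_subset infinite_Ici)
  moreover have "v ` {N..} \<subseteq> A" using N by auto
  ultimately show False using assms(2) finite_subset by blast
qed

lemma inj_ev_notin_finite:
  assumes "inj (v :: nat \<Rightarrow> 'v)" "finite A"
  shows "\<forall>\<^sub>F i in sequentially. v i \<notin> A"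
proof -
  have "finite (v -` A)" using assms by (simp add: finite_vimageI)
  then show ?thesis
    by (simp add: cofinite_eq_sequentially[symmetric] eventually_cofinite vimage_def)
qed

lemma ray_cut_edge:
  assumes "multigraph G" "(v, e) \<in> rays G" "v i \<notin> C" "v j \<in> C" "i \<le> j"
  shows "\<exists>k. e k \<in> edge_cut G C"
proof (rule ccontr)
  assume n: "\<nexists>k. e k \<in> edge_cut G C"
  have "v (Suc k) \<in> C \<longleftrightarrow> v k \<in> C" for k
  proof -
    have "e k \<in> edges G" "endpts G (e k) = {v k, v (Suc k)}"
      using assms(2) by (auto simp: rays_def)
    then show ?thesis using n edge_cut_pair[OF assms(1)] by metis
  qed
  then have "v (i + d) \<notin> C" for d
    by (induction d) (use assms in auto)
  then show False using assms(4,5) by (metis le_add_diff_inverse)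
qed

text \<open>After the last of its finitely many cut edges a ray stays on one side. Most case
  distinctions on rays below are instances of this.\<close>

lemma vray_dichotomy:
  assumes mg: "multigraph G" and v: "v \<in> vrays G" and C: "finite (edge_cut G C)"
  shows "ev_in v C \<or> ev_in v (verts G - C)"
proof -
  obtain e where e: "(v, e) \<in> rays G" using v by (rule vray_ray)
  have "finite (e -` edge_cut G C)"
    using ray_edges_inj[OF e] C by (rule finite_vimageI[rotated])
  then obtain N where N: "\<And>i. i \<ge> N \<Longrightarrow> e i \<notin> edge_cut G C"
    by (metis finite_nat_set_iff_bounded linorder_not_less vimage_eq)
  have step: "v (Suc i) \<in> C \<longleftrightarrow> v i \<in> C" if "i \<ge> N" for i
  proof -
    have "e i \<in> edges G" "endpts G (e i) = {v i, v (Suc i)}"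
      using e by (auto simp: rays_def)
    then show ?thesis using N[OF that] edge_cut_pair[OF mg] by metis
  qed
  have "v i \<in> C \<longleftrightarrow> v N \<in> C" if "i \<ge> N" for i
    using that by (induction i rule: dec_induct) (auto simp: step)
  then have "(\<forall>i\<ge>N. v i \<in> C) \<or> (\<forall>i\<ge>N. v i \<in> verts G - C)"
    using vrays_verts[OF v] by blast
  then show ?thesis unfolding eventually_sequentially by blast
qed

text \<open>Translates separation by deleted edges into separation by vertex sets with finite cut,
  the language of the laminar families. One implication captures the symmetric relation because
  complements have the same cut.\<close>

lemma edge_equiv_iff:
  assumes mg: "multigraph G" and R: "R \<in> rays G" and S: "S \<in> rays G"
  shows "edge_equiv G R S \<longleftrightarrow> (\<forall>Y. finite (edge_cut G Y) \<longrightarrow> ev_in (fst R) Y \<longrightarrow> ev_in (fst S) Y)"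
proof
  assume eq: "edge_equiv G R S"
  show "\<forall>Y. finite (edge_cut G Y) \<longrightarrow> ev_in (fst R) Y \<longrightarrow> ev_in (fst S) Y"
  proof (intro allI impI, rule ccontr)
    fix Y assume Y: "finite (edge_cut G Y)" "ev_in (fst R) Y" "\<not> ev_in (fst S) Y"
    then have "ev_in (fst S) (verts G - Y)"
      using vray_dichotomy[OF mg ray_vray[OF S]] by blast
    then obtain m n where m: "\<And>i. i \<ge> m \<Longrightarrow> fst R i \<in> Y" and n: "\<And>i. i \<ge> n \<Longrightarrow> fst S i \<in> verts G - Y"
      using Y(2) unfolding eventually_sequentially by blast
    let ?H = "del_edges G (edge_cut G Y)"
    have "joined ?H (ray_verts (ray_tail m R)) (ray_verts (ray_tail n S))"
      by (rule eq[unfolded edge_equiv_def, rule_format]) (use Y(1) edge_cut_subset_edges in \<open>intro conjI\<close>)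
    then obtain a b where ab: "a \<in> ray_verts (ray_tail m R)" "b \<in> ray_verts (ray_tail n S)" "(a, b) \<in> (adj ?H)\<^sup>*"
      using joined_iff[OF multigraph_del_edges[OF mg]] by blast
    have "a \<in> Y" using ab(1) m by (auto simp: ray_verts_def ray_tail_def)
    have "b \<in> Y"
    proof (rule reach_within[OF ab(3) \<open>a \<in> Y\<close>])
      fix e a b assume "e \<in> edges ?H" "endpts ?H e = {a, b}" "a \<in> Y"
      then show "b \<in> Y"
        using edge_cut_pair[OF mg, of e a b Y] by (simp add: del_edges_def)
    qed
    then show False using ab(2) n by (auto simp: ray_verts_def ray_tail_def)
  qed
next
  assume eq: "\<forall>Y. finite (edge_cut G Y) \<longrightarrow> ev_in (fst R) Y \<longrightarrow> ev_in (fst S) Y"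
  show "edge_equiv G R S"
    unfolding edge_equiv_def
  proof (intro allI impI)
    fix F m n assume F: "finite F \<and> F \<subseteq> edges G"
    let ?H = "del_edges G F"
    \<comment> \<open>Everything reachable from the tail once \<open>F\<close> is deleted. An edge
      leaving this set must have been deleted, so its cut lies in \<open>F\<close>.\<close>
    define Y where "Y = {y. \<exists>i. (fst R (m + i), y) \<in> (adj ?H)\<^sup>*}"
    have "edge_cut G Y \<subseteq> F"
    proof
      fix e assume "e \<in> edge_cut G Y"
      then obtain a b where e: "e \<in> edges G" "endpts G e = {a, b}" "a \<in> Y" "b \<notin> Y"
        using mg by (auto simp: mem_edge_cut)
      obtain i where i: "(fst R (m + i), a) \<in> (adj ?H)\<^sup>*" using e(3) Y_def by blast
      show "e \<in> F"
      proof (rule ccontr)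
        assume "e \<notin> F"
        then have "(fst R (m + i), b) \<in> (adj ?H)\<^sup>*"
          using reach_closed_edges[of e ?H a b] e(1,2) i by (simp add: del_edges_def)
        then show False using e(4) Y_def by blast
      qed
    qed
    then have fin: "finite (edge_cut G Y)" using F finite_subset by blast
    have "fst R i \<in> Y" if "i \<ge> m" for i
      using that unfolding Y_def by (auto intro!: exI[of _ "i - m"])
    then have "ev_in (fst R) Y" unfolding eventually_sequentially by blast
    then have "ev_in (fst S) Y" using eq fin by blast
    then obtain j where j: "j \<ge> n" "fst S j \<in> Y"
      unfolding eventually_sequentially by (meson linorder_linear)
    then obtain i where i: "(fst R (m + i), fst S j) \<in> (adj ?H)\<^sup>*" using Y_def by blast
    have "fst S j = fst (ray_tail n S) (j - n)" using j(1) by (simp add: ray_tail_def)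
    then have "fst S j \<in> ray_verts (ray_tail n S)" by (simp add: ray_verts_def)
    moreover have "fst R (m + i) \<in> ray_verts (ray_tail m R) \<inter> verts ?H"
      using vrays_verts[OF ray_vray[OF R]] by (simp add: ray_verts_def ray_tail_def del_edges_def)
    ultimately show "joined ?H (ray_verts (ray_tail m R)) (ray_verts (ray_tail n S))"
      using joined_iff[OF multigraph_del_edges[OF mg]] i by blast
  qed
qed

lemma edge_equivD:
  assumes "multigraph G" "R \<in> rays G" "S \<in> rays G" "edge_equiv G R S" "finite (edge_cut G Y)"
  shows "ev_in (fst R) Y \<longleftrightarrow> ev_in (fst S) Y"
proof
  show "ev_in (fst R) Y \<Longrightarrow> ev_in (fst S) Y"
    using assms edge_equiv_iff by blast
  assume S: "ev_in (fst S) Y"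
  show "ev_in (fst R) Y"
  proof (rule ccontr)
    assume "\<not> ev_in (fst R) Y"
    then have "ev_in (fst R) (verts G - Y)"
      using vray_dichotomy[OF assms(1) ray_vray[OF assms(2)] assms(5)] by blast
    moreover have "finite (edge_cut G (verts G - Y))"
      using assms(1,5) by (simp add: edge_cut_compl)
    ultimately have "ev_in (fst S) (verts G - Y)"
      using edge_equiv_iff[OF assms(1-3)] assms(4) by blast
    then show False using ev_in_disjoint[OF S] by blast
  qed
qed

lemma edge_endsE:
  assumes "multigraph G" "\<omega> \<in> edge_ends G"
  obtains R where "R \<in> rays G" "\<omega> = {S \<in> rays G. edge_equiv G R S}" "R \<in> \<omega>"
proof -
  obtain R where R: "R \<in> rays G" "\<omega> = {(R, S). R \<in> rays G \<and> S \<in> rays G \<and> edge_equiv G R S} `` {R}"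
    using assms(2) unfolding edge_ends_def by (rule quotientE)
  then have "\<omega> = {S \<in> rays G. edge_equiv G R S}" by blast
  moreover have "edge_equiv G R R" using edge_equiv_iff[OF assms(1) R(1) R(1)] by blast
  ultimately show ?thesis using that R(1) by blast
qed

lemma edge_endsI:
  assumes "R \<in> rays G"
  shows "{S \<in> rays G. edge_equiv G R S} \<in> edge_ends G"
proof -
  let ?r = "{(R, S). R \<in> rays G \<and> S \<in> rays G \<and> edge_equiv G R S}"
  have "?r `` {R} = {S \<in> rays G. edge_equiv G R S}"
    using assms by auto
  moreover have "?r `` {R} \<in> edge_ends G"
    unfolding edge_ends_def using assms by (rule quotientI)
  ultimately show ?thesis by (rule subst)
qed

lemma edge_end_rays:
  assumes "multigraph G" "\<omega> \<in> edge_ends G" "R \<in> \<omega>"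
  shows "R \<in> rays G"
proof -
  obtain Q where "\<omega> = {S \<in> rays G. edge_equiv G Q S}"
    using assms(1,2) by (rule edge_endsE)
  then show ?thesis using assms(3) by blast
qed

lemma edge_end_mem_iff:
  assumes "multigraph G" "\<omega> \<in> edge_ends G" "R \<in> \<omega>" "S \<in> rays G"
  shows "S \<in> \<omega> \<longleftrightarrow> edge_equiv G R S"
proof -
  obtain Q where Q: "Q \<in> rays G" "\<omega> = {S \<in> rays G. edge_equiv G Q S}"
    using assms(1,2) by (rule edge_endsE)
  then have R: "R \<in> rays G" "edge_equiv G Q R" using assms(3) by auto
  have "edge_equiv G Q S \<longleftrightarrow> edge_equiv G R S"
    using edge_equivD[OF assms(1) Q(1) R] edge_equiv_iff[OF assms(1) Q(1) assms(4)]
      edge_equiv_iff[OF assms(1) R(1) assms(4)] by blast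
  then show ?thesis using Q assms(4) by simp
qed

lemma edge_end_nonempty: "multigraph G \<Longrightarrow> \<omega> \<in> edge_ends G \<Longrightarrow> \<exists>R. R \<in> \<omega>"
  using edge_endsE by metis

lemma edge_ends_eqI:
  assumes "multigraph G" "\<omega> \<in> edge_ends G" "\<omega>' \<in> edge_ends G" "R \<in> \<omega>" "S \<in> \<omega>'" "edge_equiv G R S"
  shows "\<omega> = \<omega>'"
proof -
  have S: "S \<in> rays G" using assms(1,3,5) by (rule edge_end_rays)
  then have S': "S \<in> \<omega>" using edge_end_mem_iff[OF assms(1,2,4)] assms(6) by blast
  have "T \<in> \<omega> \<longleftrightarrow> T \<in> \<omega>'" if "T \<in> rays G" for T
    using edge_end_mem_iff[OF assms(1,2) S' that] edge_end_mem_iff[OF assms(1,3,5) that] by blast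
  then show ?thesis
    using edge_end_rays[OF assms(1,2)] edge_end_rays[OF assms(1,3)] by blast
qed

lemma lives_in_iff:
  assumes "multigraph G" "\<omega> \<in> edge_ends G" "R \<in> \<omega>" "finite (edge_cut G C)"
  shows "lives_in \<omega> C \<longleftrightarrow> ev_in (fst R) C"
proof -
  have tail: "(\<exists>n. ray_verts (ray_tail n S) \<subseteq> C) \<longleftrightarrow> ev_in (fst S) C" for S
  proof
    assume "\<exists>n. ray_verts (ray_tail n S) \<subseteq> C"
    then obtain n where n: "\<And>i. fst S (n + i) \<in> C"
      by (auto simp: ray_verts_def ray_tail_def)
    have "fst S i \<in> C" if "i \<ge> n" for i using n[of "i - n"] that by simp
    then show "ev_in (fst S) C" unfolding eventually_sequentially by blast
  next
    assume "ev_in (fst S) C"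
    then obtain n where "\<And>i. i \<ge> n \<Longrightarrow> fst S i \<in> C"
      unfolding eventually_sequentially by blast
    then have "ray_verts (ray_tail n S) \<subseteq> C"
      by (auto simp: ray_verts_def ray_tail_def)
    then show "\<exists>n. ray_verts (ray_tail n S) \<subseteq> C" by blast
  qed
  have "ev_in (fst R) C \<longleftrightarrow> ev_in (fst S) C" if "S \<in> \<omega>" for S
    using edge_equivD[OF assms(1) _ _ _ assms(4)] edge_end_mem_iff[OF assms(1,2,3)]
      edge_end_rays[OF assms(1,2)] that assms(3) by blast
  then show ?thesis unfolding lives_in_def tail using assms(3) by blast
qed

text \<open>A finite edge set is replaced by its endpoints, and a finite vertex set by the edges at
  it, which are finitely many by local finiteness.\<close>

lemma vertex_equiv_iff_edge_equiv:
  assumes mg: "multigraph G" and lf: "locally_finite G" and R: "R \<in> rays G" and S: "S \<in> rays G"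
  shows "vertex_equiv G R S \<longleftrightarrow> edge_equiv G R S"
proof
  assume v: "vertex_equiv G R S"
  show "edge_equiv G R S"
    unfolding edge_equiv_def
  proof (intro allI impI)
    fix F m n assume F: "finite F \<and> F \<subseteq> edges G"
    define X where "X = (\<Union>e\<in>F. endpts G e)"
    have X: "finite X" "X \<subseteq> verts G"
      using finite_cut_endpoints[OF mg] F mg by (auto simp: X_def multigraph_def)
    have "edges (del_verts G X) \<subseteq> edges (del_edges G F)"
    proof
      fix e assume e: "e \<in> edges (del_verts G X)"
      then have "e \<in> edges G" "endpts G e \<inter> X = {}" by (auto simp: del_verts_def)
      moreover from this obtain a b where "endpts G e = {a, b}" using mg by (metis multigraph_endptsE)
      ultimately show "e \<in> edges (del_edges G F)" by (auto simp: del_edges_def X_def)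
    qed
    then have sub: "adj (del_verts G X) \<subseteq> adj (del_edges G F)"
      by (auto simp: adj_def del_edges_def del_verts_def)
    obtain a b where "a \<in> ray_verts (ray_tail m R) \<inter> verts (del_verts G X)"
        "b \<in> ray_verts (ray_tail n S)" "(a, b) \<in> (adj (del_verts G X))\<^sup>*"
      using v X joined_iff[OF multigraph_del_verts[OF mg]] unfolding vertex_equiv_def by metis
    then have "a \<in> ray_verts (ray_tail m R) \<inter> verts (del_edges G F)"
        "b \<in> ray_verts (ray_tail n S)" "(a, b) \<in> (adj (del_edges G F))\<^sup>*"
      using rtrancl_mono[OF sub] by (auto simp: del_edges_def del_verts_def)
    then show "joined (del_edges G F) (ray_verts (ray_tail m R)) (ray_verts (ray_tail n S))"
      using joined_iff[OF multigraph_del_edges[OF mg]] by blast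
  qed
next
  assume e: "edge_equiv G R S"
  show "vertex_equiv G R S"
    unfolding vertex_equiv_def
  proof (intro allI impI)
    fix X m n assume X: "finite X \<and> X \<subseteq> verts G"
    define F where "F = (\<Union>x\<in>X. incident_edges G x)"
    have F: "finite F" "F \<subseteq> edges G"
      using X lf by (auto simp: F_def locally_finite_def incident_edges_def)
    have "edges (del_edges G F) \<subseteq> edges (del_verts G X)"
      by (auto simp: del_edges_def del_verts_def F_def incident_edges_def)
    then have sub: "adj (del_edges G F) \<subseteq> adj (del_verts G X)"
      by (auto simp: adj_def del_edges_def del_verts_def)
    have "\<forall>\<^sub>F i in sequentially. fst R i \<notin> X"
      by (rule inj_ev_notin_finite) (use X vrays_inj[OF ray_vray[OF R]] in auto)
    then obtain N where N: "\<And>i. i \<ge> N \<Longrightarrow> fst R i \<notin> X"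
      unfolding eventually_sequentially by blast
    \<comment> \<open>Deleting the edges at \<open>X\<close> leaves the vertices of \<open>X\<close>
      behind as isolated ones, so a trivial path inside \<open>X\<close> has to be ruled out. Beyond
      \<open>N\<close> the ray has left \<open>X\<close>.\<close>
    define m' where "m' = max m N"
    obtain a b where a: "a \<in> ray_verts (ray_tail m' R) \<inter> verts (del_edges G F)"
      and b: "b \<in> ray_verts (ray_tail n S)" "(a, b) \<in> (adj (del_edges G F))\<^sup>*"
      using e F joined_iff[OF multigraph_del_edges[OF mg]] unfolding edge_equiv_def by metis
    obtain i where i: "a = fst R (m' + i)" using a by (auto simp: ray_verts_def ray_tail_def)
    have "a \<notin> X" using N i m'_def by simp
    moreover have "a \<in> ray_verts (ray_tail m R)"
    proof -
      have "a = fst (ray_tail m R) (m' + i - m)" using i m'_def by (simp add: ray_tail_def)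
      then show ?thesis by (simp add: ray_verts_def)
    qed
    ultimately have "a \<in> ray_verts (ray_tail m R) \<inter> verts (del_verts G X)"
      using a by (auto simp: del_verts_def del_edges_def)
    moreover have "(a, b) \<in> (adj (del_verts G X))\<^sup>*"
      using rtrancl_mono[OF sub] b(2) by blast
    ultimately show "joined (del_verts G X) (ray_verts (ray_tail m R)) (ray_verts (ray_tail n S))"
      using joined_iff[OF multigraph_del_verts[OF mg]] b(1) by blast
  qed
qed

lemma graph_ends_eq_edge_ends:
  assumes "multigraph G" "locally_finite G"
  shows "graph_ends G = edge_ends G"
proof -
  have "{(R, S). R \<in> rays G \<and> S \<in> rays G \<and> vertex_equiv G R S} =
        {(R, S). R \<in> rays G \<and> S \<in> rays G \<and> edge_equiv G R S}"
    using vertex_equiv_iff_edge_equiv[OF assms] by auto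
  then show ?thesis by (simp add: graph_ends_def edge_ends_def)
qed

text \<open>A finite cut has finitely many endpoints, and by point-finiteness some member of the
  family contains none of them. Being connected, that member lies on one side of the cut, together
  with tails of both rays.\<close>

lemma edge_equiv_of_connected_family:
  assumes mg: "multigraph G" and R: "R \<in> rays G" and S: "S \<in> rays G"
    and inf: "infinite \<A>" and pf: "\<And>v. v \<in> verts G \<Longrightarrow> finite {A \<in> \<A>. v \<in> A}"
    and conn: "\<And>A. A \<in> \<A> \<Longrightarrow> conn_in G A"
    and RA: "\<And>A. A \<in> \<A> \<Longrightarrow> ev_in (fst R) A" and SA: "\<And>A. A \<in> \<A> \<Longrightarrow> ev_in (fst S) A"
  shows "edge_equiv G R S"
  unfolding edge_equiv_iff[OF mg R S]
proof (intro allI impI)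
  fix Y assume Y: "finite (edge_cut G Y)" "ev_in (fst R) Y"
  define X where "X = (\<Union>e\<in>edge_cut G Y. endpts G e)"
  have X: "finite X" "X \<subseteq> verts G"
    using finite_cut_endpoints[OF mg Y(1) edge_cut_subset_edges] mg edge_cut_subset_edges
    by (auto simp: X_def multigraph_def edge_cut_def)
  have "finite (\<Union>v\<in>X. {A \<in> \<A>. v \<in> A})" using X pf by blast
  then obtain A where A: "A \<in> \<A>" "A \<notin> (\<Union>v\<in>X. {A \<in> \<A>. v \<in> A})"
    using inf by (meson finite_subset subsetI)
  have "A \<inter> Y = A"
  proof (rule ccontr)
    assume "A \<inter> Y \<noteq> A"
    moreover have "A \<inter> Y \<noteq> {}" using RA[OF A(1)] Y(2) ev_in_disjoint by blast
    ultimately obtain e a b where e: "e \<in> edges G" "a \<in> A \<inter> Y" "b \<in> A - A \<inter> Y" "endpts G e = {a, b}"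
      using conn_inD[OF conn[OF A(1)], of "A \<inter> Y"] by blast
    then have "e \<in> edge_cut G Y" using edge_cut_pair[OF mg, of e a b Y] by blast
    then have "a \<in> X" using e(4) by (auto simp: X_def)
    then show False using A e(2) by blast
  qed
  then show "ev_in (fst S) Y" using SA[OF A(1)] by (blast intro: ev_in_mono)
qed

section \<open>Locally finite connected graphs\<close>

locale lfc_graph =
  fixes G :: "('v, 'e) mgraph"
  assumes mg: "multigraph G" and conn: "connected_graph G" and lf: "locally_finite G"
begin

section \<open>Countability, and rays converging to an infinite set\<close>

lemma conn_in_verts: "conn_in G (verts G)"
  using connected_graph_iff[OF mg] conn by blast

lemma finite_neighbours:
  assumes "a \<in> verts G"
  shows "finite {b. (a, b) \<in> adj G}"
proof -
  have "finite (\<Union>e\<in>incident_edges G a. endpts G e)"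
    using assms lf mg by (intro finite_cut_endpoints) (auto simp: locally_finite_def incident_edges_def)
  then show ?thesis
    by (rule finite_subset[rotated]) (auto simp: adj_def incident_edges_def)
qed

fun gball :: "'v \<Rightarrow> nat \<Rightarrow> 'v set" where
  "gball r 0 = {r}"
| "gball r (Suc n) = gball r n \<union> {b. \<exists>a\<in>gball r n. (a, b) \<in> adj G}"

lemma adj_verts: "(a, b) \<in> adj G \<Longrightarrow> a \<in> verts G \<and> b \<in> verts G"
  using mg by (auto simp: adj_def multigraph_def)

lemma gball_finite:
  assumes "r \<in> verts G"
  shows "finite (gball r n) \<and> gball r n \<subseteq> verts G"
proof (induction n)
  case (Suc n)
  have "{b. \<exists>a\<in>gball r n. (a, b) \<in> adj G} = (\<Union>a\<in>gball r n. {b. (a, b) \<in> adj G})" by blast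
  moreover have "finite \<dots>" using Suc finite_neighbours by blast
  ultimately show ?case using Suc adj_verts by auto
qed (use assms in simp)

lemma Union_gball:
  assumes "r \<in> verts G"
  shows "(\<Union>n. gball r n) = verts G"
proof (rule ccontr)
  assume n: "(\<Union>n. gball r n) \<noteq> verts G"
  have "(\<Union>n. gball r n) \<subseteq> verts G" using gball_finite[OF assms] by blast
  moreover have "r \<in> gball r 0" by simp
  then have "(\<Union>n. gball r n) \<noteq> {}" by blast
  ultimately obtain e a b where e: "e \<in> edges G" "a \<in> (\<Union>n. gball r n)" "b \<in> verts G - (\<Union>n. gball r n)" "endpts G e = {a, b}"
    using conn_inD[OF conn_in_verts] n by metis
  then obtain n where "a \<in> gball r n" by blast
  then have "b \<in> gball r (Suc n)" using e by (auto simp: adj_def)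
  then show False using e(3) by blast
qed

lemma countable_verts: "countable (verts G)"
proof -
  obtain r where r: "r \<in> verts G" using conn by (auto simp: connected_graph_def)
  have "countable (\<Union>n. gball r n)"
    using gball_finite[OF r] by (intro countable_UN) (auto intro: countable_finite)
  then show ?thesis using Union_gball[OF r] by simp
qed

text \<open>The ray descends in a breadth-first spanning tree, always into a child with infinitely
  many descendants in \<open>U\<close>. The second property says that the ray converges to
  \<open>U\<close>: far down, a whole subtree lies on the same side of a finite cut as the
  ray.\<close>

lemma koenig:
  assumes U: "U \<subseteq> verts G" "infinite U"
  obtains v where "v \<in> vrays G" "\<And>C. finite (edge_cut G C) \<Longrightarrow> ev_in v C \<Longrightarrow> infinite (C \<inter> U)"
proof -
  obtain r where r: "r \<in> verts G" using conn by (auto simp: connected_graph_def)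
  define d where "d u = (LEAST n. u \<in> gball r n)" for u
  have d: "u \<in> gball r (d u)" if "u \<in> verts G" for u
    unfolding d_def by (rule LeastI_ex) (use that Union_gball[OF r] in blast)
  have d_le: "d u \<le> n" if "u \<in> gball r n" for u n
    unfolding d_def using that by (rule Least_le)
  have "\<exists>w. (w, u) \<in> adj G \<and> d u = Suc (d w)" if u: "u \<in> verts G" "d u \<noteq> 0" for u
  proof -
    obtain n where n: "d u = Suc n" using u(2) by (cases "d u") auto
    have "u \<notin> gball r n" using d_le[of u n] n by auto
    then obtain w where w: "w \<in> gball r n" "(w, u) \<in> adj G" using d[OF u(1)] n by auto
    have "w \<in> verts G" using w(2) adj_verts by blast
    then have "u \<in> gball r (Suc (d w))" using d w(2) by auto
    then have "d u = Suc (d w)" using d_le d_le[OF w(1)] n by (metis Suc_le_mono le_antisym)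
    then show ?thesis using w(2) by blast
  qed
  then obtain \<pi> where \<pi>: "\<And>u. u \<in> verts G \<Longrightarrow> d u \<noteq> 0 \<Longrightarrow> (\<pi> u, u) \<in> adj G \<and> d u = Suc (d (\<pi> u))"
    by metis
  define T where "T = {(\<pi> u, u) | u. u \<in> verts G \<and> d u \<noteq> 0}"
  have T: "(w, u) \<in> adj G" "d u = Suc (d w)" "u \<in> verts G" if "(w, u) \<in> T" for w u
    using that \<pi> by (auto simp: T_def)
  define Desc where "Desc w = {u. (w, u) \<in> T\<^sup>*}" for w
  have Desc_root: "verts G \<subseteq> Desc r"
  proof
    fix u assume "u \<in> verts G"
    then show "u \<in> Desc r"
    proof (induction "d u" arbitrary: u)
      case 0
      then have "u = r" using d[OF 0(2)] by simp
      then show ?case by (simp add: Desc_def)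
    next
      case (Suc n)
      have p: "(\<pi> u, u) \<in> adj G" "d u = Suc (d (\<pi> u))"
        using \<pi>[OF Suc(3)] Suc(2) by auto
      have "\<pi> u \<in> Desc r"
        using Suc(1)[of "\<pi> u"] Suc(2) p adj_verts by auto
      moreover have "(\<pi> u, u) \<in> T" using Suc(2,3) unfolding T_def by auto
      ultimately show ?case unfolding Desc_def by (auto intro: rtrancl_into_rtrancl)
    qed
  qed
  \<comment> \<open>The depth \<open>d w = n\<close> is carried along because it makes the vertices
    of the branch distinct.\<close>
  define P where "P n w \<longleftrightarrow> w \<in> verts G \<and> infinite (Desc w \<inter> U) \<and> d w = n" for n :: nat and w
  have "\<exists>v. \<forall>n. P n (v n) \<and> (v n, v (Suc n)) \<in> T"
  proof (rule dependent_nat_choice)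
    have "Desc r \<inter> U = U" using Desc_root U(1) by blast
    moreover have "d r = 0" using d_le[of r 0] by simp
    ultimately show "\<exists>w. P 0 w" using r U(2) by (auto simp: P_def)
  next
    fix w n assume w: "P n w"
    have "finite {c. (w, c) \<in> T}"
      by (rule finite_subset[OF _ finite_neighbours[of w]]) (use w T(1) in \<open>auto simp: P_def\<close>)
    moreover have "Desc w \<inter> U \<subseteq> insert w (\<Union>c\<in>{c. (w, c) \<in> T}. Desc c \<inter> U)"
      by (auto simp: Desc_def elim: converse_rtranclE)
    ultimately have "\<exists>c. (w, c) \<in> T \<and> infinite (Desc c \<inter> U)"
      using w unfolding P_def by (metis (no_types, lifting) finite_UN finite_insert mem_Collect_eq rev_finite_subset)
    then show "\<exists>c. P (Suc n) c \<and> (w, c) \<in> T"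
      using w T unfolding P_def by metis
  qed
  then obtain v where v: "\<And>n. P n (v n)" "\<And>n. (v n, v (Suc n)) \<in> T" by blast
  show thesis
  proof (rule that)
    have "inj v" using v(1) unfolding P_def by (metis injI)
    moreover have "\<exists>e\<in>edges G. endpts G e = {v i, v (Suc i)}" for i
      using T(1)[OF v(2)[of i]] by (simp add: adj_def)
    ultimately show "v \<in> vrays G" using v(1) by (auto simp: vrays_def P_def)
    fix C assume C: "finite (edge_cut G C)" "ev_in v C"
    define X where "X = (\<Union>e\<in>edge_cut G C. endpts G e)"
    have "finite X" unfolding X_def by (rule finite_cut_endpoints[OF mg C(1) edge_cut_subset_edges])
    then have "finite (d ` X)" by simp
    then obtain N where N: "\<And>x. x \<in> X \<Longrightarrow> d x < N"
      by (metis finite_nat_set_iff_bounded imageI)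
    obtain n where n: "n \<ge> N" "v n \<in> C"
      using C(2) unfolding eventually_sequentially by (meson linorder_linear)
    \<comment> \<open>Vertices at depth at least \<open>N\<close> are not in \<open>X\<close>, so no
      tree edge below \<open>v n\<close> belongs to the cut.\<close>
    have "u \<in> C \<and> d u \<ge> n" if "(v n, u) \<in> T\<^sup>*" for u
      using that
    proof (induction rule: rtrancl_induct)
      case base
      then show ?case using n v(1)[of n] by (simp add: P_def)
    next
      case (step y z)
      obtain e where e: "e \<in> edges G" "endpts G e = {y, z}"
        using T(1)[OF step.hyps(2)] by (auto simp: adj_def)
      have "e \<notin> edge_cut G C"
      proof
        assume "e \<in> edge_cut G C"
        then have "y \<in> X" using e(2) by (auto simp: X_def)
        then show False using N step.IH n(1) by (meson leD le_trans)
      qed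
      then have "z \<in> C" using edge_cut_pair[OF mg e] step.IH by blast
      then show ?case using step.IH T(2)[OF step.hyps(2)] by simp
    qed
    then have "Desc (v n) \<subseteq> C" by (auto simp: Desc_def)
    then have "Desc (v n) \<inter> U \<subseteq> C \<inter> U" by blast
    then show "infinite (C \<inter> U)" using v(1)[of n] unfolding P_def by (meson finite_subset)
  qed
qed

end

section \<open>Menger's theorem for edge-disjoint paths\<close>

text \<open>The triple \<open>(e, u, v)\<close> is the edge \<open>e\<close> traversed from \<open>u\<close> to \<open>v\<close>. A flow is a finite set of such
  triples, using no edge in both directions, that is conserved outside \<open>A \<union> B\<close>.\<close>

definition dart :: "('v, 'e) mgraph \<Rightarrow> 'e \<times> 'v \<times> 'v \<Rightarrow> bool" where
  "dart G d \<longleftrightarrow> (case d of (e, u, v) \<Rightarrow> e \<in> edges G \<and> endpts G e = {u, v})"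

definition flip :: "'e \<times> 'v \<times> 'v \<Rightarrow> 'e \<times> 'v \<times> 'v" where
  "flip d = (case d of (e, u, v) \<Rightarrow> (e, v, u))"

definition outflow :: "'v set \<Rightarrow> 'e \<times> 'v \<times> 'v \<Rightarrow> int" where
  "outflow S d = (case d of (e, u, v) \<Rightarrow> of_bool (u \<in> S) - of_bool (v \<in> S))"

definition net :: "('e \<times> 'v \<times> 'v) set \<Rightarrow> 'v set \<Rightarrow> int" where
  "net D S = (\<Sum>d\<in>D. outflow S d)"

definition flow :: "('v, 'e) mgraph \<Rightarrow> 'v set \<Rightarrow> 'v set \<Rightarrow> ('e \<times> 'v \<times> 'v) set \<Rightarrow> bool" where
  "flow G A B D \<longleftrightarrow> finite D \<and> (\<forall>d\<in>D. dart G d \<and> flip d \<notin> D) \<and> (\<forall>u. u \<notin> A \<union> B \<longrightarrow> net D {u} = 0)"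

definition path_darts :: "'v list \<Rightarrow> 'e list \<Rightarrow> ('e \<times> 'v \<times> 'v) set" where
  "path_darts vs es = (\<lambda>i. (es ! i, vs ! i, vs ! Suc i)) ` {..<length es}"

section \<open>Net flow out of a vertex set\<close>

lemma flip_flip [simp]: "flip (flip d) = d"
  by (simp add: flip_def split: prod.splits)

lemma outflow_flip: "outflow S (flip d) = - outflow S d"
  by (simp add: flip_def outflow_def split: prod.splits)

lemma net_Un: "A \<inter> B = {} \<Longrightarrow> net D (A \<union> B) = net D A + net D B"
  unfolding net_def sum.distrib[symmetric]
  by (rule sum.cong) (auto simp: outflow_def split: prod.splits)

text \<open>\<open>X\<close> may be infinite, so the sum over its vertices is restricted to the
  finite set \<open>T\<close> of ends of darts in \<open>D\<close>.\<close>

lemma net_conserved: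
  assumes D: "finite D" and zero: "\<And>u. u \<in> X \<Longrightarrow> net D {u} = 0"
  shows "net D X = 0"
proof -
  define T where "T = (\<lambda>(e, u, v). u) ` D \<union> (\<lambda>(e, u, v). v) ` D"
  have T: "finite T" "\<And>e u v. (e, u, v) \<in> D \<Longrightarrow> u \<in> T \<and> v \<in> T"
    using D by (force simp: T_def)+
  have fin: "net D Y = (\<Sum>u\<in>Y. net D {u})" if "finite Y" for Y
    using that
  proof (induction Y rule: finite_induct)
    case empty
    then show ?case by (simp add: net_def outflow_def split_def)
  next
    case (insert y Y)
    then have "net D ({y} \<union> Y) = net D {y} + net D Y" by (intro net_Un) simp
    then show ?case using insert by simp
  qed
  have "net D X = net D (X \<inter> T)"
    unfolding net_def using T(2) by (intro sum.cong) (auto simp: outflow_def split: prod.splits)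
  also have "\<dots> = 0"
    using fin[of "X \<inter> T"] T(1) zero by simp
  finally show ?thesis .
qed

lemma path_darts_facts:
  assumes "is_path G vs es"
  shows "finite (path_darts vs es)" "\<And>d. d \<in> path_darts vs es \<Longrightarrow> dart G d"
    "\<And>d. d \<in> path_darts vs es \<Longrightarrow> flip d \<notin> path_darts vs es"
    "net (path_darts vs es) S = of_bool (hd vs \<in> S) - of_bool (last vs \<in> S)"
    "set es = fst ` path_darts vs es"
proof -
  have p: "length vs = Suc (length es)" "distinct vs" "set es \<subseteq> edges G"
      "\<And>i. i < length es \<Longrightarrow> endpts G (es ! i) = {vs ! i, vs ! Suc i}"
    using assms by (auto simp: is_path_def)
  show "finite (path_darts vs es)" by (simp add: path_darts_def)
  show "dart G d" if "d \<in> path_darts vs es" for d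
    using that p by (auto simp: path_darts_def dart_def)
  have inj: "i = j" if "vs ! i = vs ! j" "i \<le> length es" "j \<le> length es" for i j
    using that p by (simp add: nth_eq_iff_index_eq)
  show "flip d \<notin> path_darts vs es" if d: "d \<in> path_darts vs es" for d
  proof
    assume "flip d \<in> path_darts vs es"
    then obtain j where j: "flip d = (es ! j, vs ! j, vs ! Suc j)" "j < length es"
      unfolding path_darts_def by blast
    obtain i where i: "d = (es ! i, vs ! i, vs ! Suc i)" "i < length es"
      using d unfolding path_darts_def by blast
    have "vs ! Suc i = vs ! j" "vs ! i = vs ! Suc j"
      using i j by (simp_all add: flip_def)
    then have "Suc i = j" "i = Suc j"
      using inj i(2) j(2) by auto
    then show False by simp
  qed
  have "inj_on (\<lambda>i. (es ! i, vs ! i, vs ! Suc i)) {..<length es}"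
    by (rule inj_onI) (use inj in auto)
  then have "net (path_darts vs es) S = (\<Sum>i<length es. outflow S (es ! i, vs ! i, vs ! Suc i))"
    unfolding net_def path_darts_def by (simp add: sum.reindex)
  also have "\<dots> = (\<Sum>i<length es. (of_bool (vs ! i \<in> S) - of_bool (vs ! Suc i \<in> S)))"
    by (simp add: outflow_def)
  also have "\<dots> = of_bool (vs ! 0 \<in> S) - of_bool (vs ! length es \<in> S)"
    by (rule sum_lessThan_telescope')
  also have "vs ! 0 = hd vs" using p(1) by (cases vs) auto
  also have "vs ! length es = last vs" using p(1) by (cases vs rule: rev_cases) (auto simp: nth_append)
  finally show "net (path_darts vs es) S = of_bool (hd vs \<in> S) - of_bool (last vs \<in> S)" .
  show "set es = fst ` path_darts vs es"
    by (auto simp: path_darts_def image_image set_conv_nth)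
qed

lemma net_Diff:
  assumes "finite D" "Q \<subseteq> D"
  shows "net (D - Q) S = net D S - net Q S"
  unfolding net_def using assms by (rule sum_diff)

lemma dart_unique:
  assumes "dart G (e, u, v)" "dart G (e, u', v')"
  shows "(e, u', v') = (e, u, v) \<or> (e, u', v') = flip (e, u, v)"
  using assms by (auto simp: dart_def flip_def doubleton_eq_iff)

lemma reach_from_set:
  assumes "b \<in> r\<^sup>* `` A"
  obtains vs where "vs \<noteq> []" "hd vs \<in> A" "last vs = b" "distinct vs" "successively (\<lambda>u v. (u, v) \<in> r) vs"
proof -
  obtain a where "a \<in> A" "(a, b) \<in> r\<^sup>*" using assms by blast
  then show ?thesis using rtrancl_imp_distinct_list[of a b r] that by metis
qed

text \<open>Serves both for augmenting paths and for the paths peeled off a flow; the two uses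
  differ in the admissible darts \<open>Q\<close>.\<close>

lemma path_of_darts:
  assumes mg: "multigraph G" and A: "A \<subseteq> verts G" and AB: "A \<inter> B = {}"
    and b: "b \<in> B" "b \<in> {(u, v). \<exists>e. dart G (e, u, v) \<and> Q e u v}\<^sup>* `` A"
  obtains vs es where "is_path G vs es" "hd vs \<in> A" "last vs = b" "es \<noteq> []"
    "\<And>i. i < length es \<Longrightarrow> Q (es ! i) (vs ! i) (vs ! Suc i)"
proof -
  obtain vs where vs: "vs \<noteq> []" "hd vs \<in> A" "last vs = b" "distinct vs"
      "successively (\<lambda>u v. (u, v) \<in> {(u, v). \<exists>e. dart G (e, u, v) \<and> Q e u v}) vs"
    using b(2) by (rule reach_from_set)
  have S: "successively (\<lambda>u v. \<exists>e\<in>edges G. endpts G e = {u, v} \<and> Q e u v) vs"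
    using vs(5) by (rule successively_mono) (auto simp: dart_def)
  have "successively (\<lambda>u v. (u, v) \<in> adj G) vs"
    using vs(5) by (rule successively_mono) (auto simp: dart_def adj_def)
  then have V: "set vs \<subseteq> verts G"
    using distinct_list_verts[OF mg vs(1)] vs(2) A by blast
  obtain es where es: "is_path G vs es" "\<And>i. i < length es \<Longrightarrow> Q (es ! i) (vs ! i) (vs ! Suc i)"
    using path_of_distinct_list[OF vs(1) vs(4) S V] by metis
  have "es \<noteq> []"
  proof
    assume "es = []"
    then have "length vs = 1" using es(1) by (simp add: is_path_def)
    then have "hd vs = last vs" by (cases vs) auto
    then show False using vs(2,3) b(1) AB by auto
  qed
  then show ?thesis using that es vs by blast
qed

text \<open>Admissible darts are those outside \<open>D\<close>: free edges in either direction and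
  used edges against the flow. If they do not lead from \<open>A\<close> to \<open>B\<close>, the
  cut of the reachable set is saturated outwards. Hence that cut is finite and has at most
  \<open>k\<close> edges, even though the graph may be infinite.\<close>

lemma flow_augment:
  assumes mg: "multigraph G" and A: "A \<subseteq> verts G" and B: "B \<subseteq> verts G" and AB: "A \<inter> B = {}"
    and cuts: "\<And>Z. B \<subseteq> Z \<Longrightarrow> Z \<subseteq> verts G - A \<Longrightarrow> finite (edge_cut G Z) \<Longrightarrow> Suc k \<le> cut_size G Z"
    and D: "flow G A B D" "net D A = int k"
  obtains D' where "flow G A B D'" "net D' A = int (Suc k)"
proof -
  have finD: "finite D" and dD: "\<And>d. d \<in> D \<Longrightarrow> dart G d" and aD: "\<And>d. d \<in> D \<Longrightarrow> flip d \<notin> D"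
    and cD: "\<And>u. u \<notin> A \<union> B \<Longrightarrow> net D {u} = 0"
    using D(1) by (auto simp: flow_def)
  define Q where "Q e u v \<longleftrightarrow> (e, u, v) \<notin> D" for e u v
  define r where "r = {(u, v). \<exists>e. dart G (e, u, v) \<and> Q e u v}"
  define S where "S = r\<^sup>* `` A"
  have "S \<inter> B \<noteq> {}"
  proof
    assume SB: "S \<inter> B = {}"
    have AS: "A \<subseteq> S" by (auto simp: S_def)
    define Z where "Z = verts G - S"
    have closed: "v \<in> S" if "dart G (e, u, v)" "(e, u, v) \<notin> D" "u \<in> S" for e u v
      using that unfolding S_def r_def Q_def by (auto intro: rtrancl_into_rtrancl)
    have crossing: "\<exists>u v. (e, u, v) \<in> D \<and> u \<in> S \<and> v \<notin> S" if e: "e \<in> edge_cut G S" for e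
    proof -
      obtain a b where ab: "e \<in> edges G" "a \<in> S" "b \<notin> S" "endpts G e = {a, b}"
        using e mg by (auto simp: mem_edge_cut)
      then have "dart G (e, a, b)" by (simp add: dart_def)
      then have "(e, a, b) \<in> D" using closed ab by blast
      then show ?thesis using ab by blast
    qed
    have noback: False if "(e, u, v) \<in> D" "u \<notin> S" "v \<in> S" for e u v
    proof -
      have "(e, v, u) \<notin> D" using aD[OF that(1)] by (simp add: flip_def)
      moreover have "dart G (e, v, u)" using dD[OF that(1)] by (auto simp: dart_def)
      ultimately show False using closed that by blast
    qed
    \<comment> \<open>The darts of \<open>D\<close> that cross the boundary of \<open>S\<close>. By
      \<open>noback\<close> all of them point outwards, so the net flow out of \<open>S\<close>
      counts them.\<close>
    define X where "X = {d \<in> D. outflow S d \<noteq> 0}"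
    have X: "d \<in> X \<longleftrightarrow> d \<in> D \<and> fst (snd d) \<in> S \<and> snd (snd d) \<notin> S" for d
      using noback by (cases d) (auto simp: X_def outflow_def)
    have one: "outflow S d = 1" if "d \<in> X" for d
      using that unfolding X by (cases d) (auto simp: outflow_def)
    have "edge_cut G S \<subseteq> fst ` X"
    proof
      fix e assume "e \<in> edge_cut G S"
      then obtain u v where "(e, u, v) \<in> D" "u \<in> S" "v \<notin> S" using crossing by blast
      then have "(e, u, v) \<in> X" using X by simp
      then show "e \<in> fst ` X" by (rule rev_image_eqI) simp
    qed
    moreover have finX: "finite X" using finD by (simp add: X_def)
    ultimately have fin: "finite (edge_cut G S)" and "card (edge_cut G S) \<le> card X"
      by (auto intro: finite_subset surj_card_le)
    moreover have "net D S = int (card X)"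
    proof -
      have "net D S = (\<Sum>d\<in>X. outflow S d)"
        unfolding net_def by (rule sum.mono_neutral_right) (use finD in \<open>auto simp: X_def\<close>)
      then show ?thesis using one by simp
    qed
    moreover have "net D S = int k"
    proof -
      have "net D (A \<union> (S - A)) = net D A + net D (S - A)" by (rule net_Un) blast
      moreover have "net D (S - A) = 0"
        by (rule net_conserved[OF finD]) (use SB cD in blast)
      moreover have "A \<union> (S - A) = S" using AS by blast
      ultimately show ?thesis using D(2) by simp
    qed
    moreover have "Suc k \<le> cut_size G Z"
      by (rule cuts) (use AS SB B fin in \<open>auto simp: Z_def edge_cut_compl[OF mg]\<close>)
    ultimately show False
      by (simp add: cut_size_def Z_def edge_cut_compl[OF mg])
  qed
  then obtain b where b: "b \<in> B" "b \<in> r\<^sup>* `` A" unfolding S_def by blast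
  obtain vs es where p: "is_path G vs es" "hd vs \<in> A" "last vs = b" "es \<noteq> []"
      "\<And>i. i < length es \<Longrightarrow> Q (es ! i) (vs ! i) (vs ! Suc i)"
    using path_of_darts[OF mg A AB b(1) b(2)[unfolded r_def]] by metis
  define P where "P = path_darts vs es"
  note P = path_darts_facts[OF p(1), folded P_def]
  have PD: "P \<inter> D = {}"
    using p(5) by (auto simp: P_def path_darts_def Q_def)
  \<comment> \<open>Darts in \<open>P1\<close> run against the flow and cancel a dart of
    \<open>D\<close>; those in \<open>P2\<close> are added. Either way the net flow changes by that
    of the path.\<close>
  define P1 where "P1 = {d \<in> P. flip d \<in> D}"
  define P2 where "P2 = {d \<in> P. flip d \<notin> D}"
  define D' where "D' = (D - flip ` P1) \<union> P2"
  have fl: "flip ` P1 \<subseteq> D" by (auto simp: P1_def)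
  have inj: "inj_on flip X" for X :: "('b \<times> 'a \<times> 'a) set" by (rule inj_onI) (metis flip_flip)
  have net': "net D' S = net D S + net P S" for S
  proof -
    have "net D' S = net (D - flip ` P1) S + net P2 S"
      unfolding net_def D'_def
      by (rule sum.union_disjoint) (use finD P(1) PD in \<open>auto simp: P2_def\<close>)
    also have "net (D - flip ` P1) S = net D S - net (flip ` P1) S"
      using finD fl by (rule net_Diff)
    also have "net (flip ` P1) S = - net P1 S"
      unfolding net_def sum.reindex[OF inj] by (simp add: outflow_flip sum_negf)
    also have "net P S = net P1 S + net P2 S"
    proof -
      have "P = P1 \<union> P2" by (auto simp: P1_def P2_def)
      moreover have "net (P1 \<union> P2) S = net P1 S + net P2 S"
        unfolding net_def by (rule sum.union_disjoint) (use P(1) in \<open>auto simp: P1_def P2_def\<close>)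
      ultimately show ?thesis by simp
    qed
    ultimately show ?thesis by simp
  qed
  have "flip d \<notin> D'" if d: "d \<in> D'" for d
  proof
    assume f: "flip d \<in> D'"
    show False
    proof (cases "d \<in> P2")
      case True
      then have "flip d \<in> P2" using f by (auto simp: D'_def P2_def)
      then show False using True P(3) by (auto simp: P2_def)
    next
      case False
      then have dd: "d \<in> D" "d \<notin> flip ` P1" using d by (auto simp: D'_def)
      then have "flip d \<in> P2" using f aD by (auto simp: D'_def)
      then show False using dd by (auto simp: P2_def)
    qed
  qed
  moreover have "dart G d" if "d \<in> D'" for d
    using that dD[of d] P(2)[of d] unfolding D'_def P2_def by blast
  moreover have "finite D'" using finD P(1) by (simp add: D'_def P2_def)
  moreover have "net D' {u} = 0" if "u \<notin> A \<union> B" for u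
    using that net'[of "{u}"] cD P(4)[of "{u}"] p(2,3) b(1) by auto
  ultimately have "flow G A B D'" by (simp add: flow_def)
  moreover have "net D' A = int (Suc k)"
    using net'[of A] P(4)[of A] p(2,3) b(1) AB D(2) by auto
  ultimately show ?thesis by (rule that)
qed

text \<open>Paths are peeled off one at a time; circulations may remain in the flow and do no harm.
  Forbidding steps out of \<open>B\<close> and into \<open>A\<close> makes each path meet these sets
  only at its ends.\<close>

lemma flow_decompose:
  assumes mg: "multigraph G" and A: "A \<subseteq> verts G" and AB: "A \<inter> B = {}"
    and D: "flow G A B D" "net D A = int k"
  shows "\<exists>\<P>. finite \<P> \<and> card \<P> = k \<and> pairwise (\<lambda>P Q. disjnt (set (snd P)) (set (snd Q))) \<P> \<and>
    (\<forall>(vs, es)\<in>\<P>. is_path G vs es \<and> hd vs \<in> A \<and> last vs \<in> B \<and> es \<noteq> [] \<and> path_darts vs es \<subseteq> D \<and>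
      (\<forall>i<length es. vs ! i \<notin> B \<and> vs ! Suc i \<notin> A))"
  using D
proof (induction k arbitrary: D)
  case 0
  then show ?case by (intro exI[of _ "{}"]) simp
next
  case (Suc k)
  have finD: "finite D" and dD: "\<And>d. d \<in> D \<Longrightarrow> dart G d" and aD: "\<And>d. d \<in> D \<Longrightarrow> flip d \<notin> D"
    and cD: "\<And>u. u \<notin> A \<union> B \<Longrightarrow> net D {u} = 0"
    using Suc.prems(1) by (auto simp: flow_def)
  define R where "R e u v \<longleftrightarrow> (e, u, v) \<in> D \<and> u \<notin> B \<and> v \<notin> A" for e u v
  define r where "r = {(u, v). \<exists>e. dart G (e, u, v) \<and> R e u v}"
  define S where "S = r\<^sup>* `` A"
  have "S \<inter> B \<noteq> {}"
  proof
    assume SB: "S \<inter> B = {}"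
    have AS: "A \<subseteq> S" by (auto simp: S_def)
    \<comment> \<open>No dart of \<open>D\<close> leaves \<open>S\<close>: it does not start in
      \<open>B\<close> because \<open>S\<close> misses \<open>B\<close>, and a final vertex in
      \<open>A\<close> is in \<open>S\<close> anyway. So the net flow out of \<open>S\<close> is not
      positive, while conservation makes it \<open>Suc k\<close>.\<close>
    have "v \<in> S" if "(e, u, v) \<in> D" "u \<in> S" for e u v
    proof (cases "v \<in> A")
      case False
      then have "(u, v) \<in> r" using that SB dD unfolding r_def R_def by blast
      then show ?thesis using that(2) unfolding S_def by (auto intro: rtrancl_into_rtrancl)
    qed (use AS in blast)
    then have "outflow S d \<le> 0" if "d \<in> D" for d
      using that by (cases d) (auto simp: outflow_def)
    then have "net D S \<le> 0" unfolding net_def by (rule sum_nonpos)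
    moreover have "net D S = int (Suc k)"
    proof -
      have "net D (A \<union> (S - A)) = net D A + net D (S - A)" by (rule net_Un) blast
      moreover have "net D (S - A) = 0"
        by (rule net_conserved[OF finD]) (use SB cD in blast)
      moreover have "A \<union> (S - A) = S" using AS by blast
      ultimately show ?thesis using Suc.prems(2) by simp
    qed
    ultimately show False by simp
  qed
  then obtain b where b: "b \<in> B" "b \<in> r\<^sup>* `` A" unfolding S_def by blast
  obtain vs es where p: "is_path G vs es" "hd vs \<in> A" "last vs = b" "es \<noteq> []"
      "\<And>i. i < length es \<Longrightarrow> R (es ! i) (vs ! i) (vs ! Suc i)"
    using path_of_darts[OF mg A AB b(1) b(2)[unfolded r_def]] by metis
  define P where "P = path_darts vs es"
  note P = path_darts_facts[OF p(1), folded P_def]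
  have PD: "P \<subseteq> D"
    using p(5) by (auto simp: P_def path_darts_def R_def)
  have net': "net (D - P) S = net D S - net P S" for S
    using finD PD by (rule net_Diff)
  have "net (D - P) {u} = 0" if "u \<notin> A \<union> B" for u
    using that net'[of "{u}"] cD P(4)[of "{u}"] p(2,3) b(1) by auto
  then have fl: "flow G A B (D - P)" using finD dD aD by (auto simp: flow_def)
  have nt: "net (D - P) A = int k"
    using net'[of A] P(4)[of A] p(2,3) b(1) AB Suc.prems(2) by auto
  obtain \<P> where \<P>': "finite \<P> \<and> card \<P> = k \<and> pairwise (\<lambda>P Q. disjnt (set (snd P)) (set (snd Q))) \<P> \<and>
    (\<forall>(vs, es)\<in>\<P>. is_path G vs es \<and> hd vs \<in> A \<and> last vs \<in> B \<and> es \<noteq> [] \<and> path_darts vs es \<subseteq> D - P \<and>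
      (\<forall>i<length es. vs ! i \<notin> B \<and> vs ! Suc i \<notin> A))"
    using Suc.IH[OF fl nt] by (rule exE)
  have \<P>: "finite \<P>" "card \<P> = k" "pairwise (\<lambda>P Q. disjnt (set (snd P)) (set (snd Q))) \<P>"
    using \<P>' by simp_all
  have \<P>4: "is_path G vs es \<and> hd vs \<in> A \<and> last vs \<in> B \<and> es \<noteq> [] \<and> path_darts vs es \<subseteq> D - P \<and>
      (\<forall>i<length es. vs ! i \<notin> B \<and> vs ! Suc i \<notin> A)" if "(vs, es) \<in> \<P>" for vs es
    using \<P>' that by blast
  have disj: "set es' \<inter> set es = {}" if "(vs', es') \<in> \<P>" for vs' es'
  proof (rule ccontr)
    assume "set es' \<inter> set es \<noteq> {}"
    then obtain e where e: "e \<in> set es'" "e \<in> set es" by blast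
    have "path_darts vs' es' \<subseteq> D - P" "set es' = fst ` path_darts vs' es'"
      using \<P>4[OF that] path_darts_facts(5)[of G vs' es'] by simp_all
    then obtain u v where uv: "(e, u, v) \<in> D - P" using e(1) by auto
    obtain u' v' where uv': "(e, u', v') \<in> P" using e(2) P(5) by auto
    \<comment> \<open>\<open>D\<close> holds at most one of the two darts of an edge, so an edge
      shared with the peeled path would give a dart both in \<open>P\<close> and outside it.\<close>
    have "(e, u', v') = (e, u, v) \<or> (e, u', v') = flip (e, u, v)"
      using uv uv' PD dD by (intro dart_unique[of G]) auto
    then show False using uv uv' PD aD by auto
  qed
  have new: "(vs, es) \<notin> \<P>" using disj[of vs es] p(4) by auto
  show ?case
  proof (intro exI[of _ "insert (vs, es) \<P>"] conjI)
    show "finite (insert (vs, es) \<P>)" "card (insert (vs, es) \<P>) = Suc k"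
      using \<P>(1,2) new by auto
    show "pairwise (\<lambda>P Q. disjnt (set (snd P)) (set (snd Q))) (insert (vs, es) \<P>)"
      using \<P>(3) disj by (fastforce simp: pairwise_insert disjnt_def)
    have "\<forall>i<length es. vs ! i \<notin> B \<and> vs ! Suc i \<notin> A"
      using p(5) by (simp add: R_def)
    then show "\<forall>(vs, es)\<in>insert (vs, es) \<P>. is_path G vs es \<and> hd vs \<in> A \<and> last vs \<in> B \<and> es \<noteq> [] \<and>
        path_darts vs es \<subseteq> D \<and> (\<forall>i<length es. vs ! i \<notin> B \<and> vs ! Suc i \<notin> A)"
      using \<P>4 p(1-4) b(1) PD P_def by auto
  qed
qed

text \<open>Starting from the empty flow, augmentation succeeds up to the value \<open>k\<close>.
  Lower bounds are asked of finite cuts alone, since an infinite cut obstructs no finite number of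
  paths; \<open>A\<close> and \<open>B\<close> may be infinite.\<close>

theorem edge_menger:
  assumes mg: "multigraph G" and A: "A \<subseteq> verts G" and B: "B \<subseteq> verts G" and AB: "A \<inter> B = {}"
    and cuts: "\<And>Z. B \<subseteq> Z \<Longrightarrow> Z \<subseteq> verts G - A \<Longrightarrow> finite (edge_cut G Z) \<Longrightarrow> k \<le> cut_size G Z"
  obtains \<P> where "finite \<P>" "card \<P> = k" "pairwise (\<lambda>P Q. disjnt (set (snd P)) (set (snd Q))) \<P>"
    "\<forall>(vs, es)\<in>\<P>. is_path G vs es \<and> hd vs \<in> A \<and> last vs \<in> B \<and> es \<noteq> [] \<and>
      (\<forall>i<length es. vs ! i \<notin> B \<and> vs ! Suc i \<notin> A)"
proof -
  have "\<exists>D. flow G A B D \<and> net D A = int j" if "j \<le> k" for j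
    using that
  proof (induction j)
    case 0
    have "flow G A B {}" "net ({} :: ('b \<times> 'a \<times> 'a) set) A = int 0"
      by (simp_all add: flow_def net_def)
    then show ?case by blast
  next
    case (Suc j)
    then obtain D where D: "flow G A B D" "net D A = int j" by auto
    have "Suc j \<le> cut_size G Z" if "B \<subseteq> Z" "Z \<subseteq> verts G - A" "finite (edge_cut G Z)" for Z
      using cuts[OF that] Suc.prems by simp
    then show ?case using flow_augment[OF mg A B AB _ D] by metis
  qed
  then obtain D where "flow G A B D" "net D A = int k" by blast
  from flow_decompose[OF mg A AB this] obtain \<P> where "finite \<P>" "card \<P> = k"
    "pairwise (\<lambda>P Q. disjnt (set (snd P)) (set (snd Q))) \<P>"
    "\<forall>(vs, es)\<in>\<P>. is_path G vs es \<and> hd vs \<in> A \<and> last vs \<in> B \<and> es \<noteq> [] \<and> path_darts vs es \<subseteq> D \<and>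
      (\<forall>i<length es. vs ! i \<notin> B \<and> vs ! Suc i \<notin> A)" by blast
  then show ?thesis by (intro that[of \<P>]) auto
qed

section \<open>Uncrossing\<close>

definition nest :: "'v set \<Rightarrow> 'v set \<Rightarrow> bool" where
  "nest A B \<longleftrightarrow> A \<inter> B = {} \<or> A \<subseteq> B \<or> B \<subseteq> A"

text \<open>Uncrossing \<open>Z\<close> with \<open>C\<close> creates no new crossing with a set
  \<open>D\<close> that respects both, so the number of crossings falls.\<close>

lemma nest_uncross:
  assumes "nest C D" "nest Z D" "\<not> nest Z C"
  shows "nest (Z \<union> C) D" "nest (Z - C) D"
  using assms unfolding nest_def by blast+

lemma nest_uncross_self: "nest (Z \<union> C) C" "nest (Z - C) C"
  unfolding nest_def by blast+

text \<open>Such a chain is well-ordered by inclusion in both directions. If \<open>M\<close> is the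
  largest member with finitely many members below it, the smallest member not contained in
  \<open>M\<close> again has only finitely many below it.\<close>

lemma finite_of_chain_Inter_Union_mem:
  assumes chain: "\<And>A B. A \<in> \<C> \<Longrightarrow> B \<in> \<C> \<Longrightarrow> A \<subseteq> B \<or> B \<subseteq> A"
    and mem: "\<And>\<S>. \<S> \<subseteq> \<C> \<Longrightarrow> \<S> \<noteq> {} \<Longrightarrow> \<Inter>\<S> \<in> \<S> \<and> \<Union>\<S> \<in> \<S>"
  shows "finite \<C>"
proof (rule ccontr)
  assume inf: "infinite \<C>"
  define \<S> where "\<S> = {D \<in> \<C>. finite {D' \<in> \<C>. D' \<subseteq> D}}"
  have "\<C> \<noteq> {}" using inf by auto
  then have "\<Inter>\<C> \<in> \<C>" using mem by blast
  moreover have "{D' \<in> \<C>. D' \<subseteq> \<Inter>\<C>} \<subseteq> {\<Inter>\<C>}" by auto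
  ultimately have "\<Inter>\<C> \<in> \<S>" unfolding \<S>_def using finite_subset by blast
  then have "\<Union>\<S> \<in> \<S>" using mem[of \<S>] by (auto simp: \<S>_def)
  define M where "M = \<Union>\<S>"
  have M: "M \<in> \<C>" "finite {D' \<in> \<C>. D' \<subseteq> M}" using \<open>\<Union>\<S> \<in> \<S>\<close> by (auto simp: M_def \<S>_def)
  define \<R> where "\<R> = \<C> - {D' \<in> \<C>. D' \<subseteq> M}"
  have "\<R> \<noteq> {}" using inf M(2) unfolding \<R>_def by (metis Diff_eq_empty_iff finite_subset)
  then have R: "\<Inter>\<R> \<in> \<R>" using mem[of \<R>] by (auto simp: \<R>_def)
  have "{D' \<in> \<C>. D' \<subseteq> \<Inter>\<R>} \<subseteq> insert (\<Inter>\<R>) {D' \<in> \<C>. D' \<subseteq> M}"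
    unfolding \<R>_def by blast
  then have "finite {D' \<in> \<C>. D' \<subseteq> \<Inter>\<R>}" using M(2) finite_subset by blast
  then have "\<Inter>\<R> \<in> \<S>" using R by (simp add: \<S>_def \<R>_def)
  then have "\<Inter>\<R> \<subseteq> M" unfolding M_def by blast
  then show False using R by (simp add: \<R>_def)
qed

context lfc_graph
begin

abbreviation sz :: "'v set \<Rightarrow> nat" where "sz C \<equiv> cut_size G C"
abbreviation fincut :: "'v set \<Rightarrow> bool" where "fincut C \<equiv> finite (edge_cut G C)"

definition good :: "'v set \<Rightarrow> bool" where
  "good C \<longleftrightarrow> C \<subseteq> verts G \<and> fincut C \<and>
     (\<exists>v\<in>vrays G. ev_in v C \<and> (\<forall>Y\<subseteq>C. fincut Y \<and> ev_in v Y \<longrightarrow> sz C \<le> sz Y))"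

lemma goodE:
  assumes "good C"
  obtains v where "v \<in> vrays G" "ev_in v C" "\<And>Y. Y \<subseteq> C \<Longrightarrow> fincut Y \<Longrightarrow> ev_in v Y \<Longrightarrow> sz C \<le> sz Y"
proof -
  obtain v where "v \<in> vrays G" "ev_in v C" "\<forall>Y\<subseteq>C. fincut Y \<and> ev_in v Y \<longrightarrow> sz C \<le> sz Y"
    using assms unfolding good_def by (elim conjE bexE)
  then show ?thesis using that by simp
qed

lemma good_nonempty: "good C \<Longrightarrow> C \<noteq> {}"
  unfolding good_def using ev_in_nonempty by blast

lemma fincut_Un: "fincut A \<Longrightarrow> fincut B \<Longrightarrow> fincut (A \<union> B)"
  and fincut_Int: "fincut A \<Longrightarrow> fincut B \<Longrightarrow> fincut (A \<inter> B)"
  and fincut_Diff: "fincut A \<Longrightarrow> fincut B \<Longrightarrow> fincut (A - B)"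
  using edge_cut_submodular[OF mg] edge_cut_posimodular[OF mg] by blast+

lemma edge_cut_nonempty:
  assumes "B \<subseteq> verts G" "B \<noteq> {}" "B \<noteq> verts G"
  shows "edge_cut G B \<noteq> {}"
proof -
  obtain e a b where "e \<in> edges G" "a \<in> B" "b \<in> verts G - B" "endpts G e = {a, b}"
    using conn_inD[OF conn_in_verts assms] by metis
  then have "e \<in> edge_cut G B" using mg by (auto simp: mem_edge_cut)
  then show ?thesis by blast
qed

text \<open>A part of \<open>C\<close> without edges to the rest of \<open>C\<close> has a smaller cut, but one of the two
  parts contains a tail of the ray witnessing that \<open>C\<close> is good.\<close>

lemma good_conn_in:
  assumes C: "good C"
  shows "conn_in G C"
  unfolding conn_in_def
proof (intro allI impI, rule ccontr)
  fix B assume B: "B \<subseteq> C" "B \<noteq> {} \<and> B \<noteq> C"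
    and no: "\<not> (\<exists>e\<in>edges G. \<exists>a\<in>B. \<exists>b\<in>C - B. endpts G e = {a, b})"
  obtain v where v: "v \<in> vrays G" "ev_in v C" "\<And>Y. Y \<subseteq> C \<Longrightarrow> fincut Y \<Longrightarrow> ev_in v Y \<Longrightarrow> sz C \<le> sz Y"
    using goodE[OF C] by metis
  have CV: "C \<subseteq> verts G" "fincut C" using C by (auto simp: good_def)
  have split: "e \<in> edge_cut G C \<longleftrightarrow> e \<in> edge_cut G B \<or> e \<in> edge_cut G (C - B)"
    and excl: "\<not> (e \<in> edge_cut G B \<and> e \<in> edge_cut G (C - B))" for e
  proof -
    have "(e \<in> edge_cut G C \<longleftrightarrow> e \<in> edge_cut G B \<or> e \<in> edge_cut G (C - B)) \<and>
          \<not> (e \<in> edge_cut G B \<and> e \<in> edge_cut G (C - B))"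
    proof (cases "e \<in> edges G")
      case True
      then obtain a b where ab: "endpts G e = {a, b}" using mg by (metis multigraph_endptsE)
      have "\<not> (a \<in> B \<and> b \<in> C - B)" "\<not> (b \<in> B \<and> a \<in> C - B)"
        using no True ab insert_commute[of a b "{}"] by metis+
      moreover have "a \<in> B \<Longrightarrow> a \<in> C" "b \<in> B \<Longrightarrow> b \<in> C" using B(1) by auto
      ultimately show ?thesis by (simp add: edge_cut_pair[OF mg True ab]) argo
    qed (simp add: edge_cut_def)
    then show "e \<in> edge_cut G C \<longleftrightarrow> e \<in> edge_cut G B \<or> e \<in> edge_cut G (C - B)"
      "\<not> (e \<in> edge_cut G B \<and> e \<in> edge_cut G (C - B))" by blast+
  qed
  have un: "edge_cut G C = edge_cut G B \<union> edge_cut G (C - B)" using split by blast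
  have fin: "fincut B" "fincut (C - B)" using CV(2) unfolding un by simp_all
  have card: "sz C = sz B + sz (C - B)"
    unfolding cut_size_def un by (rule card_Un_disjoint) (use fin excl in blast)+
  have "edge_cut G B \<noteq> {}" "edge_cut G (C - B) \<noteq> {}"
    by (rule edge_cut_nonempty; use B CV(1) in blast)+
  then have "sz B > 0" "sz (C - B) > 0"
    unfolding cut_size_def using fin by (simp_all add: card_gt_0_iff)
  moreover have "ev_in v B \<or> ev_in v (C - B)"
  proof -
    have "ev_in v B \<or> ev_in v (verts G - B)" using vray_dichotomy[OF mg v(1) fin(1)] .
    moreover have "ev_in v (C - B)" if "ev_in v (verts G - B)"
      using ev_in_Int[OF v(2) that] by (rule ev_in_mono) blast
    ultimately show ?thesis by blast
  qed
  then have "sz C \<le> sz B \<or> sz C \<le> sz (C - B)"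
    using v(3)[of B] v(3)[of "C - B"] B(1) fin by blast
  ultimately show False using card by linarith
qed

text \<open>The witness ray of \<open>F\<close> decides between the two outcomes. If it has a tail
  in \<open>Z\<close>, then \<open>Z \<inter> F\<close> has no smaller cut than \<open>F\<close>,
  and submodularity bounds the union. Otherwise \<open>F - Z\<close> has no smaller cut than
  \<open>F\<close>, and posimodularity bounds \<open>Z - F\<close>.\<close>

lemma good_uncross:
  assumes F: "good F" and Z: "fincut Z"
  shows "sz (Z \<union> F) \<le> sz Z \<or> sz (Z - F) \<le> sz Z"
proof -
  obtain v where v: "v \<in> vrays G" "ev_in v F" "\<And>Y. Y \<subseteq> F \<Longrightarrow> fincut Y \<Longrightarrow> ev_in v Y \<Longrightarrow> sz F \<le> sz Y"
    using goodE[OF F] by metis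
  have fin: "fincut F" using F by (simp add: good_def)
  have "ev_in v Z \<or> ev_in v (verts G - Z)" using vray_dichotomy[OF mg v(1) Z] .
  then show ?thesis
  proof
    assume "ev_in v Z"
    then have "sz F \<le> sz (Z \<inter> F)" using v fin Z fincut_Int ev_in_Int by (intro v(3)) auto
    moreover have "sz (Z \<inter> F) + sz (Z \<union> F) \<le> sz Z + sz F" using edge_cut_submodular[OF mg Z fin] by blast
    ultimately show ?thesis by linarith
  next
    assume a: "ev_in v (verts G - Z)"
    have "ev_in v (F - Z)" using ev_in_Int[OF v(2) a] by (rule ev_in_mono) blast
    then have "sz F \<le> sz (F - Z)" using fin Z fincut_Diff by (intro v(3)) auto
    moreover have "sz (Z - F) + sz (F - Z) \<le> sz Z + sz F" using edge_cut_posimodular[OF mg Z fin] by blast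
    ultimately show ?thesis by linarith
  qed
qed

section \<open>Cut-minimal sets and their uncrossing from a laminar family\<close>

definition minim :: "('v set \<Rightarrow> bool) \<Rightarrow> 'v set \<Rightarrow> bool" where
  "minim Q Z \<longleftrightarrow> Q Z \<and> fincut Z \<and> (\<forall>Y. Q Y \<and> fincut Y \<longrightarrow> sz Z \<le> sz Y)"

lemma ex_minim:
  assumes "Q Z" "fincut Z"
  shows "\<exists>Z. minim Q Z"
proof -
  have "\<exists>Y. (Q Y \<and> fincut Y) \<and> (\<forall>X. Q X \<and> fincut X \<longrightarrow> sz Y \<le> sz X)"
    by (rule ex_has_least_nat) (use assms in blast)
  then show ?thesis by (auto simp: minim_def)
qed

lemma minim_le: "minim Q Z \<Longrightarrow> Q Y \<Longrightarrow> fincut Y \<Longrightarrow> sz Z \<le> sz Y"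
  by (simp add: minim_def)

lemma minim_transfer:
  assumes "minim Q Z" "Q Y" "fincut Y" "sz Y \<le> sz Z"
  shows "minim Q Y"
  using assms unfolding minim_def by (meson le_trans)

text \<open>A connected set that crosses \<open>Z\<close> contains an endpoint of an edge in the
  finite cut of \<open>Z\<close>.\<close>

lemma finite_crossing:
  assumes pf: "\<And>u. finite {C \<in> \<F>. u \<in> C}" and conn: "\<And>C. C \<in> \<F> \<Longrightarrow> conn_in G C" and Z: "fincut Z"
  shows "finite {C \<in> \<F>. \<not> nest Z C}"
proof -
  define X where "X = (\<Union>e\<in>edge_cut G Z. endpts G e)"
  have "finite X" unfolding X_def by (rule finite_cut_endpoints[OF mg Z edge_cut_subset_edges])
  then have "finite (\<Union>u\<in>X. {C \<in> \<F>. u \<in> C})" using pf by blast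
  moreover have "{C \<in> \<F>. \<not> nest Z C} \<subseteq> (\<Union>u\<in>X. {C \<in> \<F>. u \<in> C})"
  proof
    fix C assume "C \<in> {C \<in> \<F>. \<not> nest Z C}"
    then have C: "C \<in> \<F>" "C \<inter> Z \<noteq> {}" "C \<inter> Z \<noteq> C" by (auto simp: nest_def)
    obtain e a b where e: "e \<in> edges G" "a \<in> C \<inter> Z" "b \<in> C - C \<inter> Z" "endpts G e = {a, b}"
      using conn_inD[OF conn[OF C(1)], of "C \<inter> Z"] C by blast
    then have "e \<in> edge_cut G Z" using edge_cut_pair[OF mg e(1) e(4), of Z] by blast
    then have "a \<in> X" using e(4) by (auto simp: X_def)
    then show "C \<in> (\<Union>u\<in>X. {C \<in> \<F>. u \<in> C})" using C(1) e(2) by blast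
  qed
  ultimately show ?thesis by (rule finite_subset[rotated])
qed

text \<open>\<open>Q\<close> must survive both uncrossings because it is not known in advance which
  of them keeps the cut small. The chosen one stays minimal, removes the crossing with
  \<open>C\<close> and adds none.\<close>

lemma uncross_all:
  assumes pf: "\<And>u. finite {C \<in> \<F>. u \<in> C}" and good: "\<And>C. C \<in> \<F> \<Longrightarrow> good C"
    and lam: "\<And>C D. C \<in> \<F> \<Longrightarrow> D \<in> \<F> \<Longrightarrow> nest C D"
    and step: "\<And>Z C. minim Q Z \<Longrightarrow> C \<in> \<F> \<Longrightarrow> \<not> nest Z C \<Longrightarrow> Q (Z \<union> C) \<and> Q (Z - C)"
    and Z: "minim Q Z"
  shows "\<exists>Z. minim Q Z \<and> (\<forall>C\<in>\<F>. nest Z C)"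
  using Z
proof (induction "card {C \<in> \<F>. \<not> nest Z C}" arbitrary: Z rule: less_induct)
  case less
  show ?case
  proof (cases "\<forall>C\<in>\<F>. nest Z C")
    case False
    then obtain C where C: "C \<in> \<F>" "\<not> nest Z C" by blast
    have finZ: "fincut Z" using less.prems by (simp add: minim_def)
    have finC: "fincut C" using good[OF C(1)] by (simp add: good_def)
    have "\<exists>Z'\<in>{Z \<union> C, Z - C}. minim Q Z'"
      using good_uncross[OF good[OF C(1)] finZ] step[OF less.prems C] minim_transfer[OF less.prems]
        fincut_Un[OF finZ finC] fincut_Diff[OF finZ finC] by blast
    then obtain Z' where Z': "Z' = Z \<union> C \<or> Z' = Z - C" "minim Q Z'" by blast
    have "nest Z' C" using Z'(1) nest_uncross_self by metis
    moreover have "nest Z' D" if "D \<in> \<F>" "nest Z D" for D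
      using Z'(1) nest_uncross[OF lam[OF C(1) that(1)] that(2) C(2)] by blast
    ultimately have "{C \<in> \<F>. \<not> nest Z' C} \<subset> {C \<in> \<F>. \<not> nest Z C}"
      using C by blast
    moreover have "finite {C \<in> \<F>. \<not> nest Z C}"
      by (rule finite_crossing[OF pf good_conn_in[OF good] finZ])
    ultimately have "card {C \<in> \<F>. \<not> nest Z' C} < card {C \<in> \<F>. \<not> nest Z C}"
      by (rule psubset_card_mono[rotated])
    then show ?thesis using less.hyps Z'(2) by blast
  qed (use less.prems in blast)
qed

section \<open>Greedy laminar families\<close>

text \<open>Backlinked sets of equal cut size admit no infinite ascending chain, which makes the families
  below point-finite.\<close>

definition backlinked :: "'v set \<Rightarrow> 'v set \<Rightarrow> bool" where
  "backlinked W C \<longleftrightarrow> (\<forall>Y. C \<subseteq> Y \<and> Y \<subseteq> W \<and> fincut Y \<longrightarrow> sz C \<le> sz Y)"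

lemma backlinkedD: "backlinked W C \<Longrightarrow> C \<subseteq> Y \<Longrightarrow> Y \<subseteq> W \<Longrightarrow> fincut Y \<Longrightarrow> sz C \<le> sz Y"
  by (simp add: backlinked_def)

lemma backlinked_mono: "backlinked W C \<Longrightarrow> W' \<subseteq> W \<Longrightarrow> backlinked W' C"
  by (auto simp: backlinked_def)

text \<open>An edge in the cut of the intersection has one end in all members, while some member
  misses its other end; it lies in the cut of that member and of all smaller ones. Finitely many
  such edges thus share a member, which bounds their number by \<open>j\<close>.\<close>

lemma chain_cut_Inter:
  assumes chain: "\<And>A B. A \<in> \<S> \<Longrightarrow> B \<in> \<S> \<Longrightarrow> A \<subseteq> B \<or> B \<subseteq> A" and ne: "\<S> \<noteq> {}"
    and size: "\<And>C. C \<in> \<S> \<Longrightarrow> fincut C \<and> sz C = j"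
  shows "\<exists>D\<in>\<S>. edge_cut G (\<Inter>\<S>) \<subseteq> edge_cut G D"
proof -
  have fin: "\<exists>D\<in>\<S>. \<forall>D'\<in>\<S>. D' \<subseteq> D \<longrightarrow> X \<subseteq> edge_cut G D'"
    if "finite X" "X \<subseteq> edge_cut G (\<Inter>\<S>)" for X
    using that
  proof (induction X rule: finite_induct)
    case (insert e X)
    have "\<exists>D\<in>\<S>. \<forall>D'\<in>\<S>. D' \<subseteq> D \<longrightarrow> X \<subseteq> edge_cut G D'"
      using insert.IH insert.prems by simp
    then obtain D where D: "D \<in> \<S>" "\<forall>D'\<in>\<S>. D' \<subseteq> D \<longrightarrow> X \<subseteq> edge_cut G D'" by (rule bexE)
    obtain a b where e: "e \<in> edges G" "a \<in> \<Inter>\<S>" "b \<notin> \<Inter>\<S>" "endpts G e = {a, b}"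
      using insert.prems mg by (auto simp: mem_edge_cut)
    then obtain D1 where D1: "D1 \<in> \<S>" "b \<notin> D1" by blast
    have eD: "e \<in> edge_cut G D'" if "D' \<in> \<S>" "D' \<subseteq> D1" for D'
      using edge_cut_pair[OF mg e(1,4), of D'] e(2) D1 that by blast
    have "D \<subseteq> D1 \<or> D1 \<subseteq> D" using chain D(1) D1(1) by blast
    then show ?case
    proof
      assume "D \<subseteq> D1"
      then show ?thesis using D eD by (intro bexI[of _ D]) auto
    next
      assume "D1 \<subseteq> D"
      then show ?thesis using D D1 eD by (intro bexI[of _ D1]) auto
    qed
  qed (use ne in blast)
  have "finite (edge_cut G (\<Inter>\<S>))"
  proof (rule ccontr)
    assume "infinite (edge_cut G (\<Inter>\<S>))"
    then obtain X where X: "X \<subseteq> edge_cut G (\<Inter>\<S>)" "finite X" "card X = Suc j"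
      using infinite_arbitrarily_large by blast
    then obtain D where D: "D \<in> \<S>" "X \<subseteq> edge_cut G D" using fin[of X] by blast
    then have "Suc j \<le> j"
      using size[OF D(1)] card_mono[of "edge_cut G D" X] X(3) by (simp add: cut_size_def)
    then show False by simp
  qed
  then show ?thesis using fin[of "edge_cut G (\<Inter>\<S>)"] by blast
qed

text \<open>Complements turn unions into intersections and keep the cuts.\<close>

lemma chain_cut_Union:
  assumes chain: "\<And>A B. A \<in> \<S> \<Longrightarrow> B \<in> \<S> \<Longrightarrow> A \<subseteq> B \<or> B \<subseteq> A" and ne: "\<S> \<noteq> {}"
    and size: "\<And>C. C \<in> \<S> \<Longrightarrow> fincut C \<and> sz C = j"
  shows "\<exists>D\<in>\<S>. edge_cut G (\<Union>\<S>) \<subseteq> edge_cut G D"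
proof -
  let ?c = "\<lambda>C. verts G - C"
  have "\<exists>D\<in>?c ` \<S>. edge_cut G (\<Inter>(?c ` \<S>)) \<subseteq> edge_cut G D"
  proof (rule chain_cut_Inter)
    show "A \<subseteq> B \<or> B \<subseteq> A" if AB: "A \<in> ?c ` \<S>" "B \<in> ?c ` \<S>" for A B
    proof -
      obtain A' B' where "A' \<in> \<S>" "B' \<in> \<S>" "A = ?c A'" "B = ?c B'" using AB by blast
      then show ?thesis using chain[of A' B'] by blast
    qed
    show "fincut C \<and> sz C = j" if "C \<in> ?c ` \<S>" for C
      using that size edge_cut_compl[OF mg] by (auto simp: cut_size_def)
  qed (use ne in simp)
  moreover have "\<Inter>(?c ` \<S>) = ?c (\<Union>\<S>)" using ne by auto
  ultimately show ?thesis by (auto simp: edge_cut_compl[OF mg])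
qed

lemma conn_in_proper_edge:
  assumes "conn_in G D" "C \<subseteq> D" "C \<noteq> {}" "C \<noteq> D"
  obtains e where "e \<in> edge_cut G C" "\<And>X. D \<subseteq> X \<Longrightarrow> e \<notin> edge_cut G X"
proof -
  obtain e a b where e: "e \<in> edges G" "a \<in> C" "b \<in> D - C" "endpts G e = {a, b}"
    using conn_inD[OF assms] by metis
  have "e \<in> edge_cut G C" using edge_cut_pair[OF mg e(1,4), of C] e(2,3) by blast
  moreover have "e \<notin> edge_cut G X" if "D \<subseteq> X" for X
    using edge_cut_pair[OF mg e(1,4), of X] e(2,3) assms(2) that by blast
  ultimately show ?thesis using that by blast
qed

text \<open>If a nonempty set lies properly inside a connected one, some edge leaves it within the
  larger set. This contradicts the inclusion from \<open>chain_cut_Inter\<close> unless the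
  intersection is \<open>D\<close>. For unions that inclusion points the wrong way, and
  backlinkedness in \<open>W\<close> first turns it into an equality.\<close>

lemma finite_chain_same_size:
  assumes chain: "\<And>A B. A \<in> \<C> \<Longrightarrow> B \<in> \<C> \<Longrightarrow> A \<subseteq> B \<or> B \<subseteq> A"
    and C: "\<And>C. C \<in> \<C> \<Longrightarrow> u \<in> C \<and> fincut C \<and> sz C = j \<and> conn_in G C \<and> C \<subseteq> W \<and> backlinked W C"
  shows "finite \<C>"
proof (rule finite_of_chain_Inter_Union_mem[OF chain])
  fix \<S> assume S: "\<S> \<subseteq> \<C>" "\<S> \<noteq> {}"
  have ch: "A \<subseteq> B \<or> B \<subseteq> A" if "A \<in> \<S>" "B \<in> \<S>" for A B using chain S that by blast
  have size: "fincut A \<and> sz A = j" if "A \<in> \<S>" for A using C S that by blast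
  have "\<Inter>\<S> \<in> \<S>"
  proof -
    obtain D where D: "D \<in> \<S>" "edge_cut G (\<Inter>\<S>) \<subseteq> edge_cut G D"
      using chain_cut_Inter[OF ch S(2) size] by blast
    have "\<Inter>\<S> = D"
    proof (rule ccontr)
      assume ne: "\<Inter>\<S> \<noteq> D"
      have "u \<in> \<Inter>\<S>" using C S(1) by blast
      then obtain e where "e \<in> edge_cut G (\<Inter>\<S>)" "e \<notin> edge_cut G D"
        using conn_in_proper_edge[of D "\<Inter>\<S>"] C S(1) D(1) ne
        by (metis Inter_lower empty_iff subset_eq subset_refl)
      then show False using D(2) by blast
    qed
    then show ?thesis using D(1) by simp
  qed
  moreover have "\<Union>\<S> \<in> \<S>"
  proof -
    obtain D where D: "D \<in> \<S>" "edge_cut G (\<Union>\<S>) \<subseteq> edge_cut G D"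
      using chain_cut_Union[OF ch S(2) size] by blast
    have DC: "D \<in> \<C>" using D S by blast
    have finD: "fincut D" and szD: "sz D = j" using size[OF D(1)] by auto
    have fin: "fincut (\<Union>\<S>)" using D(2) finD by (rule finite_subset)
    have "\<Union>\<S> \<subseteq> W" using C S(1) by blast
    then have "sz D \<le> sz (\<Union>\<S>)"
      using C[OF DC] D(1) fin by (intro backlinkedD[of W]) auto
    then have eq: "edge_cut G (\<Union>\<S>) = edge_cut G D"
      using D(2) finD unfolding cut_size_def by (intro card_seteq) auto
    have "\<Union>\<S> = D"
    proof (rule ccontr)
      assume "\<Union>\<S> \<noteq> D"
      then obtain D' where D': "D' \<in> \<S>" "\<not> D' \<subseteq> D" using D(1) by blast
      have "D \<subseteq> D'" using ch[OF D(1) D'(1)] D'(2) by blast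
      moreover have "conn_in G D'" "D \<noteq> {}" using C S(1) D(1) D'(1) by blast+
      ultimately obtain e where "e \<in> edge_cut G D" "e \<notin> edge_cut G (\<Union>\<S>)"
        using conn_in_proper_edge[of D' D] D' by (metis Union_upper order_refl)
      then show False using eq by blast
    qed
    then show ?thesis using D(1) by simp
  qed
  ultimately show "\<Inter>\<S> \<in> \<S> \<and> \<Union>\<S> \<in> \<S>" ..
qed

text \<open>\<open>E\<close> is the largest inherited set around the first vertex \<open>x\<close> of \<open>P\<close> (or \<open>{x}\<close>): only sets with a
  smaller cut than \<open>P\<close> may contain \<open>x\<close>. Maximality is required size by size, hence a set has to be
  nested only with the members whose cut is at most as large as its own.\<close>

definition region :: "'v set \<Rightarrow> 'v set \<Rightarrow> nat \<Rightarrow> 'v set" where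
  "region P E j = (if j < sz P then P else P - E)"

definition cand :: "'v set \<Rightarrow> 'v set \<Rightarrow> 'v set \<Rightarrow> bool" where
  "cand P E C \<longleftrightarrow> good C \<and> C \<subseteq> region P E (sz C) \<and> backlinked (region P E (sz C)) C"

definition greedy :: "'v set \<Rightarrow> 'v set \<Rightarrow> nat \<Rightarrow> 'v set set \<Rightarrow> bool" where
  "greedy P E K \<F> \<longleftrightarrow>
     (\<forall>C\<in>\<F>. cand P E C \<and> sz C < K) \<and> (\<forall>C\<in>\<F>. \<forall>D\<in>\<F>. nest C D) \<and>
     (\<forall>Z. cand P E Z \<and> sz Z < K \<and> (\<forall>C\<in>\<F>. sz C \<le> sz Z \<longrightarrow> nest Z C) \<longrightarrow> Z \<in> \<F>)"

lemma greedyD: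
  assumes "greedy P E K \<F>" "C \<in> \<F>"
  shows "cand P E C" "sz C < K" "good C" "C \<subseteq> region P E (sz C)" "backlinked (region P E (sz C)) C"
    "C \<subseteq> P" "D \<in> \<F> \<Longrightarrow> nest C D"
proof -
  show "cand P E C" "sz C < K" "good C" "C \<subseteq> region P E (sz C)" "backlinked (region P E (sz C)) C"
    "D \<in> \<F> \<Longrightarrow> nest C D"
    using assms unfolding greedy_def cand_def by blast+
  then show "C \<subseteq> P" by (auto simp: region_def split: if_splits)
qed

lemma greedy_mem:
  assumes "greedy P E K \<F>" "cand P E Z" "sz Z < K" "\<And>C. C \<in> \<F> \<Longrightarrow> sz C \<le> sz Z \<Longrightarrow> nest Z C"
  shows "Z \<in> \<F>"
  using assms unfolding greedy_def by blast

text \<open>Only sizes below \<open>K\<close> occur, and the members of one size around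
  \<open>u\<close> form a chain of backlinked connected sets.\<close>

lemma greedy_point_finite:
  assumes gr: "greedy P E K \<F>"
  shows "finite {C \<in> \<F>. u \<in> C}"
proof -
  have "finite {C \<in> \<F>. u \<in> C \<and> sz C = j}" for j
  proof (rule finite_chain_same_size[where u = u and j = j and W = "region P E j"])
    show "A \<subseteq> B \<or> B \<subseteq> A" if "A \<in> {C \<in> \<F>. u \<in> C \<and> sz C = j}" "B \<in> {C \<in> \<F>. u \<in> C \<and> sz C = j}" for A B
      using greedyD(7)[OF gr, of A B] that by (auto simp: nest_def)
    show "u \<in> C \<and> fincut C \<and> sz C = j \<and> conn_in G C \<and> C \<subseteq> region P E j \<and> backlinked (region P E j) C"
      if "C \<in> {C \<in> \<F>. u \<in> C \<and> sz C = j}" for C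
      using greedyD(3-5)[OF gr, of C] good_conn_in that by (auto simp: good_def)
  qed
  then have "finite (\<Union>j<K. {C \<in> \<F>. u \<in> C \<and> sz C = j})" by blast
  moreover have "{C \<in> \<F>. u \<in> C} \<subseteq> (\<Union>j<K. {C \<in> \<F>. u \<in> C \<and> sz C = j})"
    using greedyD(2)[OF gr] by blast
  ultimately show ?thesis by (rule finite_subset[rotated])
qed

lemma greedy_Suc:
  assumes gr: "greedy P E K \<F>"
  obtains \<F>' where "\<F> \<subseteq> \<F>'" "greedy P E (Suc K) \<F>'" "\<And>C. C \<in> \<F>' - \<F> \<Longrightarrow> sz C = K"
proof -
  define \<A> where "\<A> = {Z. cand P E Z \<and> sz Z = K \<and> (\<forall>C\<in>\<F>. nest Z C)}"
  define \<M>s where "\<M>s = {\<M>. \<M> \<subseteq> \<A> \<and> (\<forall>C\<in>\<M>. \<forall>D\<in>\<M>. nest C D)}"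
  have "\<exists>\<M>\<in>\<M>s. \<forall>X\<in>\<M>s. \<M> \<subseteq> X \<longrightarrow> X = \<M>"
  proof (rule subset_Zorn')
    fix \<X> assume ch: "subset.chain \<M>s \<X>"
    have "nest C D" if "C \<in> \<Union>\<X>" "D \<in> \<Union>\<X>" for C D
    proof -
      obtain X Y where "X \<in> \<X>" "Y \<in> \<X>" "C \<in> X" "D \<in> Y" using \<open>C \<in> \<Union>\<X>\<close> \<open>D \<in> \<Union>\<X>\<close> by blast
      moreover from this have "X \<subseteq> Y \<or> Y \<subseteq> X" "X \<in> \<M>s" "Y \<in> \<M>s"
        using ch unfolding subset_chain_def by blast+
      ultimately show ?thesis unfolding \<M>s_def by blast
    qed
    moreover have "\<Union>\<X> \<subseteq> \<A>" using ch unfolding subset_chain_def \<M>s_def by blast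
    ultimately show "\<Union>\<X> \<in> \<M>s" by (simp add: \<M>s_def)
  qed
  then obtain \<M> where M: "\<M> \<in> \<M>s" "\<forall>X\<in>\<M>s. \<M> \<subseteq> X \<longrightarrow> X = \<M>" by (rule bexE)
  have \<M>: "\<M> \<subseteq> \<A>" "\<And>C D. C \<in> \<M> \<Longrightarrow> D \<in> \<M> \<Longrightarrow> nest C D"
    using M(1) by (simp_all add: \<M>s_def)
  have max: "\<And>X. X \<in> \<M>s \<Longrightarrow> \<M> \<subseteq> X \<Longrightarrow> X = \<M>" using M(2) by simp
  have nsym: "nest A B \<longleftrightarrow> nest B A" for A B :: "'v set" by (auto simp: nest_def)
  have "greedy P E (Suc K) (\<F> \<union> \<M>)"
    unfolding greedy_def
  proof (intro conjI allI impI)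
    show "\<forall>C\<in>\<F> \<union> \<M>. cand P E C \<and> sz C < Suc K"
      using \<M>(1) greedyD(1,2)[OF gr] by (fastforce simp: \<A>_def)
    show "\<forall>C\<in>\<F> \<union> \<M>. \<forall>D\<in>\<F> \<union> \<M>. nest C D"
      using \<M> greedyD(7)[OF gr] nsym unfolding \<A>_def by blast
    fix Z assume Z: "cand P E Z \<and> sz Z < Suc K \<and> (\<forall>C\<in>\<F> \<union> \<M>. sz C \<le> sz Z \<longrightarrow> nest Z C)"
    show "Z \<in> \<F> \<union> \<M>"
    proof (cases "sz Z < K")
      case True
      then show ?thesis using greedy_mem[OF gr, of Z] Z by blast
    next
      case False
      then have szZ: "sz Z = K" using Z by simp
      have nZ: "nest Z C" if "C \<in> \<F> \<union> \<M>" for C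
      proof -
        have "sz C \<le> sz Z" using that greedyD(2)[OF gr, of C] \<M>(1) szZ by (auto simp: \<A>_def)
        then show ?thesis using Z that by blast
      qed
      have "insert Z \<M> \<subseteq> \<A>" using Z szZ \<M>(1) nZ by (simp add: \<A>_def)
      moreover have "nest Z Z" by (simp add: nest_def)
      then have "nest C D" if "C \<in> insert Z \<M>" "D \<in> insert Z \<M>" for C D
        using that nZ \<M>(2) nsym by (metis UnCI insert_iff)
      ultimately have "insert Z \<M> \<in> \<M>s" by (simp add: \<M>s_def)
      then have "insert Z \<M> = \<M>" using max by blast
      then show ?thesis by blast
    qed
  qed
  moreover have "sz C = K" if "C \<in> (\<F> \<union> \<M>) - \<F>" for C
    using that \<M>(1) by (auto simp: \<A>_def)
  ultimately show ?thesis using that[of "\<F> \<union> \<M>"] by blast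
qed

lemma greedy_extend:
  assumes "greedy P E K \<F>" "K \<le> K'"
  shows "\<exists>\<F>'. \<F> \<subseteq> \<F>' \<and> greedy P E K' \<F>' \<and> (\<forall>C\<in>\<F>' - \<F>. K \<le> sz C)"
  using assms(2)
proof (induction K' rule: dec_induct)
  case base
  show ?case using assms(1) by blast
next
  case (step n)
  then obtain \<F>1 where F1: "\<F> \<subseteq> \<F>1" "greedy P E n \<F>1" "\<And>C. C \<in> \<F>1 - \<F> \<Longrightarrow> K \<le> sz C" by blast
  obtain \<F>2 where F2: "\<F>1 \<subseteq> \<F>2" "greedy P E (Suc n) \<F>2" "\<And>C. C \<in> \<F>2 - \<F>1 \<Longrightarrow> sz C = n"
    using greedy_Suc[OF F1(2)] by blast
  have "K \<le> sz C" if "C \<in> \<F>2 - \<F>" for C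
    using that F1(3)[of C] F2(3)[of C] step.hyps(1) by (cases "C \<in> \<F>1") auto
  then show ?case using F1(1) F2(1,2) by blast
qed

text \<open>Below size \<open>sz P\<close> the region is all of \<open>P\<close>. So a state can
  record its inherited family before \<open>E\<close> is known, and \<open>E\<close> can then be
  chosen from that family.\<close>

lemma greedy_anchor_irrelevant:
  assumes "greedy P E (sz P) \<F>"
  shows "greedy P E' (sz P) \<F>"
proof -
  have "cand P E C \<longleftrightarrow> cand P E' C" if "sz C < sz P" for C
    using that by (simp add: cand_def region_def)
  then show ?thesis using assms unfolding greedy_def by blast
qed

lemma greedy_minim_mem:
  assumes gr: "greedy P E K \<F>"
    and cross: "\<And>Z C. minim Q Z \<Longrightarrow> C \<in> \<F> \<Longrightarrow> sz C \<le> sz Z \<Longrightarrow> \<not> nest Z C \<Longrightarrow> Q (Z - C) \<and> C \<subseteq> W"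
    and sub: "\<And>Z. Q Z \<Longrightarrow> Z \<subseteq> W" and up: "\<And>Z Y. Q Z \<Longrightarrow> Z \<subseteq> Y \<Longrightarrow> Y \<subseteq> W \<Longrightarrow> Q Y"
    and good: "\<And>Z. minim Q Z \<Longrightarrow> good Z \<and> region P E (sz Z) = W \<and> sz Z < K"
    and Z0: "Q Z0" "fincut Z0"
  shows "\<exists>Z\<in>\<F>. minim Q Z"
proof -
  obtain Z1 where Z1: "minim Q Z1" using ex_minim[of Q Z0] Z0 by blast
  define \<F>1 where "\<F>1 = {C \<in> \<F>. sz C \<le> sz Z1}"
  have same: "sz Z = sz Z1" if "minim Q Z" for Z
    using that Z1 unfolding minim_def by (meson antisym)
  have "\<exists>Z. minim Q Z \<and> (\<forall>C\<in>\<F>1. nest Z C)"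
  proof (rule uncross_all[OF _ _ _ _ Z1])
    show "finite {C \<in> \<F>1. u \<in> C}" for u
      by (rule finite_subset[OF _ greedy_point_finite[OF gr, of u]]) (auto simp: \<F>1_def)
    show "good C" if "C \<in> \<F>1" for C using that greedyD(3)[OF gr, of C] by (simp add: \<F>1_def)
    show "nest C D" if "C \<in> \<F>1" "D \<in> \<F>1" for C D using that greedyD(7)[OF gr, of C D] by (simp add: \<F>1_def)
    show "Q (Z \<union> C) \<and> Q (Z - C)" if Z: "minim Q Z" and C: "C \<in> \<F>1" "\<not> nest Z C" for Z C
    proof -
      have QZ: "Q Z" using Z by (simp add: minim_def)
      have "Q (Z - C) \<and> C \<subseteq> W" using cross[OF Z, of C] C same[OF Z] by (simp add: \<F>1_def)
      then show ?thesis using up[OF QZ, of "Z \<union> C"] sub[OF QZ] by blast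
    qed
  qed
  then obtain Z where Z: "minim Q Z" "\<And>C. C \<in> \<F>1 \<Longrightarrow> nest Z C" by blast
  have QZ: "Q Z" using Z(1) by (simp add: minim_def)
  have "cand P E Z"
    unfolding cand_def backlinked_def
    using good[OF Z(1)] sub[OF QZ] up[OF QZ] minim_le[OF Z(1)] by metis
  moreover have "nest Z C" if "C \<in> \<F>" "sz C \<le> sz Z" for C
    using Z(2)[of C] that same[OF Z(1)] by (simp add: \<F>1_def)
  ultimately have "Z \<in> \<F>" using greedy_mem[OF gr] good[OF Z(1)] by blast
  then show ?thesis using Z(1) by blast
qed

text \<open>The ray witnessing that \<open>Z0\<close> is good is also a witness for \<open>Z\<close>.\<close>

lemma minim_superset_good:
  assumes Z0: "good Z0" and W: "W \<subseteq> verts G"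
    and Z: "minim (\<lambda>Y. Z0 \<subseteq> Y \<and> Y \<subseteq> W) Z"
  shows "good Z"
proof -
  obtain v where v: "v \<in> vrays G" "ev_in v Z0" "\<And>Y. Y \<subseteq> Z0 \<Longrightarrow> fincut Y \<Longrightarrow> ev_in v Y \<Longrightarrow> sz Z0 \<le> sz Y"
    using goodE[OF Z0] by metis
  have fin0: "fincut Z0" using Z0 by (simp add: good_def)
  have ZW: "Z0 \<subseteq> Z" "Z \<subseteq> W" "fincut Z" using Z by (auto simp: minim_def)
  have "sz Z \<le> sz Y" if Y: "Y \<subseteq> Z" "fincut Y" "ev_in v Y" for Y
  proof -
    have "sz Z0 \<le> sz (Y \<inter> Z0)" using v(2) Y fin0 fincut_Int ev_in_Int by (intro v(3)) auto
    moreover have "sz Z \<le> sz (Y \<union> Z0)"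
      using Y ZW fin0 fincut_Un by (intro minim_le[OF Z]) auto
    moreover have "sz (Y \<inter> Z0) + sz (Y \<union> Z0) \<le> sz Y + sz Z0"
      using edge_cut_submodular[OF mg Y(2) fin0] by blast
    ultimately show ?thesis by linarith
  qed
  moreover have "ev_in v Z" using v(2) ZW(1) by (rule ev_in_mono)
  ultimately show ?thesis unfolding good_def using ZW W v(1) by blast
qed

end

section \<open>One step of the construction\<close>

text \<open>\<open>K\<close> must exceed the cut of \<open>P - E\<close>: this set bounds the cut
  that can be found around a ray whose tails have no cut below \<open>sz P\<close>, see
  \<open>coverage\<close>.\<close>

locale node = lfc_graph G for G :: "('v, 'e) mgraph" +
  fixes P :: "'v set" and \<F>0 :: "'v set set" and x :: 'v and E :: "'v set" and K :: nat and \<F> :: "'v set set"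
  assumes P: "P \<subseteq> verts G" "finite (edge_cut G P)" and x: "x \<in> P"
    and gr0: "greedy P E (sz P) \<F>0"
    and E: "E = {x} \<or> E \<in> \<F>0" "x \<in> E" "\<And>C. C \<in> \<F>0 \<Longrightarrow> x \<in> C \<Longrightarrow> C \<subseteq> E"
    and K: "sz P \<le> K" "sz (P - E) < K"
    and gr: "greedy P E K \<F>" and sub: "\<F>0 \<subseteq> \<F>" and new: "\<And>C. C \<in> \<F> - \<F>0 \<Longrightarrow> sz P \<le> sz C"
begin

section \<open>Position of the members relative to the anchor \<open>E\<close>\<close>

lemma fincut_singleton:
  assumes "y \<in> verts G"
  shows "fincut {y}"
proof (rule finite_subset)
  show "edge_cut G {y} \<subseteq> incident_edges G y"
    by (auto simp: mem_edge_cut[OF mg] incident_edges_def)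
  show "finite (incident_edges G y)" using lf assms by (simp add: locally_finite_def)
qed

lemma fincut_E: "fincut E"
proof -
  have "x \<in> verts G" using x P by blast
  then show ?thesis using E(1) fincut_singleton greedyD(3)[OF gr0] by (auto simp: good_def)
qed

lemma F0_iff: "C \<in> \<F> \<Longrightarrow> C \<in> \<F>0 \<longleftrightarrow> sz C < sz P"
  using new[of C] greedyD(2)[OF gr0, of C] by (meson DiffI leD)

lemma big_avoids_E: "C \<in> \<F> \<Longrightarrow> sz P \<le> sz C \<Longrightarrow> C \<subseteq> P - E"
  using greedyD(4)[OF gr, of C] by (auto simp: region_def split: if_splits)

lemma F_x_subset_E:
  assumes "C \<in> \<F>" "x \<in> C"
  shows "C \<subseteq> E"
proof (cases "sz P \<le> sz C")
  case True
  then show ?thesis using big_avoids_E[OF assms(1)] assms(2) E(2) by blast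
next
  case False
  then show ?thesis using E(3) F0_iff assms by simp
qed

text \<open>A member containing \<open>E\<close> contains \<open>x\<close>, and by the choice of
  \<open>E\<close> it then lies inside \<open>E\<close>. So no member crosses
  \<open>E\<close>.\<close>

lemma F_E_cases:
  assumes C: "C \<in> \<F>"
  shows "C \<subseteq> E \<or> C \<inter> E = {}"
proof (cases "E = {x}")
  case True
  then show ?thesis using F_x_subset_E[OF C] by blast
next
  case False
  then have "nest C E" using greedyD(7)[OF gr C] E(1) sub by blast
  moreover have "C \<subseteq> E" if "E \<subseteq> C" using F_x_subset_E[OF C] that E(2) by blast
  ultimately show ?thesis by (auto simp: nest_def)
qed

lemma F_psubset:
  assumes "C \<in> \<F>"
  shows "C \<subset> P"
proof -
  have "C \<noteq> P" using big_avoids_E[OF assms] E(2) x by auto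
  then show ?thesis using greedyD(6)[OF gr assms] by blast
qed

text \<open>While a set inside the window \<open>W\<close> is uncrossed with \<open>C\<close>, the
  union with \<open>C\<close> must stay in the window as well. For \<open>P - E\<close> this holds
  because a member that meets \<open>P - E\<close> avoids \<open>E\<close>.\<close>

lemma crossing_region:
  assumes "C \<in> \<F>" "\<not> nest Z C" "Z \<subseteq> W" "W = P \<or> W = P - E"
  shows "C \<subseteq> W"
proof -
  have "C \<subseteq> P" using greedyD(6)[OF gr assms(1)] .
  moreover have "C \<inter> E = {}" if "W = P - E"
    using F_E_cases[OF assms(1)] that assms(2,3) unfolding nest_def by blast
  ultimately show ?thesis using assms(4) by blast
qed

lemma coverage:
  assumes v: "v \<in> vrays G" "ev_in v P"
  shows "\<exists>C\<in>\<F>. ev_in v C"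
proof (rule ccontr)
  assume no: "\<not> (\<exists>C\<in>\<F>. ev_in v C)"
  have out: "ev_in v (verts G - C)" if "C \<in> \<F>" for C
    using vray_dichotomy[OF mg v(1), of C] greedyD(3)[OF gr that] no that by (auto simp: good_def)
  have mem: "\<exists>Z\<in>\<F>. minim (\<lambda>Z. Z \<subseteq> W \<and> ev_in v Z) Z"
    if W: "W = P \<or> W = P - E" and Z0: "Z0 \<subseteq> W" "ev_in v Z0" "fincut Z0"
      and reg: "\<And>Z. minim (\<lambda>Z. Z \<subseteq> W \<and> ev_in v Z) Z \<Longrightarrow> region P E (sz Z) = W \<and> sz Z < K" for W Z0
  proof (rule greedy_minim_mem[OF gr, where W = W])
    fix Z C assume Z: "minim (\<lambda>Z. Z \<subseteq> W \<and> ev_in v Z) Z" and C: "C \<in> \<F>" "\<not> nest Z C"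
    have ZW: "Z \<subseteq> W" "ev_in v Z" using Z by (auto simp: minim_def)
    have "ev_in v (Z - C)" using ev_in_Int[OF ZW(2) out[OF C(1)]] by (rule ev_in_mono) blast
    then show "(Z - C \<subseteq> W \<and> ev_in v (Z - C)) \<and> C \<subseteq> W"
      using ZW crossing_region[OF C ZW(1) W] by blast
  next
    fix Z Y assume "Z \<subseteq> W \<and> ev_in v Z" "Z \<subseteq> Y" "Y \<subseteq> W"
    then show "Y \<subseteq> W \<and> ev_in v Y" using ev_in_mono by blast
  next
    fix Z assume Z: "minim (\<lambda>Z. Z \<subseteq> W \<and> ev_in v Z) Z"
    have z: "Z \<subseteq> W" "ev_in v Z" "fincut Z" using Z by (simp_all add: minim_def)
    have "\<forall>Y\<subseteq>Z. fincut Y \<and> ev_in v Y \<longrightarrow> sz Z \<le> sz Y"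
      using minim_le[OF Z] z(1) by (simp add: subset_trans)
    moreover have "Z \<subseteq> verts G" using z(1) W P(1) by blast
    ultimately have "good Z"
      unfolding good_def using z v(1) by (intro conjI bexI[of _ v]) assumption+
    then show "good Z \<and> region P E (sz Z) = W \<and> sz Z < K" using reg[OF Z] by blast
  qed (use Z0 in auto)
  show False
  proof (cases "\<exists>Y\<subseteq>P. fincut Y \<and> ev_in v Y \<and> sz Y < sz P")
    case True
    then obtain Y where Y: "Y \<subseteq> P" "fincut Y" "ev_in v Y" "sz Y < sz P" by blast
    have "\<exists>Z\<in>\<F>. minim (\<lambda>Z. Z \<subseteq> P \<and> ev_in v Z) Z"
    proof (rule mem[OF _ Y(1,3,2)])
      fix Z assume Z: "minim (\<lambda>Z. Z \<subseteq> P \<and> ev_in v Z) Z"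
      have "sz Z \<le> sz Y" using minim_le[OF Z] Y by blast
      then show "region P E (sz Z) = P \<and> sz Z < K" using Y(4) K(1) by (simp add: region_def)
    qed simp
    then show False using no by (auto simp: minim_def)
  next
    case False
    \<comment> \<open>\<open>E\<close> is either a single vertex or a member of the family, so it
      holds no tail.\<close>
    have "\<not> ev_in v E"
      using E(1) no sub inj_not_ev_in_finite[OF vrays_inj[OF v(1)], of "{x}"] by blast
    then have out_E: "ev_in v (verts G - E)" using vray_dichotomy[OF mg v(1) fincut_E] by blast
    have PE: "ev_in v (P - E)" using ev_in_Int[OF v(2) out_E] by (rule ev_in_mono) blast
    have "\<exists>Z\<in>\<F>. minim (\<lambda>Z. Z \<subseteq> P - E \<and> ev_in v Z) Z"
    proof (rule mem[OF _ order_refl PE fincut_Diff[OF P(2) fincut_E]])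
      fix Z assume Z: "minim (\<lambda>Z. Z \<subseteq> P - E \<and> ev_in v Z) Z"
      have "sz Z \<le> sz (P - E)" using minim_le[OF Z] PE fincut_Diff[OF P(2) fincut_E] by blast
      moreover have "\<not> sz Z < sz P" using False Z by (auto simp: minim_def)
      ultimately show "region P E (sz Z) = P - E \<and> sz Z < K" using K(2) by (simp add: region_def)
    qed simp
    then show False using no by (auto simp: minim_def)
  qed
qed

section \<open>Children of a node and their finiteness\<close>

definition children :: "'v set set" where
  "children = {D \<in> \<F>. \<forall>C\<in>\<F>. D \<subseteq> C \<longrightarrow> C = D}"

lemma childrenD: "D \<in> children \<Longrightarrow> D \<in> \<F>" "D \<in> children \<Longrightarrow> C \<in> \<F> \<Longrightarrow> D \<subseteq> C \<Longrightarrow> C = D"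
  by (auto simp: children_def)

lemma subset_child:
  assumes C: "C \<in> \<F>"
  shows "\<exists>D\<in>children. C \<subseteq> D"
proof -
  obtain u where u: "u \<in> C" using good_nonempty greedyD(3)[OF gr C] by blast
  have fin: "finite {D \<in> \<F>. C \<subseteq> D}"
    by (rule finite_subset[OF _ greedy_point_finite[OF gr, of u]]) (use u in blast)
  have "{D \<in> \<F>. C \<subseteq> D} \<noteq> {}" using C by blast
  then obtain D where D: "D \<in> {D \<in> \<F>. C \<subseteq> D}" "\<forall>D'\<in>{D \<in> \<F>. C \<subseteq> D}. D \<subseteq> D' \<longrightarrow> D = D'"
    using finite_has_maximal[OF fin] by meson
  then have "D \<in> children" unfolding children_def by auto
  then show ?thesis using D(1) by blast
qed

lemma children_disjoint:
  assumes "C \<in> children" "D \<in> children" "C \<noteq> D"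
  shows "C \<inter> D = {}"
proof -
  have "nest C D" using greedyD(7)[OF gr] assms childrenD by blast
  then show ?thesis using assms childrenD unfolding nest_def by blast
qed

lemma child_good: "D \<in> children \<Longrightarrow> good D"
  using childrenD greedyD(3)[OF gr] by blast

lemma child_psubset: "D \<in> children \<Longrightarrow> D \<subset> P"
  using childrenD F_psubset by blast

lemma child_x:
  assumes "D \<in> children" "x \<in> D"
  shows "sz D < sz P"
  using big_avoids_E[OF childrenD(1)[OF assms(1)]] assms(2) E(2) by (meson DiffD2 leI subsetD)

lemma ev_in_child:
  assumes "v \<in> vrays G" "ev_in v P"
  shows "\<exists>D\<in>children. ev_in v D"
proof -
  obtain C where C: "C \<in> \<F>" "ev_in v C" using coverage assms by blast
  then obtain D where "D \<in> children" "C \<subseteq> D" using subset_child by blast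
  then show ?thesis using ev_in_mono[OF C(2)] by blast
qed

text \<open>A ray converging to \<open>U\<close> has a tail in \<open>P\<close>, as the outside of
  \<open>P\<close> misses \<open>U\<close>; the child holding a tail then meets \<open>U\<close>
  infinitely often. Applied to the bag and to representatives of the children, it makes both
  finite.\<close>

lemma ray_meeting:
  assumes U: "U \<subseteq> P" "infinite U"
  shows "\<exists>D\<in>children. infinite (D \<inter> U)"
proof -
  obtain v where v: "v \<in> vrays G" "\<And>C. fincut C \<Longrightarrow> ev_in v C \<Longrightarrow> infinite (C \<inter> U)"
    using koenig[of U] U P(1) by blast
  have "ev_in v P"
  proof (rule ccontr)
    assume "\<not> ev_in v P"
    then have "ev_in v (verts G - P)" using vray_dichotomy[OF mg v(1) P(2)] by blast
    moreover have "fincut (verts G - P)" using P(2) edge_cut_compl[OF mg] by simp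
    moreover have "(verts G - P) \<inter> U = {}" using U(1) by blast
    ultimately show False using v(2) by fastforce
  qed
  then obtain D where "D \<in> children" "ev_in v D" using ev_in_child[OF v(1)] by blast
  moreover have "fincut D" using child_good[OF \<open>D \<in> children\<close>] by (simp add: good_def)
  ultimately show ?thesis using v(2) by blast
qed

lemma finite_bag: "finite (P - \<Union>children)"
proof (rule ccontr)
  assume "infinite (P - \<Union>children)"
  then obtain D where "D \<in> children" "infinite (D \<inter> (P - \<Union>children))"
    using ray_meeting[of "P - \<Union>children"] by blast
  moreover have "D \<inter> (P - \<Union>children) = {}" using \<open>D \<in> children\<close> by blast
  ultimately show False by simp
qed

lemma finite_children: "finite children"
proof (rule ccontr)
  assume inf: "infinite children"
  have "\<forall>D\<in>children. \<exists>u. u \<in> D" using good_nonempty child_good by blast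
  then obtain f where f: "\<And>D. D \<in> children \<Longrightarrow> f D \<in> D" by metis
  have "inj_on f children"
  proof (rule inj_onI, rule ccontr)
    fix C D assume CD: "C \<in> children" "D \<in> children" "f C = f D" "C \<noteq> D"
    have "f C \<in> C \<inter> D" using f[OF CD(1)] f[OF CD(2)] CD(3) by simp
    then show False using children_disjoint[OF CD(1,2,4)] by simp
  qed
  then have "infinite (f ` children)" using inf finite_imageD by blast
  moreover have "f ` children \<subseteq> P" using f child_psubset by blast
  ultimately obtain D where D: "D \<in> children" "infinite (D \<inter> f ` children)"
    using ray_meeting[of "f ` children"] by blast
  have "D \<inter> f ` children \<subseteq> {f D}" using f children_disjoint[OF D(1)] by blast
  then show False using D(2) finite_subset by blast
qed

section \<open>Inheritance of the greedy property\<close>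

definition inherited :: "'v set \<Rightarrow> 'v set set" where
  "inherited D = {C \<in> \<F>. C \<subset> D \<and> sz C < sz D}"

text \<open>If \<open>j\<close> is at least \<open>sz P\<close>, then so is the cut of
  \<open>D\<close>, and \<open>D\<close> avoids \<open>E\<close>.\<close>

lemma child_region: "D \<in> children \<Longrightarrow> j \<le> sz D \<Longrightarrow> D \<subseteq> region P E j"
  using big_avoids_E[OF childrenD(1)] child_psubset by (auto simp: region_def)

lemma F_child_cases:
  assumes D: "D \<in> children" and C: "C \<in> \<F>" "sz C < sz D"
  shows "C \<in> inherited D \<or> C \<inter> D = {}"
proof -
  have "nest C D" using greedyD(7)[OF gr C(1)] childrenD(1)[OF D] by blast
  moreover have "C \<noteq> D" using C(2) by auto
  ultimately show ?thesis
    using childrenD(2)[OF D C(1)] C unfolding nest_def inherited_def by blast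
qed

text \<open>A smallest counterexample \<open>Y\<close> to backlinkedness would itself have entered the family,
  and then lie inside \<open>D\<close>.\<close>

lemma cand_inherits:
  assumes D: "D \<in> children" and Z: "cand D E' Z" "sz Z < sz D"
    and nestZ: "\<And>C. C \<in> inherited D \<Longrightarrow> sz C \<le> sz Z \<Longrightarrow> nest Z C"
  shows "cand P E Z"
proof -
  have gZ: "good Z" and ZD: "Z \<subseteq> D" and blZ: "backlinked D Z"
    using Z by (auto simp: cand_def region_def)
  have Zne: "Z \<noteq> {}" using good_nonempty[OF gZ] .
  have finZ: "fincut Z" using gZ by (simp add: good_def)
  \<comment> \<open>Run once with the window \<open>P\<close> and once with \<open>P - E\<close>;
    \<open>Y\<close> is an alleged counterexample to backlinkedness of \<open>Z\<close> in the
    window.\<close>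
  have contra: False
    if W: "W = P \<or> W = P - E" and DW: "D \<subseteq> W" and Y: "Z \<subseteq> Y" "Y \<subseteq> W" "fincut Y" "sz Y < sz Z"
      and reg: "\<And>Y'. minim (\<lambda>Y. Z \<subseteq> Y \<and> Y \<subseteq> W) Y' \<Longrightarrow> region P E (sz Y') = W \<and> sz Y' < K" for W Y
  proof -
    let ?Q = "\<lambda>Y. Z \<subseteq> Y \<and> Y \<subseteq> W"
    have small: "sz Y' < sz Z" if "minim ?Q Y'" for Y'
      using minim_le[OF that, of Y] Y by linarith
    have "\<exists>Y'\<in>\<F>. minim ?Q Y'"
    proof (rule greedy_minim_mem[OF gr, where W = W])
      fix Y' C assume Y': "minim ?Q Y'" and C: "C \<in> \<F>" "sz C \<le> sz Y'" "\<not> nest Y' C"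
      have YW: "Z \<subseteq> Y'" "Y' \<subseteq> W" using Y' by (auto simp: minim_def)
      have szC: "sz C < sz Z" using C(2) small[OF Y'] by linarith
      \<comment> \<open>A small member meeting \<open>D\<close> is inherited and hence nested with
        \<open>Z\<close>. It is not inside \<open>Z\<close> since it crosses \<open>Y'\<close>, and
        it does not contain \<open>Z\<close> because \<open>Z\<close> is backlinked in
        \<open>D\<close>.\<close>
      have "C \<inter> Z = {}"
      proof (cases "C \<inter> D = {}")
        case False
        then have CD: "C \<in> inherited D" using F_child_cases[OF D C(1)] szC Z(2) by auto
        then have "nest Z C" using nestZ szC by simp
        moreover have "\<not> Z \<subseteq> C"
        proof
          assume "Z \<subseteq> C"
          then have "sz Z \<le> sz C"
            using CD greedyD(3)[OF gr C(1)] by (intro backlinkedD[OF blZ]) (auto simp: inherited_def good_def)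
          then show False using szC by simp
        qed
        moreover have "\<not> C \<subseteq> Z" using C(3) YW(1) by (auto simp: nest_def)
        ultimately show ?thesis by (auto simp: nest_def)
      qed (use ZD in blast)
      then show "(Z \<subseteq> Y' - C \<and> Y' - C \<subseteq> W) \<and> C \<subseteq> W"
        using YW crossing_region[OF C(1,3) YW(2) W] by blast
    next
      fix Y' assume Y': "minim ?Q Y'"
      have "good Y'"
        by (rule minim_superset_good[OF gZ _ Y']) (use W P(1) in blast)
      then show "good Y' \<and> region P E (sz Y') = W \<and> sz Y' < K" using reg[OF Y'] by blast
    qed (use Y in blast)+
    then obtain Y' where Y': "Y' \<in> \<F>" "minim ?Q Y'" by blast
    have YZ: "Z \<subseteq> Y'" "fincut Y'" using Y'(2) by (auto simp: minim_def)
    have "Y' \<inter> D \<noteq> {}" using YZ ZD Zne by blast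
    then have "Y' \<subseteq> D"
      using F_child_cases[OF D Y'(1)] small[OF Y'(2)] Z(2) by (auto simp: inherited_def)
    then have "sz Z \<le> sz Y'" using backlinkedD[OF blZ] YZ by blast
    then show False using small[OF Y'(2)] by simp
  qed
  \<comment> \<open>Counterexamples with a cut below \<open>sz P\<close> are refuted first, in the
    window \<open>P\<close>. In the window \<open>P - E\<close> a minimiser therefore has size at
    least \<open>sz P\<close>, so that its region is that window.\<close>
  have step1: "sz Z \<le> sz Y" if Y: "Z \<subseteq> Y" "Y \<subseteq> P" "fincut Y" "sz Y < sz P" for Y
  proof (rule ccontr)
    assume "\<not> sz Z \<le> sz Y"
    show False
    proof (rule contra[of P Y])
      fix Y' assume "minim (\<lambda>Y. Z \<subseteq> Y \<and> Y \<subseteq> P) Y'"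
      then have "sz Y' \<le> sz Y" using minim_le Y by blast
      then show "region P E (sz Y') = P \<and> sz Y' < K" using Y(4) K(1) by (simp add: region_def)
    qed (use Y \<open>\<not> sz Z \<le> sz Y\<close> child_psubset[OF D] in auto)
  qed
  have "backlinked (region P E (sz Z)) Z"
    unfolding backlinked_def
  proof (intro allI impI)
    fix Y assume Y: "Z \<subseteq> Y \<and> Y \<subseteq> region P E (sz Z) \<and> fincut Y"
    show "sz Z \<le> sz Y"
    proof (cases "sz Z < sz P")
      case True
      then have "Y \<subseteq> P" using Y by (simp add: region_def)
      then show ?thesis using step1[of Y] Y True by linarith
    next
      case False
      then have DP: "D \<subseteq> P - E" using child_region[OF D, of "sz Z"] Z(2) by (simp add: region_def)
      have YP: "Y \<subseteq> P - E" using Y False by (simp add: region_def)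
      show ?thesis
      proof (rule ccontr)
        assume less: "\<not> sz Z \<le> sz Y"
        show False
        proof (rule contra[of "P - E" Y])
          fix Y' assume Y': "minim (\<lambda>Y. Z \<subseteq> Y \<and> Y \<subseteq> P - E) Y'"
          have "sz Y' \<le> sz Y" using minim_le[OF Y'] Y YP by blast
          moreover have "Z \<subseteq> Y'" "Y' \<subseteq> P" "fincut Y'" using Y' by (auto simp: minim_def)
          then have "\<not> sz Y' < sz P" using step1[of Y'] \<open>sz Y' \<le> sz Y\<close> less by linarith
          moreover have "sz Y' \<le> sz (P - E)"
            using minim_le[OF Y'] ZD DP fincut_Diff[OF P(2) fincut_E] by blast
          ultimately show "region P E (sz Y') = P - E \<and> sz Y' < K" using K(2) by (simp add: region_def)
        qed (use Y YP less DP in auto)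
      qed
    qed
  qed
  moreover have "Z \<subseteq> region P E (sz Z)" using ZD child_region[OF D, of "sz Z"] Z(2) by simp
  ultimately show ?thesis using gZ by (simp add: cand_def)
qed

text \<open>Every candidate of the child below its cut size that respects the inherited sets is one
  of the parent, and each smaller member of \<open>\<F>\<close> is inherited or disjoint from
  \<open>D\<close>; so maximality passes down. This is what allows linkedness to be proved at every
  state from its own inherited family.\<close>

lemma inherited_greedy:
  assumes D: "D \<in> children"
  shows "greedy D E' (sz D) (inherited D)"
  unfolding greedy_def
proof (intro conjI ballI allI impI)
  fix C assume C: "C \<in> inherited D"
  then have CF: "C \<in> \<F>" "C \<subseteq> D" "sz C < sz D" by (auto simp: inherited_def)
  show "sz C < sz D" using CF by simp
  have "backlinked D C"
    by (rule backlinked_mono[OF greedyD(5)[OF gr CF(1)]]) (use child_region[OF D] CF in simp)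
  then show "cand D E' C" using CF greedyD(3)[OF gr CF(1)] by (simp add: cand_def region_def)
next
  fix C C' assume "C \<in> inherited D" "C' \<in> inherited D"
  then show "nest C C'" using greedyD(7)[OF gr] by (auto simp: inherited_def)
next
  fix Z assume Z: "cand D E' Z \<and> sz Z < sz D \<and> (\<forall>C\<in>inherited D. sz C \<le> sz Z \<longrightarrow> nest Z C)"
  have ZD: "Z \<subseteq> D" using Z by (auto simp: cand_def region_def)
  have cZ: "cand P E Z" using cand_inherits[OF D, of E' Z] Z by blast
  have "Z \<in> \<F>"
  proof (rule greedy_mem[OF gr cZ])
    show "sz Z < K" using Z greedyD(2)[OF gr childrenD(1)[OF D]] by simp
    fix C assume C: "C \<in> \<F>" "sz C \<le> sz Z"
    show "nest Z C"
    proof (cases "C \<inter> D = {}")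
      case True
      then show ?thesis using ZD by (auto simp: nest_def)
    next
      case False
      then have "C \<in> inherited D" using F_child_cases[OF D C(1)] C(2) Z by auto
      then show ?thesis using Z C(2) by blast
    qed
  qed
  then show "Z \<in> inherited D" using Z ZD by (auto simp: inherited_def)
qed

end

context lfc_graph
begin

lemma node_exists:
  assumes P: "P \<subseteq> verts G" "fincut P" and x: "x \<in> P" and gr0: "greedy P {} (sz P) \<F>0"
  shows "\<exists>E K \<F>. node G P \<F>0 x E K \<F>"
proof -
  have fin: "finite {C \<in> \<F>0. x \<in> C}" by (rule greedy_point_finite[OF gr0])
  have "\<exists>E. (E = {x} \<or> E \<in> \<F>0) \<and> x \<in> E \<and> (\<forall>C\<in>\<F>0. x \<in> C \<longrightarrow> C \<subseteq> E)"
  proof (cases "{C \<in> \<F>0. x \<in> C} = {}")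
    case False
    then obtain E where E: "E \<in> {C \<in> \<F>0. x \<in> C}" "\<And>C. C \<in> {C \<in> \<F>0. x \<in> C} \<Longrightarrow> E \<subseteq> C \<Longrightarrow> C = E"
      using finite_has_maximal[OF fin] by blast
    have "C \<subseteq> E" if "C \<in> \<F>0" "x \<in> C" for C
      using greedyD(7)[OF gr0 that(1), of E] E that unfolding nest_def by blast
    then show ?thesis using E(1) by blast
  qed auto
  then obtain E where E: "E = {x} \<or> E \<in> \<F>0" "x \<in> E" "\<And>C. C \<in> \<F>0 \<Longrightarrow> x \<in> C \<Longrightarrow> C \<subseteq> E" by blast
  have gr1: "greedy P E (sz P) \<F>0" by (rule greedy_anchor_irrelevant[OF gr0])
  \<comment> \<open>One more than both bounds, since the sizes in a greedy family are strictly below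
    \<open>K\<close>.\<close>
  define K where "K = Suc (max (sz P) (sz (P - E)))"
  have K_le: "sz P \<le> K" by (simp add: K_def)
  obtain \<F> where F: "\<F>0 \<subseteq> \<F>" "greedy P E K \<F>" "\<forall>C\<in>\<F> - \<F>0. sz P \<le> sz C"
    using greedy_extend[OF gr1 K_le] by blast
  have "node G P \<F>0 x E K \<F>"
    by unfold_locales (use P x gr1 E F K_def in auto)
  then show ?thesis by blast
qed

end

section \<open>The laminar family of a decomposition\<close>

context lfc_graph
begin

text \<open>A state consists of a node set \<open>P\<close> and the family that it inherits from its parent.\<close>

definition state_ok :: "'v set \<times> 'v set set \<Rightarrow> bool" where
  "state_ok s \<longleftrightarrow> fst s \<subseteq> verts G \<and> fincut (fst s) \<and> fst s \<noteq> {} \<and> conn_in G (fst s) \<and>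
     greedy (fst s) {} (sz (fst s)) (snd s)"

definition first_vertex :: "'v set \<Rightarrow> 'v" where
  "first_vertex P = (SOME x. x \<in> P \<and> (\<forall>y\<in>P. to_nat_on (verts G) x \<le> to_nat_on (verts G) y))"

lemma first_vertex:
  assumes "P \<noteq> {}"
  shows "first_vertex P \<in> P" "\<And>y. y \<in> P \<Longrightarrow> to_nat_on (verts G) (first_vertex P) \<le> to_nat_on (verts G) y"
proof -
  have "\<exists>x. x \<in> P \<and> (\<forall>y. y \<in> P \<longrightarrow> to_nat_on (verts G) x \<le> to_nat_on (verts G) y)"
    using assms ex_has_least_nat[of "\<lambda>x. x \<in> P"] by (metis all_not_in_conv)
  then have "\<exists>x. x \<in> P \<and> (\<forall>y\<in>P. to_nat_on (verts G) x \<le> to_nat_on (verts G) y)" by blast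
  then have "first_vertex P \<in> P \<and> (\<forall>y\<in>P. to_nat_on (verts G) (first_vertex P) \<le> to_nat_on (verts G) y)"
    unfolding first_vertex_def by (rule someI_ex)
  then show "first_vertex P \<in> P" "\<And>y. y \<in> P \<Longrightarrow> to_nat_on (verts G) (first_vertex P) \<le> to_nat_on (verts G) y"
    by auto
qed

text \<open>Collects what later arguments need of the children; the parameters \<open>E\<close> and
  \<open>K\<close> of the step are forgotten from here on.\<close>

definition kids_spec :: "'v set \<times> 'v set set \<Rightarrow> ('v set \<times> 'v set set) set \<Rightarrow> bool" where
  "kids_spec s T \<longleftrightarrow> finite T \<and> finite (fst s - \<Union>(fst ` T)) \<and>
     (\<forall>t\<in>T. state_ok t \<and> fst t \<subset> fst s \<and> good (fst t) \<and>
        (first_vertex (fst s) \<in> fst t \<longrightarrow> sz (fst t) < sz (fst s)) \<and>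
        (\<forall>C\<in>snd s. sz C < sz (fst t) \<longrightarrow> C \<in> snd t \<or> C \<inter> fst t = {})) \<and>
     (\<forall>t\<in>T. \<forall>u\<in>T. t \<noteq> u \<longrightarrow> fst t \<inter> fst u = {})"

lemma ex_kids:
  assumes "state_ok s"
  shows "\<exists>T. kids_spec s T"
proof -
  obtain P \<F>0 where s: "s = (P, \<F>0)" by (cases s)
  have ok: "P \<subseteq> verts G" "fincut P" "P \<noteq> {}" "greedy P {} (sz P) \<F>0"
    using assms by (auto simp: state_ok_def s)
  obtain E K \<F> where "node G P \<F>0 (first_vertex P) E K \<F>"
    using node_exists[OF ok(1,2) first_vertex(1)[OF ok(3)] ok(4)] by blast
  then interpret n: node G P \<F>0 "first_vertex P" E K \<F> .
  define T where "T = (\<lambda>D. (D, n.inherited D)) ` n.children"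
  have fstT: "fst ` T = n.children" by (simp add: T_def image_image)
  have "state_ok (D, n.inherited D)" if D: "D \<in> n.children" for D
    using n.child_good[OF D] good_nonempty good_conn_in n.inherited_greedy[OF D]
    by (auto simp: state_ok_def good_def)
  moreover have "C \<in> n.inherited D \<or> C \<inter> D = {}" if "D \<in> n.children" "C \<in> \<F>0" "sz C < sz D" for C D
    using n.F_child_cases that n.sub by blast
  ultimately have "kids_spec s T"
    unfolding kids_spec_def fstT s
    using n.finite_children n.finite_bag n.child_psubset n.child_good n.child_x n.children_disjoint
    by (auto simp: T_def)
  then show ?thesis by blast
qed

definition kids :: "'v set \<times> 'v set set \<Rightarrow> ('v set \<times> 'v set set) set" where
  "kids s = (SOME T. kids_spec s T)"

lemma kids_spec_kids: "state_ok s \<Longrightarrow> kids_spec s (kids s)"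
  unfolding kids_def using ex_kids by (rule someI_ex)

definition kid_rel :: "(('v set \<times> 'v set set) \<times> ('v set \<times> 'v set set)) set" where
  "kid_rel = {(s, t). state_ok s \<and> t \<in> kids s}"

definition root_state :: "'v set \<times> 'v set set" where
  "root_state = (verts G, {})"

definition states :: "('v set \<times> 'v set set) set" where
  "states = {s. (root_state, s) \<in> kid_rel\<^sup>*}"

lemma edge_cut_verts: "edge_cut G (verts G) = {}"
proof (rule equals0I)
  fix e assume "e \<in> edge_cut G (verts G)"
  then obtain b where "e \<in> edges G" "b \<in> endpts G e" "b \<notin> verts G"
    by (auto simp: mem_edge_cut[OF mg])
  then show False using mg by (auto simp: multigraph_def)
qed

text \<open>The whole vertex set has an empty cut, so no set has a smaller one and the empty family
  is greedy.\<close>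

lemma root_ok: "state_ok root_state"
  using conn connected_graph_iff[OF mg]
  by (auto simp: state_ok_def root_state_def edge_cut_verts greedy_def cut_size_def)

lemma kid_relD:
  assumes "(s, t) \<in> kid_rel"
  shows "state_ok s" "state_ok t" "fst t \<subset> fst s" "good (fst t)"
    "first_vertex (fst s) \<in> fst t \<Longrightarrow> sz (fst t) < sz (fst s)"
    "C \<in> snd s \<Longrightarrow> sz C < sz (fst t) \<Longrightarrow> C \<in> snd t \<or> C \<inter> fst t = {}"
    "(s, u) \<in> kid_rel \<Longrightarrow> u \<noteq> t \<Longrightarrow> fst u \<inter> fst t = {}"
proof -
  show ok: "state_ok s" using assms by (simp add: kid_rel_def)
  note sp = kids_spec_kids[OF ok, unfolded kids_spec_def]
  have t: "t \<in> kids s" using assms by (simp add: kid_rel_def)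
  have all: "state_ok t \<and> fst t \<subset> fst s \<and> good (fst t) \<and>
        (first_vertex (fst s) \<in> fst t \<longrightarrow> sz (fst t) < sz (fst s)) \<and>
        (\<forall>C\<in>snd s. sz C < sz (fst t) \<longrightarrow> C \<in> snd t \<or> C \<inter> fst t = {})"
    using sp t by simp
  then show "state_ok t" "fst t \<subset> fst s" "good (fst t)"
    "first_vertex (fst s) \<in> fst t \<Longrightarrow> sz (fst t) < sz (fst s)"
    "C \<in> snd s \<Longrightarrow> sz C < sz (fst t) \<Longrightarrow> C \<in> snd t \<or> C \<inter> fst t = {}" by blast+
  show "fst u \<inter> fst t = {}" if "(s, u) \<in> kid_rel" "u \<noteq> t"
  proof -
    have "u \<in> kids s" using that(1) by (simp add: kid_rel_def)
    then show ?thesis using sp t that(2) by simp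
  qed
qed

lemma finite_kid_rel: "finite {t. (s, t) \<in> kid_rel}"
proof (cases "state_ok s")
  case True
  have "finite (kids s)" using kids_spec_kids[OF True] by (simp add: kids_spec_def)
  then show ?thesis using True by (simp add: kid_rel_def)
qed (simp add: kid_rel_def)

section \<open>The tree order on states\<close>

lemma states_ok: "s \<in> states \<Longrightarrow> state_ok s"
  unfolding states_def mem_Collect_eq
  by (erule rtranclE) (use root_ok kid_relD(2) in auto)

lemma states_step: "s \<in> states \<Longrightarrow> (s, t) \<in> kid_rel\<^sup>* \<Longrightarrow> t \<in> states"
  by (simp add: states_def)

lemma rel_subset: "(s, t) \<in> kid_rel\<^sup>* \<Longrightarrow> fst t \<subseteq> fst s"
proof (induction rule: rtrancl_induct)
  case (step y z)
  then show ?case using kid_relD(3)[OF step.hyps(2)] by blast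
qed simp

lemma rel_psubset:
  assumes "(s, t) \<in> kid_rel\<^sup>*" "s \<noteq> t"
  shows "\<exists>u. (s, u) \<in> kid_rel \<and> (u, t) \<in> kid_rel\<^sup>* \<and> fst t \<subseteq> fst u \<and> fst u \<subset> fst s"
  using assms
proof (cases rule: converse_rtranclE)
  case (step u)
  then show ?thesis using kid_relD(3)[OF step(1)] rel_subset[OF step(2)] by blast
qed simp

lemma states_cases:
  assumes "s \<in> states" "t \<in> states"
  shows "(s, t) \<in> kid_rel\<^sup>* \<or> (t, s) \<in> kid_rel\<^sup>* \<or> fst s \<inter> fst t = {}"
  using assms(2) unfolding states_def mem_Collect_eq
proof (induction rule: rtrancl_induct)
  case base
  show ?case using assms(1) by (simp add: states_def)
next
  case (step t u)
  consider "(s, t) \<in> kid_rel\<^sup>*" | "(t, s) \<in> kid_rel\<^sup>*" "s \<noteq> t" | "fst s \<inter> fst t = {}"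
    using step.IH by blast
  then show ?case
  proof cases
    case 1
    then have "(s, u) \<in> kid_rel\<^sup>*" using step.hyps(2) by (rule rtrancl_into_rtrancl)
    then show ?thesis by simp
  next
    case 2
    then obtain w where w: "(t, w) \<in> kid_rel" "(w, s) \<in> kid_rel\<^sup>*" "fst s \<subseteq> fst w"
      using rel_psubset[OF 2(1)] 2(2) by blast
    show ?thesis
    proof (cases "w = u")
      case False
      then have "fst w \<inter> fst u = {}" using kid_relD(7)[OF step.hyps(2) w(1)] by simp
      then show ?thesis using w(3) by auto
    qed (use w in simp)
  next
    case 3
    then show ?thesis using kid_relD(3)[OF step.hyps(2)] by auto
  qed
qed

lemma states_subset_rel:
  assumes "s \<in> states" "t \<in> states" "fst t \<subseteq> fst s"
  shows "(s, t) \<in> kid_rel\<^sup>*"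
proof (rule ccontr)
  assume n: "(s, t) \<notin> kid_rel\<^sup>*"
  have "fst t \<noteq> {}" using states_ok[OF assms(2)] by (simp add: state_ok_def)
  then have "fst s \<inter> fst t \<noteq> {}" using assms(3) by auto
  then have "(t, s) \<in> kid_rel\<^sup>*" using states_cases[OF assms(1,2)] n by simp
  moreover have "t \<noteq> s" using n by auto
  ultimately show False using rel_psubset[of t s] assms(3) by auto
qed

text \<open>A child contains the first vertex of its parent only if its cut is smaller, so below a state
  containing \<open>y\<close> the pair of index distance to \<open>y\<close> and cut size decreases lexicographically.\<close>

lemma states_point_finite:
  assumes "y \<in> verts G"
  shows "finite {t \<in> states. y \<in> fst t}"
proof -
  define i where "i = to_nat_on (verts G)"
  define m where "m s = (i y - i (first_vertex (fst s)), sz (fst s))" for s :: "'v set \<times> 'v set set"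
  have "finite {t. (s, t) \<in> kid_rel\<^sup>* \<and> y \<in> fst t}" if "state_ok s" "y \<in> fst s" for s
    using that
  proof (induction "m s" arbitrary: s rule: wf_induct_rule[OF wf_lex_prod[OF wf_less_than wf_less_than]])
    case (1 s)
    have ne: "fst s \<noteq> {}" using 1(3) by auto
    have fin: "finite {t. (u, t) \<in> kid_rel\<^sup>* \<and> y \<in> fst t}" if u: "(s, u) \<in> kid_rel" "y \<in> fst u" for u
    proof (rule 1(1))
      have neu: "fst u \<noteq> {}" using u(2) by auto
      let ?x = "first_vertex (fst s)" and ?z = "first_vertex (fst u)"
      have z: "?z \<in> fst u" "?z \<in> fst s" using first_vertex(1)[OF neu] kid_relD(3)[OF u(1)] by auto
      have x: "?x \<in> fst s" using first_vertex(1)[OF ne] .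
      have le: "i ?x \<le> i ?z" "i ?z \<le> i y"
        unfolding i_def using first_vertex(2)[OF ne z(2)] first_vertex(2)[OF neu u(2)] by auto
      show "(m u, m s) \<in> less_than <*lex*> less_than"
      proof (cases "i ?x = i ?z")
        case True
        have sub: "fst s \<subseteq> verts G" using 1(2) by (simp add: state_ok_def)
        have "inj_on i (verts G)" unfolding i_def by (rule inj_on_to_nat_on[OF countable_verts])
        then have "?x = ?z" using True x z(2) sub by (auto dest: inj_onD)
        then have "sz (fst u) < sz (fst s)" using kid_relD(5)[OF u(1)] z(1) by simp
        then show ?thesis using True by (simp add: m_def)
      next
        case False
        then have "i y - i ?z < i y - i ?x" using le by linarith
        then show ?thesis by (simp add: m_def)
      qed
    qed (use u kid_relD(2) in auto)
    have "{t. (s, t) \<in> kid_rel\<^sup>* \<and> y \<in> fst t} \<subseteq>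
        insert s (\<Union>u\<in>{u. (s, u) \<in> kid_rel \<and> y \<in> fst u}. {t. (u, t) \<in> kid_rel\<^sup>* \<and> y \<in> fst t})"
    proof
      fix t assume t: "t \<in> {t. (s, t) \<in> kid_rel\<^sup>* \<and> y \<in> fst t}"
      show "t \<in> insert s (\<Union>u\<in>{u. (s, u) \<in> kid_rel \<and> y \<in> fst u}. {t. (u, t) \<in> kid_rel\<^sup>* \<and> y \<in> fst t})"
      proof (cases "s = t")
        case False
        then obtain u where "(s, u) \<in> kid_rel" "(u, t) \<in> kid_rel\<^sup>*" "fst t \<subseteq> fst u"
          using rel_psubset[of s t] t by blast
        moreover have "y \<in> fst t" using t by simp
        ultimately show ?thesis by blast
      qed simp
    qed
    moreover have "finite {u. (s, u) \<in> kid_rel \<and> y \<in> fst u}"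
      by (rule finite_subset[OF _ finite_kid_rel[of s]]) auto
    ultimately show ?case using fin by (auto intro: finite_subset)
  qed
  from this[OF root_ok] show ?thesis using assms by (simp add: root_state_def states_def)
qed

text \<open>A set of size at most \<open>j\<close> has a smaller cut than every state on the way to
  \<open>t\<close>, so each step either passes it on or makes it disjoint from the child.\<close>

lemma inherited_persist:
  assumes "(s, t) \<in> kid_rel\<^sup>*" "s \<in> states"
    and "\<And>u. u \<in> states \<Longrightarrow> fst t \<subseteq> fst u \<Longrightarrow> fst u \<subseteq> fst s \<Longrightarrow> j < sz (fst u)"
    and "C \<in> snd s" "sz C \<le> j"
  shows "C \<in> snd t \<or> C \<inter> fst t = {}"
  using assms(1,3)
proof (induction rule: rtrancl_induct)
  case base
  then show ?case using assms(4) by simp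
next
  case (step t u)
  have sub: "fst u \<subset> fst t" using kid_relD(3)[OF step.hyps(2)] .
  have "C \<in> snd t \<or> C \<inter> fst t = {}"
    by (rule step.IH) (use step.prems sub in auto)
  then show ?case
  proof
    assume C: "C \<in> snd t"
    have su: "(s, u) \<in> kid_rel\<^sup>*" using step.hyps by (rule rtrancl_into_rtrancl)
    have "j < sz (fst u)"
      by (rule step.prems[OF states_step[OF assms(2) su]]) (use rel_subset[OF su] in auto)
    then show ?thesis using kid_relD(6)[OF step.hyps(2) C] assms(5) by simp
  qed (use sub in auto)
qed

lemma states_linked:
  assumes s: "s \<in> states" and t: "t \<in> states" and Z: "fst t \<subseteq> Z" "Z \<subseteq> fst s" "fincut Z"
  shows "\<exists>u\<in>states. fst t \<subseteq> fst u \<and> fst u \<subseteq> fst s \<and> sz (fst u) \<le> sz Z"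
proof (rule ccontr)
  assume no: "\<not> (\<exists>u\<in>states. fst t \<subseteq> fst u \<and> fst u \<subseteq> fst s \<and> sz (fst u) \<le> sz Z)"
  have ts: "fst t \<subseteq> fst s" using Z by blast
  have st: "(s, t) \<in> kid_rel\<^sup>*" using states_subset_rel[OF s t ts] .
  have "s \<noteq> t" using no Z s by (metis order_refl subset_antisym)
  then obtain r where "(r, t) \<in> kid_rel" using st by (metis rtranclE)
  then have gt: "good (fst t)" by (rule kid_relD(4))
  have oks: "fst s \<subseteq> verts G" "greedy (fst s) {} (sz (fst s)) (snd s)"
    and okt: "greedy (fst t) {} (sz (fst t)) (snd t)" "fst t \<noteq> {}"
    using states_ok[OF s] states_ok[OF t] by (auto simp: state_ok_def)
  let ?Q = "\<lambda>Y. fst t \<subseteq> Y \<and> Y \<subseteq> fst s"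
  have persist: "C \<in> snd t \<or> C \<inter> fst t = {}" if "C \<in> snd s" "sz C \<le> sz Z" for C
    by (rule inherited_persist[OF st s _ that]) (use no in \<open>auto simp: not_le\<close>)
  have le: "sz Y \<le> sz Z" if "minim ?Q Y" for Y using minim_le[OF that] Z by blast
  have less_s: "sz Z < sz (fst s)" using no s ts by (meson leI order_refl)
  have "\<exists>Y\<in>snd s. minim ?Q Y"
  proof (rule greedy_minim_mem[OF oks(2), where W = "fst s"])
    fix Y C assume Y: "minim ?Q Y" and C: "C \<in> snd s" "sz C \<le> sz Y" "\<not> nest Y C"
    have YQ: "fst t \<subseteq> Y" "Y \<subseteq> fst s" using Y by (auto simp: minim_def)
    \<comment> \<open>Sets inherited by \<open>t\<close> lie inside \<open>fst t\<close>, hence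
      inside \<open>Y\<close>, and do not cross it. So every crossing member of at most this size is
      disjoint from \<open>fst t\<close> and can be subtracted from \<open>Y\<close>.\<close>
    have "C \<notin> snd t"
    proof
      assume "C \<in> snd t"
      then have "C \<subseteq> fst t" by (rule greedyD(6)[OF okt(1)])
      then show False using C(3) YQ(1) by (auto simp: nest_def)
    qed
    then have "C \<inter> fst t = {}" using persist[OF C(1)] C(2) le[OF Y] by auto
    then show "?Q (Y - C) \<and> C \<subseteq> fst s" using YQ greedyD(6)[OF oks(2) C(1)] by blast
  next
    fix Y assume Y: "minim ?Q Y"
    have "good Y" by (rule minim_superset_good[OF gt oks(1) Y])
    then show "good Y \<and> region (fst s) {} (sz Y) = fst s \<and> sz Y < sz (fst s)"
      using le[OF Y] less_s by (simp add: region_def)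
  qed (use Z in auto)
  then obtain Y where Y: "Y \<in> snd s" "minim ?Q Y" by blast
  have YQ: "fst t \<subseteq> Y" using Y by (auto simp: minim_def)
  have "Y \<in> snd t" using persist[OF Y(1) le[OF Y(2)]] YQ okt(2) by auto
  then have "sz Y < sz (fst t)" "Y \<subseteq> fst t"
    using greedyD(2)[OF okt(1)] greedyD(6)[OF okt(1)] by auto
  then show False using YQ by auto
qed

text \<open>The interface to the tree: only the sets survive, the inherited families are dropped.
  The maximal proper members inside \<open>P\<close> are its future children, and the last condition
  is linkedness in terms of cuts.\<close>

definition linked_family :: "'v set set \<Rightarrow> bool" where
  "linked_family \<L> \<longleftrightarrow> verts G \<in> \<L> \<and>
    (\<forall>L\<in>\<L>. L \<subseteq> verts G \<and> L \<noteq> {} \<and> fincut L \<and> conn_in G L) \<and>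
    (\<forall>A\<in>\<L>. \<forall>B\<in>\<L>. nest A B) \<and>
    (\<forall>v\<in>verts G. finite {L \<in> \<L>. v \<in> L}) \<and>
    (\<forall>P\<in>\<L>. finite {D \<in> \<L>. D \<subset> P \<and> (\<forall>C\<in>\<L>. D \<subseteq> C \<and> C \<subset> P \<longrightarrow> C = D)}) \<and>
    (\<forall>P\<in>\<L>. finite (P - \<Union>{D \<in> \<L>. D \<subset> P})) \<and>
    (\<forall>P\<in>\<L>. \<forall>Q\<in>\<L>. \<forall>Z. Q \<subseteq> Z \<and> Z \<subseteq> P \<and> fincut Z \<longrightarrow> (\<exists>L\<in>\<L>. Q \<subseteq> L \<and> L \<subseteq> P \<and> sz L \<le> sz Z))"

theorem linked_family_exists: "\<exists>\<L>. linked_family \<L>"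
proof -
  define \<L> where "\<L> = fst ` states"
  have L: "L \<in> \<L> \<longleftrightarrow> (\<exists>s\<in>states. L = fst s)" for L by (auto simp: \<L>_def)
  have LI: "s \<in> states \<Longrightarrow> fst s \<in> \<L>" for s by (simp add: \<L>_def)
  have root: "root_state \<in> states" by (simp add: states_def)
  have "verts G \<in> \<L>" using LI[OF root] by (simp add: root_state_def)
  moreover have "L \<subseteq> verts G \<and> L \<noteq> {} \<and> fincut L \<and> conn_in G L" if LL: "L \<in> \<L>" for L
  proof -
    obtain s where "L = fst s" "s \<in> states" using LL unfolding \<L>_def by (rule imageE)
    then show ?thesis using states_ok[of s] by (simp add: state_ok_def)
  qed
  moreover have "nest A B" if AB: "A \<in> \<L>" "B \<in> \<L>" for A B
  proof -
    obtain s t where st: "s \<in> states" "t \<in> states" "A = fst s" "B = fst t" using AB L by metis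
    then show ?thesis
      using states_cases[OF st(1,2)] rel_subset[of s t] rel_subset[of t s] unfolding nest_def by metis
  qed
  moreover have "finite {L \<in> \<L>. v \<in> L}" if "v \<in> verts G" for v
  proof (rule finite_subset)
    show "{L \<in> \<L>. v \<in> L} \<subseteq> fst ` {t \<in> states. v \<in> fst t}" by (auto simp: \<L>_def)
  qed (use states_point_finite[OF that] in simp)
  moreover have "finite {D \<in> \<L>. D \<subset> P \<and> (\<forall>C\<in>\<L>. D \<subseteq> C \<and> C \<subset> P \<longrightarrow> C = D)}"
    and "finite (P - \<Union>{D \<in> \<L>. D \<subset> P})" if P: "P \<in> \<L>" for P
  proof -
    obtain s where s: "s \<in> states" "P = fst s" using P L by metis
    have kid: "(s, u) \<in> kid_rel \<Longrightarrow> u \<in> states" for u using states_step[OF s(1)] by blast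
    show "finite {D \<in> \<L>. D \<subset> P \<and> (\<forall>C\<in>\<L>. D \<subseteq> C \<and> C \<subset> P \<longrightarrow> C = D)}"
    proof (rule finite_subset)
      show "{D \<in> \<L>. D \<subset> P \<and> (\<forall>C\<in>\<L>. D \<subseteq> C \<and> C \<subset> P \<longrightarrow> C = D)} \<subseteq> fst ` {u. (s, u) \<in> kid_rel}"
      proof
        fix D assume D: "D \<in> {D \<in> \<L>. D \<subset> P \<and> (\<forall>C\<in>\<L>. D \<subseteq> C \<and> C \<subset> P \<longrightarrow> C = D)}"
        then have "D \<in> \<L>" by simp
        then obtain t where t: "t \<in> states" "D = fst t" using L by metis
        have sub: "fst t \<subset> fst s" using D t s by simp
        then have "(s, t) \<in> kid_rel\<^sup>*" using states_subset_rel[OF s(1) t(1)] by blast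
        then obtain u where u: "(s, u) \<in> kid_rel" "fst t \<subseteq> fst u" "fst u \<subset> fst s"
          using rel_psubset[of s t] sub by (metis psubsetE order_refl)
        have "fst u \<in> \<L>" using kid[OF u(1)] LI by simp
        then have "fst u = D" using D u t s by blast
        then show "D \<in> fst ` {u. (s, u) \<in> kid_rel}" using u(1) by blast
      qed
    qed (use finite_kid_rel in simp)
    have ok: "state_ok s" using states_ok[OF s(1)] .
    have "fst ` kids s \<subseteq> {D \<in> \<L>. D \<subset> P}"
    proof
      fix D assume "D \<in> fst ` kids s"
      then obtain u where u: "D = fst u" "(s, u) \<in> kid_rel" using ok by (auto simp: kid_rel_def)
      then show "D \<in> {D \<in> \<L>. D \<subset> P}" using LI[OF kid[OF u(2)]] kid_relD(3)[OF u(2)] s(2) by simp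
    qed
    then have "P - \<Union>{D \<in> \<L>. D \<subset> P} \<subseteq> fst s - \<Union>(fst ` kids s)" using s(2) by blast
    moreover have "finite (fst s - \<Union>(fst ` kids s))" using kids_spec_kids[OF ok] by (simp add: kids_spec_def)
    ultimately show "finite (P - \<Union>{D \<in> \<L>. D \<subset> P})" by (rule finite_subset)
  qed
  moreover have "\<exists>L\<in>\<L>. Q \<subseteq> L \<and> L \<subseteq> P \<and> sz L \<le> sz Z"
    if PQ: "P \<in> \<L>" "Q \<in> \<L>" and Z: "Q \<subseteq> Z" "Z \<subseteq> P" "fincut Z" for P Q Z
  proof -
    obtain s t where st: "s \<in> states" "t \<in> states" "P = fst s" "Q = fst t" using PQ L by metis
    then obtain u where u: "u \<in> states" "fst t \<subseteq> fst u" "fst u \<subseteq> fst s" "sz (fst u) \<le> sz Z"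
      using states_linked[OF st(1,2), of Z] Z by blast
    moreover have "fst u \<in> \<L>" using LI[OF u(1)] .
    ultimately show ?thesis using st(3,4) by blast
  qed
  ultimately have "linked_family \<L>" unfolding linked_family_def by simp
  then show ?thesis by blast
qed

end

section \<open>The tree of a linked laminar family\<close>

lemma ex_maximal_set:
  fixes \<A> :: "'a set set"
  assumes "finite \<A>" "X \<in> \<A>"
  shows "\<exists>M\<in>\<A>. \<forall>Y\<in>\<A>. M \<subseteq> Y \<longrightarrow> M = Y"
  using finite_has_maximal[OF assms(1)] assms(2) by auto

lemma ex_minimal_set:
  fixes \<A> :: "'a set set"
  assumes "finite \<A>" "X \<in> \<A>"
  shows "\<exists>M\<in>\<A>. \<forall>Y\<in>\<A>. Y \<subseteq> M \<longrightarrow> M = Y"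
  using finite_has_minimal[OF assms(1)] assms(2) by auto

lemma subpath_crosses:
  assumes mg: "multigraph G" and p: "is_path G vs es" and ab: "a \<le> b" "b \<le> length es" "(vs ! a \<in> X) \<noteq> (vs ! b \<in> X)"
  shows "\<exists>i. a \<le> i \<and> i < b \<and> es ! i \<in> edge_cut G X"
proof (rule ccontr)
  assume no: "\<not> ?thesis"
  have "(vs ! a \<in> X) = (vs ! i \<in> X)" if "a \<le> i" "i \<le> b" for i
    using that
  proof (induction i rule: dec_induct)
    case (step i)
    have i: "i < length es" using step ab by simp
    have "es ! i \<in> edges G" using p i unfolding is_path_def by (meson nth_mem subsetD)
    moreover have "endpts G (es ! i) = {vs ! i, vs ! Suc i}" using p i by (simp add: is_path_def)
    ultimately have "(vs ! i \<in> X) = (vs ! Suc i \<in> X)"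
      using edge_cut_pair[OF mg, of "es ! i"] no step.hyps step.prems by (meson Suc_le_lessD)
    then show ?case using step by simp
  qed simp
  then show False using ab by simp
qed

lemma path_nth_inj:
  assumes "is_path G vs es" "i \<le> length es" "j \<le> length es" "vs ! i = vs ! j"
  shows "i = j"
  using assms by (simp add: is_path_def nth_eq_iff_index_eq)

lemma path_edge_nth_inj:
  assumes p: "is_path G vs es" and ij: "i < length es" "j < length es" "es ! i = es ! j"
  shows "i = j"
proof -
  have "endpts G (es ! i) = {vs ! i, vs ! Suc i}" "endpts G (es ! j) = {vs ! j, vs ! Suc j}"
    using p ij(1,2) unfolding is_path_def by blast+
  then have "{vs ! i, vs ! Suc i} = {vs ! j, vs ! Suc j}" using ij(3) by simp
  then have "vs ! i = vs ! j \<or> vs ! i = vs ! Suc j \<and> vs ! Suc i = vs ! j"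
    by (auto simp: doubleton_eq_iff)
  then have "i = j \<or> i = Suc j \<and> Suc i = j"
    using path_nth_inj[OF p] ij(1,2) by (metis Suc_leI less_imp_le)
  then show ?thesis by linarith
qed

lemma path_hd_last:
  assumes "is_path G vs es"
  shows "hd vs = vs ! 0" "last vs = vs ! length es"
proof -
  have l: "length vs = Suc (length es)" using assms by (simp add: is_path_def)
  then have "vs \<noteq> []" by auto
  then show "hd vs = vs ! 0" "last vs = vs ! length es"
    using l by (simp_all add: hd_conv_nth last_conv_nth)
qed

text \<open>The injection \<open>c\<close> names the members by natural numbers, which become the
  nodes of the tree.\<close>

locale family = lfc_graph G for G :: "('v, 'e) mgraph" +
  fixes \<L> :: "'v set set" and c :: "'v set \<Rightarrow> nat"
  assumes fam: "linked_family \<L>" and inj: "inj_on c \<L>"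
begin

lemma V_mem: "verts G \<in> \<L>"
  and memD: "L \<in> \<L> \<Longrightarrow> L \<subseteq> verts G \<and> L \<noteq> {} \<and> fincut L \<and> conn_in G L"
  and nestL: "A \<in> \<L> \<Longrightarrow> B \<in> \<L> \<Longrightarrow> nest A B"
  and pf: "v \<in> verts G \<Longrightarrow> finite {L \<in> \<L>. v \<in> L}"
  and finite_maximal: "P \<in> \<L> \<Longrightarrow> finite {D \<in> \<L>. D \<subset> P \<and> (\<forall>C\<in>\<L>. D \<subseteq> C \<and> C \<subset> P \<longrightarrow> C = D)}"
  and finite_rest: "P \<in> \<L> \<Longrightarrow> finite (P - \<Union>{D \<in> \<L>. D \<subset> P})"
  and link: "P \<in> \<L> \<Longrightarrow> Q \<in> \<L> \<Longrightarrow> Q \<subseteq> Z \<Longrightarrow> Z \<subseteq> P \<Longrightarrow> fincut Z \<Longrightarrow> \<exists>L\<in>\<L>. Q \<subseteq> L \<and> L \<subseteq> P \<and> sz L \<le> sz Z"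
  using fam unfolding linked_family_def by simp_all

lemma c_eq: "A \<in> \<L> \<Longrightarrow> B \<in> \<L> \<Longrightarrow> c A = c B \<longleftrightarrow> A = B"
  using inj by (auto dest: inj_onD)

lemma finite_supersets:
  assumes "P \<in> \<L>"
  shows "finite {L \<in> \<L>. P \<subseteq> L}"
proof -
  obtain v where "v \<in> P" "v \<in> verts G" using memD[OF assms] by blast
  then show ?thesis by (intro finite_subset[OF _ pf[of v]]) auto
qed

lemma comparable:
  assumes "A \<in> \<L>" "B \<in> \<L>" "C \<in> \<L>" "C \<subseteq> A" "C \<subseteq> B"
  shows "A \<subseteq> B \<or> B \<subseteq> A"
  using nestL[OF assms(1,2)] memD[OF assms(3)] assms(4,5) unfolding nest_def by blast

text \<open>The members properly containing a given one form a finite chain, so the intersection is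
  the least of them. For \<open>verts G\<close> there is none and the intersection is
  \<open>UNIV\<close>; hence the recurring exclusion of \<open>verts G\<close>.\<close>

definition par :: "'v set \<Rightarrow> 'v set" where
  "par P = \<Inter>{L \<in> \<L>. P \<subset> L}"

lemma par:
  assumes P: "P \<in> \<L>" "P \<noteq> verts G"
  shows "par P \<in> \<L>" "P \<subset> par P" "\<And>L. L \<in> \<L> \<Longrightarrow> P \<subset> L \<Longrightarrow> par P \<subseteq> L"
proof -
  have fin: "finite {L \<in> \<L>. P \<subset> L}"
    by (rule finite_subset[OF _ finite_supersets[OF P(1)]]) auto
  have mem: "verts G \<in> {L \<in> \<L>. P \<subset> L}" using V_mem memD[OF P(1)] P(2) by blast
  obtain M where M: "M \<in> {L \<in> \<L>. P \<subset> L}" "\<forall>L\<in>{L \<in> \<L>. P \<subset> L}. L \<subseteq> M \<longrightarrow> M = L"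
    using ex_minimal_set[OF fin mem] by (elim bexE)
  have "M \<subseteq> L" if "L \<in> {L \<in> \<L>. P \<subset> L}" for L
  proof -
    have "M \<subseteq> L \<or> L \<subseteq> M" using comparable[of M L P] M(1) that P(1) by auto
    then show ?thesis using M(2) that by blast
  qed
  then have "par P = M" unfolding par_def using M(1) by (intro equalityI Inter_lower Inter_greatest)
  then show "par P \<in> \<L>" "P \<subset> par P" using M(1) by auto
  show "par P \<subseteq> L" if "L \<in> \<L>" "P \<subset> L" for L
    unfolding par_def using that by (intro Inter_lower) simp
qed

definition kid_sets :: "'v set \<Rightarrow> 'v set set" where
  "kid_sets P = {D \<in> \<L>. D \<noteq> verts G \<and> par D = P}"

lemma finite_kid_sets:
  assumes "P \<in> \<L>"
  shows "finite (kid_sets P)"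
proof (rule finite_subset[OF _ finite_maximal[OF assms]])
  show "kid_sets P \<subseteq> {D \<in> \<L>. D \<subset> P \<and> (\<forall>C\<in>\<L>. D \<subseteq> C \<and> C \<subset> P \<longrightarrow> C = D)}"
  proof
    fix D assume "D \<in> kid_sets P"
    then have D: "D \<in> \<L>" "D \<noteq> verts G" "par D = P" by (auto simp: kid_sets_def)
    have "C = D" if "C \<in> \<L>" "D \<subseteq> C" "C \<subset> P" for C
    proof (rule ccontr)
      assume "C \<noteq> D"
      then have "D \<subset> C" using that(2) by blast
      then have "P \<subseteq> C" using par(3)[OF D(1,2) that(1)] D(3) by simp
      then show False using that(3) by blast
    qed
    then show "D \<in> {D \<in> \<L>. D \<subset> P \<and> (\<forall>C\<in>\<L>. D \<subseteq> C \<and> C \<subset> P \<longrightarrow> C = D)}"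
      using D par(2)[OF D(1,2)] by simp
  qed
qed

lemma below_kid:
  assumes P: "P \<in> \<L>" and L: "L \<in> \<L>" "L \<subset> P"
  shows "\<exists>D\<in>kid_sets P. L \<subseteq> D"
proof -
  have fin: "finite {D \<in> \<L>. L \<subseteq> D \<and> D \<subset> P}"
    by (rule finite_subset[OF _ finite_supersets[OF L(1)]]) auto
  have mem: "L \<in> {D \<in> \<L>. L \<subseteq> D \<and> D \<subset> P}" using L by simp
  obtain D where D: "D \<in> {D \<in> \<L>. L \<subseteq> D \<and> D \<subset> P}" "\<forall>C\<in>{D \<in> \<L>. L \<subseteq> D \<and> D \<subset> P}. D \<subseteq> C \<longrightarrow> D = C"
    using ex_maximal_set[OF fin mem] by (elim bexE)
  have DV: "D \<in> \<L>" "D \<noteq> verts G" "D \<subset> P" "L \<subseteq> D" using D(1) memD[OF P] by auto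
  have "par D \<subseteq> P" using par(3)[OF DV(1,2) P DV(3)] .
  moreover have "\<not> par D \<subset> P"
  proof
    assume "par D \<subset> P"
    then have "D = par D" using D(2) par(1,2)[OF DV(1,2)] DV(4) by auto
    then show False using par(2)[OF DV(1,2)] by simp
  qed
  ultimately have "D \<in> kid_sets P" using DV by (auto simp: kid_sets_def)
  then show ?thesis using DV(4) by blast
qed

section \<open>Encoding the family as a tree\<close>

definition dec :: "nat \<Rightarrow> 'v set" where "dec = inv_into \<L> c"

lemma dec_c: "L \<in> \<L> \<Longrightarrow> dec (c L) = L"
  unfolding dec_def using inj by (rule inv_into_f_f)

text \<open>The code of a set also names the tree edge from this set to its parent.\<close>

definition tree :: "(nat, nat) mgraph" where
  "tree = \<lparr>verts = c ` \<L>, edges = c ` (\<L> - {verts G}), endpts = (\<lambda>n. {n, c (par (dec n))})\<rparr>"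

definition bag :: "nat \<Rightarrow> 'v set" where
  "bag n = dec n - \<Union>{D \<in> \<L>. D \<subset> dec n}"

definition below :: "'v set \<Rightarrow> nat set" where
  "below P = c ` {L \<in> \<L>. L \<subseteq> P}"

lemma verts_tree: "verts tree = c ` \<L>"
  and edges_tree: "edges tree = c ` (\<L> - {verts G})"
  by (simp_all add: tree_def)

lemma endpts_tree: "P \<in> \<L> \<Longrightarrow> endpts tree (c P) = {c P, c (par P)}"
  by (simp add: tree_def dec_c)

lemma edge_treeE:
  assumes "e \<in> edges tree"
  obtains P where "P \<in> \<L>" "P \<noteq> verts G" "e = c P"
  using assms by (auto simp: edges_tree)

lemma c_mem_below: "L \<in> \<L> \<Longrightarrow> c L \<in> below P \<longleftrightarrow> L \<subseteq> P"
  unfolding below_def using c_eq by auto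

lemma multigraph_tree: "multigraph tree"
  unfolding multigraph_def
proof
  fix e assume "e \<in> edges tree"
  then obtain P where P: "P \<in> \<L>" "P \<noteq> verts G" "e = c P" by (rule edge_treeE)
  have "c P \<noteq> c (par P)" using c_eq[OF P(1) par(1)[OF P(1,2)]] par(2)[OF P(1,2)] by blast
  then show "endpts tree e \<subseteq> verts tree \<and> card (endpts tree e) = 2"
    using P par(1)[OF P(1,2)] by (simp add: endpts_tree verts_tree)
qed

text \<open>The edge from \<open>Q\<close> to its parent leaves the subtree of \<open>P\<close> only
  if \<open>Q\<close> is \<open>P\<close>, as the parent is the least proper superset. Subtracting
  the code of the root covers \<open>P = verts G\<close>, where the cut is empty.\<close>

lemma edge_cut_below:
  assumes "P \<in> \<L>"
  shows "edge_cut tree (below P) = {c P} - {c (verts G)}"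
proof -
  have "c Q \<in> edge_cut tree (below P) \<longleftrightarrow> Q = P" if Q: "Q \<in> \<L>" "Q \<noteq> verts G" for Q
  proof -
    note pQ = par[OF Q]
    have "c Q \<in> edge_cut tree (below P) \<longleftrightarrow> (Q \<subseteq> P) \<noteq> (par Q \<subseteq> P)"
      using edge_cut_pair[OF multigraph_tree _ endpts_tree[OF Q(1)], of "below P"] Q c_mem_below pQ(1)
      by (auto simp: edges_tree)
    also have "\<dots> \<longleftrightarrow> Q = P"
    proof
      assume a: "(Q \<subseteq> P) \<noteq> (par Q \<subseteq> P)"
      then have "Q \<subseteq> P" "\<not> par Q \<subseteq> P" using pQ(2) by auto
      then show "Q = P" using pQ(3)[OF assms] by blast
    next
      assume "Q = P"
      then show "(Q \<subseteq> P) \<noteq> (par Q \<subseteq> P)" using pQ(2) by blast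
    qed
    finally show ?thesis .
  qed
  then have mem: "e \<in> edge_cut tree (below P) \<longleftrightarrow> e = c P" if "e \<in> edges tree" for e
    using that assms c_eq by (elim edge_treeE) auto
  have ce: "c P \<in> edges tree \<longleftrightarrow> c P \<noteq> c (verts G)"
    using c_eq[OF assms] c_eq[OF assms V_mem] assms by (auto simp: edges_tree)
  show ?thesis
  proof (rule set_eqI)
    fix e
    show "e \<in> edge_cut tree (below P) \<longleftrightarrow> e \<in> {c P} - {c (verts G)}"
    proof (cases "e \<in> edges tree")
      case True
      then show ?thesis using mem[OF True] ce by auto
    next
      case False
      then have "e \<notin> edge_cut tree (below P)" using edge_cut_subset_edges[of tree] by (meson subsetD)
      then show ?thesis using ce False by auto
    qed
  qed
qed

lemma finite_cut_below: "P \<in> \<L> \<Longrightarrow> finite (edge_cut tree (below P))"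
  by (simp add: edge_cut_below)

text \<open>From a part without the top one climbs to the last set before leaving it; the edge to
  its parent exits. \<open>H\<close> is the tree with or without a deleted edge, and the top
  \<open>M\<close> is \<open>P\<close> for a lower component and \<open>verts G\<close> for an upper
  one.\<close>

lemma conn_in_up_closed:
  assumes A: "\<A> \<subseteq> \<L>" "M \<in> \<A>" "\<And>L. L \<in> \<A> \<Longrightarrow> L \<noteq> M \<Longrightarrow> L \<noteq> verts G \<and> par L \<in> \<A>"
    and H: "\<And>L. L \<in> \<A> \<Longrightarrow> L \<noteq> M \<Longrightarrow> c L \<in> edges H \<and> endpts H (c L) = {c L, c (par L)}"
  shows "conn_in H (c ` \<A>)"
  unfolding conn_in_def
proof (intro allI impI)
  fix B assume B: "B \<subseteq> c ` \<A>" "B \<noteq> {} \<and> B \<noteq> c ` \<A>"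
  have key: "\<exists>e\<in>edges H. \<exists>a\<in>B'. \<exists>b\<in>c ` \<A> - B'. endpts H e = {a, b}"
    if B': "B' \<subseteq> c ` \<A>" "B' \<noteq> {}" "c M \<notin> B'" for B'
  proof -
    obtain L0 where L0: "L0 \<in> \<A>" "c L0 \<in> B'" using B' by blast
    have fin: "finite {L \<in> \<A>. L0 \<subseteq> L \<and> c L \<in> B'}"
      by (rule finite_subset[OF _ finite_supersets[of L0]]) (use L0 A in auto)
    have mem: "L0 \<in> {L \<in> \<A>. L0 \<subseteq> L \<and> c L \<in> B'}" using L0 by simp
    obtain L where L: "L \<in> {L \<in> \<A>. L0 \<subseteq> L \<and> c L \<in> B'}"
        "\<forall>L'\<in>{L \<in> \<A>. L0 \<subseteq> L \<and> c L \<in> B'}. L \<subseteq> L' \<longrightarrow> L = L'"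
      using ex_maximal_set[OF fin mem] by (elim bexE)
    have LM: "L \<in> \<A>" "L \<noteq> M" "L0 \<subseteq> L" "c L \<in> B'" using L(1) B'(3) by auto
    have L': "L \<in> \<L>" "L \<noteq> verts G" "par L \<in> \<A>" using A LM by auto
    have p: "L \<subset> par L" by (rule par(2)[OF L'(1,2)])
    have "c (par L) \<notin> B'"
    proof
      assume "c (par L) \<in> B'"
      then have "L = par L" using L(2) L'(3) LM(3) p by auto
      then show False using p by simp
    qed
    then show ?thesis using H[OF LM(1,2)] LM(4) L'(3) by blast
  qed
  show "\<exists>e\<in>edges H. \<exists>a\<in>B. \<exists>b\<in>c ` \<A> - B. endpts H e = {a, b}"
  proof (cases "c M \<in> B")
    case False
    then show ?thesis using key[of B] B by blast
  next
    \<comment> \<open>An edge between \<open>B\<close> and the rest is equally one for the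
      complement of \<open>B\<close>, which does not contain the top.\<close>
    case True
    then have "\<exists>e\<in>edges H. \<exists>a\<in>c ` \<A> - B. \<exists>b\<in>c ` \<A> - (c ` \<A> - B). endpts H e = {a, b}"
      using B by (intro key) auto
    then obtain e a b where "e \<in> edges H" "a \<in> c ` \<A> - B" "b \<in> B" "endpts H e = {b, a}"
      by (auto simp: insert_commute)
    then show ?thesis by blast
  qed
qed

lemma conn_in_below:
  assumes "P \<in> \<L>" "e \<notin> c ` {L \<in> \<L>. L \<subset> P}"
  shows "conn_in (del_edges tree {e}) (below P)"
  unfolding below_def
proof (rule conn_in_up_closed[where M = P])
  fix L assume L: "L \<in> {L \<in> \<L>. L \<subseteq> P}" "L \<noteq> P"
  then have L': "L \<in> \<L>" "L \<noteq> verts G" "L \<subset> P" using memD[OF assms(1)] by auto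
  show "L \<noteq> verts G \<and> par L \<in> {L \<in> \<L>. L \<subseteq> P}" using L' par[OF L'(1,2)] assms(1) by simp
  have "c L \<noteq> e" using assms(2) L' by auto
  then show "c L \<in> edges (del_edges tree {e}) \<and> endpts (del_edges tree {e}) (c L) = {c L, c (par L)}"
    using L' by (simp add: del_edges_def edges_tree endpts_tree)
qed (use assms in auto)

lemma conn_in_below_tree:
  assumes "P \<in> \<L>"
  shows "conn_in tree (below P)"
  unfolding below_def
proof (rule conn_in_up_closed[where M = P])
  fix L assume L: "L \<in> {L \<in> \<L>. L \<subseteq> P}" "L \<noteq> P"
  then have L': "L \<in> \<L>" "L \<noteq> verts G" "L \<subset> P" using memD[OF assms(1)] by auto
  show "L \<noteq> verts G \<and> par L \<in> {L \<in> \<L>. L \<subseteq> P}" using L' par[OF L'(1,2)] assms(1) by simp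
  show "c L \<in> edges tree \<and> endpts tree (c L) = {c L, c (par L)}"
    using L' by (simp add: edges_tree endpts_tree)
qed (use assms in auto)

lemma below_V: "below (verts G) = verts tree"
  using memD by (auto simp: below_def verts_tree)

lemma components_tree:
  assumes P: "P \<in> \<L>" "P \<noteq> verts G"
  shows "graph_components (del_edges tree {c P}) = {below P, verts tree - below P}"
proof (rule graph_components_two[OF multigraph_del_edges[OF multigraph_tree]])
  show "verts (del_edges tree {c P}) = below P \<union> (verts tree - below P)"
    by (auto simp: del_edges_def below_def verts_tree)
  show "below P \<noteq> {}" using P by (auto simp: below_def)
  have "c (verts G) \<notin> below P" using c_mem_below[OF V_mem] memD[OF P(1)] P(2) by blast
  then show "verts tree - below P \<noteq> {}" using V_mem by (auto simp: verts_tree)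
  show "conn_in (del_edges tree {c P}) (below P)"
    by (rule conn_in_below[OF P(1)]) (use c_eq P(1) in auto)
  have rest: "verts tree - below P = c ` {L \<in> \<L>. \<not> L \<subseteq> P}"
    using c_mem_below by (auto simp: verts_tree)
  show "conn_in (del_edges tree {c P}) (verts tree - below P)"
    unfolding rest
  proof (rule conn_in_up_closed[where M = "verts G"])
    fix L assume L: "L \<in> {L \<in> \<L>. \<not> L \<subseteq> P}" "L \<noteq> verts G"
    then have L': "L \<in> \<L>" "L \<noteq> verts G" "\<not> L \<subseteq> P" by auto
    show "L \<noteq> verts G \<and> par L \<in> {L \<in> \<L>. \<not> L \<subseteq> P}" using L' par(1,2)[OF L'(1,2)] by auto
    have "c L \<noteq> c P" using c_eq[OF L'(1) P(1)] L'(3) by auto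
    then show "c L \<in> edges (del_edges tree {c P}) \<and> endpts (del_edges tree {c P}) (c L) = {c L, c (par L)}"
      using L' by (simp add: del_edges_def edges_tree endpts_tree)
  qed (use V_mem memD[OF P(1)] P(2) in auto)
  have "edge_cut (del_edges tree {c P}) (below P) = edge_cut tree (below P) - {c P}"
    by (auto simp: edge_cut_def del_edges_def)
  then show "edge_cut (del_edges tree {c P}) (below P) = {}"
    using edge_cut_below[OF P(1)] by auto
qed auto

text \<open>For acyclicity: an edge \<open>c P\<close> is the only one in the cut of
  \<open>below P\<close>, so a cycle closed by it would have to cross that cut a second time by
  another edge.\<close>

lemma tree_graph_tree: "tree_graph tree"
  unfolding tree_graph_def
proof (intro conjI notI)
  show "multigraph tree" by (rule multigraph_tree)
  show "connected_graph tree"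
    using conn_in_below_tree[OF V_mem] V_mem unfolding connected_graph_iff[OF multigraph_tree] below_V
    by (auto simp: verts_tree)
  assume "\<exists>vs es e. is_cycle tree vs es e"
  then obtain vs es e where cyc: "is_path tree vs es" "e \<in> edges tree - set es" "endpts tree e = {last vs, hd vs}"
    unfolding is_cycle_def by blast
  obtain P where P: "P \<in> \<L>" "P \<noteq> verts G" "e = c P" using cyc(2) by (auto elim: edge_treeE)
  have cut: "edge_cut tree (below P) = {e}"
    using edge_cut_below[OF P(1)] c_eq[OF P(1) V_mem] P(2,3) by auto
  have "e \<in> edge_cut tree (below P) \<longleftrightarrow> (last vs \<in> below P) \<noteq> (hd vs \<in> below P)"
    by (rule edge_cut_pair[OF multigraph_tree _ cyc(3)]) (use cyc(2) in simp)
  then have "(vs ! 0 \<in> below P) \<noteq> (vs ! length es \<in> below P)"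
    using cut path_hd_last[OF cyc(1)] by auto
  then obtain i where "i < length es" "es ! i \<in> edge_cut tree (below P)"
    using subpath_crosses[OF multigraph_tree cyc(1), of 0 "length es"] by auto
  then show False using cut cyc(2) by (metis DiffD2 nth_mem singletonD)
qed

text \<open>A path uses the single edge into \<open>below P\<close> at most once. Unless
  \<open>P\<close> is the root set, a path from the root starts outside, so after visiting
  \<open>c P\<close> it cannot leave again; conversely it can enter only along the edge
  \<open>c P\<close>, which ends at the node \<open>c P\<close>.\<close>

lemma tree_le_iff:
  assumes P: "P \<in> \<L>" and Q: "Q \<in> \<L>"
  shows "tree_le tree (c (verts G)) (c P) (c Q) \<longleftrightarrow> Q \<subseteq> P"
proof
  assume "tree_le tree (c (verts G)) (c P) (c Q)"
  then obtain vs es where p: "is_path tree vs es" "hd vs = c (verts G)" "last vs = c Q" "c P \<in> set vs"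
    unfolding tree_le_def by blast
  show "Q \<subseteq> P"
  proof (rule ccontr)
    assume n: "\<not> Q \<subseteq> P"
    have len: "length vs = Suc (length es)" using p(1) by (simp add: is_path_def)
    obtain k where k: "k \<le> length es" "vs ! k = c P" using p(4) len by (metis in_set_conv_nth less_Suc_eq_le)
    have "\<not> verts G \<subseteq> P" using n memD[OF Q] by blast
    then have b: "vs ! 0 \<notin> below P" "vs ! length es \<notin> below P" "vs ! k \<in> below P"
      using n k path_hd_last[OF p(1)] p(2,3) c_mem_below[OF V_mem] c_mem_below[OF Q] c_mem_below[OF P] by auto
    obtain i where i: "i < k" "es ! i \<in> edge_cut tree (below P)"
      using subpath_crosses[OF multigraph_tree p(1), of 0 k "below P"] b k by auto
    obtain j where j: "k \<le> j" "j < length es" "es ! j \<in> edge_cut tree (below P)"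
      using subpath_crosses[OF multigraph_tree p(1), of k "length es" "below P"] b k by auto
    have "es ! i = es ! j" using i(2) j(3) edge_cut_below[OF P] by auto
    then have "i = j" using path_edge_nth_inj[OF p(1)] i(1) j by simp
    then show False using i(1) j(1) by simp
  qed
next
  assume QP: "Q \<subseteq> P"
  have "joined tree {c (verts G)} {c Q}"
    using tree_graph_tree V_mem Q by (simp add: tree_graph_def connected_graph_def verts_tree)
  then obtain vs es where p: "is_path tree vs es" "hd vs = c (verts G)" "last vs = c Q"
    unfolding joined_def by auto
  have len: "length vs = Suc (length es)" using p(1) by (simp add: is_path_def)
  have "c P \<in> set vs"
  proof (cases "P = verts G")
    case True
    then show ?thesis using p(2) len by (metis hd_in_set length_0_conv nat.distinct(1))
  next
    case False
    then have "vs ! 0 \<notin> below P" "vs ! length es \<in> below P"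
      using path_hd_last[OF p(1)] p(2,3) c_mem_below[OF V_mem] c_mem_below[OF Q] QP memD[OF P] by auto
    then obtain i where i: "i < length es" "es ! i \<in> edge_cut tree (below P)"
      using subpath_crosses[OF multigraph_tree p(1), of 0 "length es" "below P"] by auto
    have "es ! i = c P" using i(2) edge_cut_below[OF P] by auto
    then have "c P \<in> endpts tree (es ! i)" using endpts_tree[OF P] by simp
    moreover have "endpts tree (es ! i) = {vs ! i, vs ! Suc i}" using p(1) i(1) by (simp add: is_path_def)
    ultimately have "c P \<in> {vs ! i, vs ! Suc i}" by (rule back_subst)
    then show ?thesis using i(1) len by auto
  qed
  then show "tree_le tree (c (verts G)) (c P) (c Q)"
    unfolding tree_le_def using p by blast
qed

section \<open>Bags and adhesion sets\<close>

lemma bag_c: "L \<in> \<L> \<Longrightarrow> bag (c L) = L - \<Union>{D \<in> \<L>. D \<subset> L}"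
  by (simp add: bag_def dec_c)

text \<open>A vertex belongs to the bag of a smallest member around it, which exists by
  point-finiteness.\<close>

lemma bags_below:
  assumes "P \<in> \<L>"
  shows "bags_of bag (below P) = P"
proof
  show "bags_of bag (below P) \<subseteq> P"
    by (auto simp: bags_of_def below_def bag_c)
  show "P \<subseteq> bags_of bag (below P)"
  proof
    fix v assume v: "v \<in> P"
    have fin: "finite {L \<in> \<L>. v \<in> L \<and> L \<subseteq> P}"
      by (rule finite_subset[OF _ pf[of v]]) (use v memD[OF assms] in auto)
    have mem: "P \<in> {L \<in> \<L>. v \<in> L \<and> L \<subseteq> P}" using v assms by simp
    obtain L where L: "L \<in> {L \<in> \<L>. v \<in> L \<and> L \<subseteq> P}" "\<forall>L'\<in>{L \<in> \<L>. v \<in> L \<and> L \<subseteq> P}. L' \<subseteq> L \<longrightarrow> L = L'"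
      using ex_minimal_set[OF fin mem] by (elim bexE)
    have "v \<notin> D" if "D \<in> \<L>" "D \<subset> L" for D
      using L that by auto
    then have "v \<in> bag (c L)" using L(1) by (auto simp: bag_c)
    moreover have "c L \<in> below P" using L(1) by (auto simp: below_def)
    ultimately show "v \<in> bags_of bag (below P)" by (auto simp: bags_of_def)
  qed
qed

lemma bags_disjoint: "disjoint_family_on bag (verts tree)"
  unfolding disjoint_family_on_def
proof (intro ballI impI)
  fix m n assume "m \<in> verts tree" "n \<in> verts tree" "m \<noteq> n"
  then obtain A B where AB: "A \<in> \<L>" "B \<in> \<L>" "m = c A" "n = c B" "A \<noteq> B" by (auto simp: verts_tree)
  then show "bag m \<inter> bag n = {}"
    using nestL[OF AB(1,2)] unfolding nest_def by (auto simp: bag_c)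
qed

lemma bags_rest:
  assumes "P \<in> \<L>"
  shows "bags_of bag (verts tree - below P) = verts G - P"
proof -
  have 1: "bags_of bag (verts tree) = verts G" using bags_below[OF V_mem] below_V by simp
  have 2: "bags_of bag (verts tree) = bags_of bag (verts tree - below P) \<union> bags_of bag (below P)"
    by (auto simp: bags_of_def below_def verts_tree)
  have 3: "bags_of bag (verts tree - below P) \<inter> bags_of bag (below P) = {}"
  proof -
    have "bag m \<inter> bag n = {}" if "m \<in> verts tree - below P" "n \<in> below P" for m n
    proof -
      have "n \<in> verts tree" using that(2) by (auto simp: below_def verts_tree)
      then show ?thesis using that by (intro disjoint_family_onD[OF bags_disjoint]) auto
    qed
    then show ?thesis unfolding bags_of_def by blast
  qed
  show ?thesis using 1 2 3 bags_below[OF assms] by blast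
qed

lemma decomposition_tree: "rooted_tree_cut_decomposition G tree (c (verts G)) bag"
  unfolding rooted_tree_cut_decomposition_def
  using tree_graph_tree V_mem bags_disjoint bags_below[OF V_mem] below_V by (auto simp: verts_tree)

lemma part_above_tree:
  assumes "P \<in> \<L>"
  shows "part_above tree (c (verts G)) bag (c P) = P"
proof -
  have "{s \<in> verts tree. tree_le tree (c (verts G)) (c P) s} = below P"
    using tree_le_iff[OF assms] by (auto simp: verts_tree below_def)
  then show ?thesis unfolding part_above_def using bags_below[OF assms] by simp
qed

lemma adhesion_tree:
  assumes P: "P \<in> \<L>" "P \<noteq> verts G"
  shows "adhesion_set G tree bag (c P) = edge_cut G P"
proof -
  have ne: "below P \<noteq> verts tree - below P" using P by (auto simp: below_def)
  have "adhesion_set G tree bag (c P) = edges_between G P (verts G - P) \<union> edges_between G (verts G - P) P"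
  proof (rule set_eqI)
    fix g
    have two: "(\<exists>A B. A \<in> {X, Y} \<and> B \<in> {X, Y} \<and> A \<noteq> B \<and> Q A B) \<longleftrightarrow> Q X Y \<or> Q Y X"
      if "X \<noteq> Y" for X Y :: "nat set" and Q
      using that by auto
    show "g \<in> adhesion_set G tree bag (c P) \<longleftrightarrow>
        g \<in> edges_between G P (verts G - P) \<union> edges_between G (verts G - P) P"
      unfolding adhesion_set_def components_tree[OF P] mem_Collect_eq two[OF ne]
        bags_below[OF P(1)] bags_rest[OF P(1)] by simp
  qed
  also have "\<dots> = edge_cut G P"
  proof -
    have "e \<in> edge_cut G P \<longleftrightarrow> (\<exists>a\<in>P. \<exists>b\<in>verts G - P. endpts G e = {a, b})" if "e \<in> edges G" for e
    proof -
      have "endpts G e \<subseteq> verts G" using mg that by (simp add: multigraph_def)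
      then show ?thesis unfolding mem_edge_cut[OF mg] using that by blast
    qed
    then have "edges_between G P (verts G - P) = edge_cut G P"
      using edge_cut_subset_edges[of G P] unfolding edges_between_def by blast
    moreover have "edges_between G A B \<subseteq> edges_between G B A" for A B
    proof
      fix e assume "e \<in> edges_between G A B"
      then obtain a b where "e \<in> edges G" "a \<in> A" "b \<in> B" "endpts G e = {b, a}"
        by (auto simp: edges_between_def insert_commute)
      then show "e \<in> edges_between G B A" unfolding edges_between_def by blast
    qed
    then have "edges_between G (verts G - P) P = edges_between G P (verts G - P)" by blast
    ultimately show ?thesis by simp
  qed
  finally show ?thesis .
qed

lemma finite_adhesion_tree: "finite_adhesion G tree bag"
  unfolding finite_adhesion_def
proof
  fix e assume "e \<in> edges tree"
  then obtain P where P: "P \<in> \<L>" "P \<noteq> verts G" "e = c P" by (rule edge_treeE)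
  then show "finite (adhesion_set G tree bag e)" using adhesion_tree[OF P(1,2)] memD[OF P(1)] by simp
qed

lemma finite_bags_tree: "t \<in> verts tree \<Longrightarrow> finite (bag t)"
  using finite_rest by (auto simp: verts_tree bag_c)

lemma locally_finite_tree: "locally_finite tree"
  unfolding locally_finite_def
proof
  fix n assume "n \<in> verts tree"
  then obtain P where P: "P \<in> \<L>" "n = c P" by (auto simp: verts_tree)
  have "incident_edges tree n \<subseteq> insert (c P) (c ` kid_sets P)"
  proof
    fix e assume e: "e \<in> incident_edges tree n"
    then obtain Q where Q: "Q \<in> \<L>" "Q \<noteq> verts G" "e = c Q"
      by (auto simp: incident_edges_def elim: edge_treeE)
    then have "c P = c Q \<or> c P = c (par Q)" using e P(2) by (auto simp: incident_edges_def endpts_tree)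
    then have "P = Q \<or> P = par Q" using c_eq P(1) Q(1) par(1)[OF Q(1,2)] by blast
    then show "e \<in> insert (c P) (c ` kid_sets P)" using Q by (auto simp: kid_sets_def)
  qed
  then show "finite (incident_edges tree n)"
    using finite_kid_sets[OF P(1)] by (meson finite.insertI finite_imageI finite_subset)
qed

end

text \<open>Otherwise the ray would leave each of the finitely many sets for good and be trapped in
  a finite rest. The graph \<open>H\<close> will be both \<open>G\<close> and the tree.\<close>

lemma ev_in_some:
  assumes mg: "multigraph H" and v: "v \<in> vrays H" "ev_in v X"
    and D: "finite \<D>" "\<And>D. D \<in> \<D> \<Longrightarrow> finite (edge_cut H D)" and X: "finite (X - \<Union>\<D>)"
  shows "\<exists>D\<in>\<D>. ev_in v D"
proof (rule ccontr)
  assume no: "\<not> (\<exists>D\<in>\<D>. ev_in v D)"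
  have "\<forall>\<^sub>F i in sequentially. v i \<in> verts H - D" if "D \<in> \<D>" for D
    using vray_dichotomy[OF mg v(1) D(2)[OF that]] no that by blast
  then have "\<forall>\<^sub>F i in sequentially. \<forall>D\<in>\<D>. v i \<in> verts H - D"
    by (intro eventually_ball_finite[OF D(1)]) blast
  then have "\<forall>\<^sub>F i in sequentially. v i \<in> X - \<Union>\<D>"
    using v(2) by eventually_elim blast
  then show False using inj_not_ev_in_finite[OF vrays_inj[OF v(1)] X] by blast
qed

context family
begin

section \<open>Linkedness of the decomposition\<close>

definition nested_seq :: "(nat \<Rightarrow> 'v set) \<Rightarrow> nat \<Rightarrow> nat \<Rightarrow> bool" where
  "nested_seq q m n \<longleftrightarrow> (\<forall>i. m \<le> i \<and> i < n \<longrightarrow> q (Suc i) \<in> \<L> \<and> q (Suc i) \<noteq> verts G \<and> par (q (Suc i)) = q i)"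

text \<open>Parents are least proper supersets, so no member fits strictly between consecutive
  terms.\<close>

lemma nested_seq_between:
  assumes "nested_seq q m n" "m \<le> n" "L \<in> \<L>" "q n \<subseteq> L" "L \<subseteq> q m"
  shows "\<exists>i. m \<le> i \<and> i \<le> n \<and> L = q i"
  using assms(2,1,4)
proof (induction n rule: dec_induct)
  case base
  then show ?case using assms(5) by auto
next
  case (step n)
  have q: "q (Suc n) \<in> \<L>" "q (Suc n) \<noteq> verts G" "par (q (Suc n)) = q n"
    using step.prems(1) step.hyps unfolding nested_seq_def by auto
  show ?case
  proof (cases "q (Suc n) = L")
    case True
    then show ?thesis using step.hyps by (intro exI[of _ "Suc n"]) auto
  next
    case False
    then have "q n \<subseteq> L" using par(3)[OF q(1,2) assms(3)] step.prems(2) q(3) by blast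
    moreover have "nested_seq q m n" using step.prems(1) unfolding nested_seq_def by auto
    ultimately obtain i where "m \<le> i" "i \<le> n" "L = q i" using step.IH by blast
    then show ?thesis by (intro exI[of _ i]) simp
  qed
qed

text \<open>Menger's theorem from the outside of \<open>P\<close> to \<open>Q\<close>; linkedness of
  the family reduces the lower bound on all separating cuts to the members between \<open>Q\<close>
  and \<open>P\<close>. As the paths meet \<open>Q\<close> and the outside of \<open>P\<close> only
  at their ends, their first and last edges lie in the two cuts.\<close>

lemma linking_paths:
  assumes PQ: "P \<in> \<L>" "Q \<in> \<L>" "Q \<subseteq> P" and k: "\<And>L. L \<in> \<L> \<Longrightarrow> Q \<subseteq> L \<Longrightarrow> L \<subseteq> P \<Longrightarrow> k \<le> sz L"
  obtains \<P> where "finite \<P>" "card \<P> = k" "pairwise (\<lambda>P Q. disjnt (set (snd P)) (set (snd Q))) \<P>"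
    "\<forall>(vs, es)\<in>\<P>. is_path G vs es \<and> es \<noteq> [] \<and> hd es \<in> edge_cut G P \<and> last es \<in> edge_cut G Q \<and>
       last vs \<in> Q \<and> hd vs \<notin> P \<and> (\<forall>i<length es. vs ! i \<notin> Q \<and> vs ! Suc i \<in> P)"
proof -
  have PV: "P \<subseteq> verts G" "Q \<subseteq> verts G" using memD PQ by auto
  have A: "verts G - P \<subseteq> verts G" "(verts G - P) \<inter> Q = {}" using PQ(3) by auto
  have cuts: "k \<le> sz Z" if Z: "Q \<subseteq> Z" "Z \<subseteq> verts G - (verts G - P)" "fincut Z" for Z
  proof -
    obtain L where "L \<in> \<L>" "Q \<subseteq> L" "L \<subseteq> P" "sz L \<le> sz Z"
      using link[OF PQ(1,2) Z(1) _ Z(3)] Z(2) by blast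
    then show ?thesis using k[of L] by simp
  qed
  obtain \<P> where \<P>: "finite \<P>" "card \<P> = k" "pairwise (\<lambda>P Q. disjnt (set (snd P)) (set (snd Q))) \<P>"
    "\<forall>(vs, es)\<in>\<P>. is_path G vs es \<and> hd vs \<in> verts G - P \<and> last vs \<in> Q \<and> es \<noteq> [] \<and>
      (\<forall>i<length es. vs ! i \<notin> Q \<and> vs ! Suc i \<notin> verts G - P)"
    by (rule edge_menger[OF mg A(1) PV(2) A(2) cuts])
  show thesis
  proof (rule that[OF \<P>(1-3)])
    have "is_path G vs es \<and> es \<noteq> [] \<and> hd es \<in> edge_cut G P \<and> last es \<in> edge_cut G Q \<and>
       last vs \<in> Q \<and> hd vs \<notin> P \<and> (\<forall>i<length es. vs ! i \<notin> Q \<and> vs ! Suc i \<in> P)"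
      if mem: "(vs, es) \<in> \<P>" for vs es
    proof -
      have p: "is_path G vs es \<and> hd vs \<in> verts G - P \<and> last vs \<in> Q \<and> es \<noteq> [] \<and>
        (\<forall>i<length es. vs ! i \<notin> Q \<and> vs ! Suc i \<notin> verts G - P)"
        using \<P>(4) mem by blast
      have path: "is_path G vs es" and ne: "es \<noteq> []" using p by auto
      have len: "length vs = Suc (length es)" "set vs \<subseteq> verts G" "set es \<subseteq> edges G"
        and e: "\<And>i. i < length es \<Longrightarrow> endpts G (es ! i) = {vs ! i, vs ! Suc i}"
        using path by (auto simp: is_path_def)
      have inner: "vs ! i \<notin> Q \<and> vs ! Suc i \<in> P" if "i < length es" for i
        using p that len by (metis DiffI Suc_less_eq nth_mem subsetD)
      have n: "0 < length es" "length es - 1 < length es" using ne by auto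
      have "hd es = es ! 0" "last es = es ! (length es - 1)" using ne by (simp_all add: hd_conv_nth last_conv_nth)
      moreover have "vs ! 0 \<notin> P" using p path_hd_last(1)[OF path] by auto
      then have "es ! 0 \<in> edge_cut G P"
        using edge_cut_pair[OF mg _ e[OF n(1)], of P] inner[OF n(1)] len(3) n(1) by (meson nth_mem subsetD)
      moreover have "vs ! Suc (length es - 1) \<in> Q" using p path_hd_last(2)[OF path] n(1) by simp
      then have "es ! (length es - 1) \<in> edge_cut G Q"
        using edge_cut_pair[OF mg _ e[OF n(2)], of Q] inner[OF n(2)] len(3) n(2) by (meson nth_mem subsetD)
      ultimately show ?thesis using p inner by auto
    qed
    then show "\<forall>(vs, es)\<in>\<P>. is_path G vs es \<and> es \<noteq> [] \<and> hd es \<in> edge_cut G P \<and> last es \<in> edge_cut G Q \<and>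
       last vs \<in> Q \<and> hd vs \<notin> P \<and> (\<forall>i<length es. vs ! i \<notin> Q \<and> vs ! Suc i \<in> P)" by blast
  qed
qed

lemma linked_tree: "linked G tree (c (verts G)) bag"
  unfolding linked_def
proof (intro allI impI)
  fix ts fs
  assume a: "is_path tree ts fs \<and> fs \<noteq> [] \<and>
    (\<forall>i<length fs. tree_le tree (c (verts G)) (ts ! i) (ts ! Suc i) \<and> ts ! i \<noteq> ts ! Suc i)"
  define n where "n = length fs"
  define q where "q i = dec (ts ! i)" for i
  have n: "0 < n" using a by (auto simp: n_def)
  have path: "length ts = Suc n" "set ts \<subseteq> c ` \<L>" "set fs \<subseteq> edges tree"
    "\<And>i. i < n \<Longrightarrow> endpts tree (fs ! i) = {ts ! i, ts ! Suc i}"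
    using a by (auto simp: is_path_def verts_tree n_def)
  have q: "q i \<in> \<L> \<and> ts ! i = c (q i)" if "i \<le> n" for i
  proof -
    have "ts ! i \<in> c ` \<L>" using that path(1,2) by (metis le_imp_less_Suc nth_mem subsetD)
    then show ?thesis by (auto simp: q_def dec_c)
  qed
  have step: "q (Suc i) \<noteq> verts G \<and> par (q (Suc i)) = q i \<and> fs ! i = c (q (Suc i)) \<and> q (Suc i) \<subset> q i"
    if i: "i < n" for i
  proof -
    have qi: "q i \<in> \<L>" "ts ! i = c (q i)" "q (Suc i) \<in> \<L>" "ts ! Suc i = c (q (Suc i))"
      using q[of i] q[of "Suc i"] i by auto
    have "tree_le tree (c (verts G)) (c (q i)) (c (q (Suc i)))" "c (q i) \<noteq> c (q (Suc i))"
      using a i qi by (auto simp: n_def)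
    then have sub: "q (Suc i) \<subset> q i" using tree_le_iff[OF qi(1,3)] by auto
    have "fs ! i \<in> edges tree" using path(3) i by (auto simp: n_def)
    then obtain X where X: "X \<in> \<L>" "X \<noteq> verts G" "fs ! i = c X" by (rule edge_treeE)
    have pX: "par X \<in> \<L>" "X \<subset> par X" using par[OF X(1,2)] by auto
    have "{c X, c (par X)} = {c (q i), c (q (Suc i))}"
      using path(4)[OF i] endpts_tree[OF X(1)] X(3) qi by simp
    then have "X = q i \<and> par X = q (Suc i) \<or> X = q (Suc i) \<and> par X = q i"
      using c_eq X(1) pX(1) qi(1,3) by (auto simp: doubleton_eq_iff)
    then have "X = q (Suc i)" "par X = q i" using sub pX(2) by auto
    then show ?thesis using X sub by auto
  qed
  \<comment> \<open>The edge from \<open>ts ! i\<close> to \<open>ts ! Suc i\<close> carries the cut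
    of \<open>q (Suc i)\<close>, so the first cut on the path is that of \<open>q 1\<close>, not of
    \<open>q 0\<close>.\<close>
  have seq: "nested_seq q 1 n"
    unfolding nested_seq_def using step q by auto
  have sub: "q n \<subseteq> q 1"
  proof -
    have "q (Suc j) \<subseteq> q 1" if "j < n" for j
      using that by (induction j) (use step in auto)
    then show ?thesis using n by (metis Suc_pred' diff_less less_one)
  qed
  have adh: "adhesion_set G tree bag (fs ! i) = edge_cut G (q (Suc i))" if "i < n" for i
    using step[OF that] q[of "Suc i"] adhesion_tree that by auto
  have hdl: "hd fs = fs ! 0" "last fs = fs ! (n - 1)"
    using a n by (simp_all add: hd_conv_nth last_conv_nth n_def)
  define k where "k = Min ((\<lambda>i. sz (q (Suc i))) ` {..<n})"
  have k: "k \<le> sz L" if L: "L \<in> \<L>" "q n \<subseteq> L" "L \<subseteq> q 1" for L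
  proof -
    obtain i where i: "1 \<le> i" "i \<le> n" "L = q i"
      using nested_seq_between[OF seq _ L] n by auto
    then have "sz L \<in> (\<lambda>i. sz (q (Suc i))) ` {..<n}" by (intro image_eqI[of _ _ "i - 1"]) auto
    then show ?thesis unfolding k_def by (intro Min_le) auto
  qed
  have q1: "q 1 \<in> \<L>" "q n \<in> \<L>" using q[of 1] q[of n] n by auto
  obtain \<P> where \<P>: "finite \<P>" "card \<P> = k" "pairwise (\<lambda>P Q. disjnt (set (snd P)) (set (snd Q))) \<P>"
    "\<forall>(vs, es)\<in>\<P>. is_path G vs es \<and> es \<noteq> [] \<and> hd es \<in> edge_cut G (q 1) \<and> last es \<in> edge_cut G (q n) \<and>
       last vs \<in> q n \<and> hd vs \<notin> q 1 \<and> (\<forall>i<length es. vs ! i \<notin> q n \<and> vs ! Suc i \<in> q 1)"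
    by (rule linking_paths[OF q1 sub k])
  have "adhesion_set G tree bag (hd fs) = edge_cut G (q 1)" "adhesion_set G tree bag (last fs) = edge_cut G (q n)"
    using adh[of 0] adh[of "n - 1"] n hdl by auto
  then have sub\<P>: "\<P> \<subseteq> edge_set_paths G (adhesion_set G tree bag (hd fs)) (adhesion_set G tree bag (last fs))"
    using \<P>(4) unfolding edge_set_paths_def by auto
  have "(\<lambda>f. ecard (adhesion_set G tree bag f)) ` set fs = enat ` ((\<lambda>i. sz (q (Suc i))) ` {..<n})"
  proof -
    have "set fs = (\<lambda>i. fs ! i) ` {..<n}" by (auto simp: n_def set_conv_nth)
    moreover have "ecard (adhesion_set G tree bag (fs ! i)) = enat (sz (q (Suc i)))" if "i < n" for i
      using adh[OF that] q[of "Suc i"] memD that by (auto simp: ecard_def cut_size_def)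
    ultimately show ?thesis by (simp add: image_image)
  qed
  moreover have "Min (enat ` ((\<lambda>i. sz (q (Suc i))) ` {..<n})) = enat k"
    unfolding k_def using n by (intro mono_Min_commute[symmetric]) (auto simp: mono_def)
  ultimately have "ecard \<P> = Min ((\<lambda>f. ecard (adhesion_set G tree bag f)) ` set fs)"
    using \<P>(1,2) by (simp add: ecard_def)
  then show "\<exists>\<P>\<subseteq>edge_set_paths G (adhesion_set G tree bag (hd fs)) (adhesion_set G tree bag (last fs)).
      pairwise (\<lambda>P Q. disjnt (set (snd P)) (set (snd Q))) \<P> \<and>
      ecard \<P> = Min ((\<lambda>f. ecard (adhesion_set G tree bag f)) ` set fs)"
    using sub\<P> \<P>(3) by blast
qed

section \<open>Displaying the ends\<close>

definition chain :: "(nat \<Rightarrow> 'v set) \<Rightarrow> bool" where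
  "chain p \<longleftrightarrow> p 0 = verts G \<and> (\<forall>n. p n \<in> \<L> \<and> p (Suc n) \<noteq> verts G \<and> par (p (Suc n)) = p n)"

lemma chainD:
  assumes "chain p"
  shows "p 0 = verts G" "p n \<in> \<L>" "p (Suc n) \<noteq> verts G" "par (p (Suc n)) = p n" "p (Suc n) \<subset> p n"
    "m \<le> n \<Longrightarrow> p n \<subseteq> p m" "inj p"
proof -
  show 1: "p 0 = verts G" "\<And>n. p n \<in> \<L>" "\<And>n. p (Suc n) \<noteq> verts G" "\<And>n. par (p (Suc n)) = p n"
    using assms by (auto simp: chain_def)
  show 2: "p (Suc n) \<subset> p n" for n using par(2)[OF 1(2) 1(3)] 1(4) by metis
  show 3: "m \<le> n \<Longrightarrow> p n \<subseteq> p m" for m n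
    by (induction n rule: dec_induct) (use 2 in auto)
  show "inj p"
  proof (rule linorder_injI)
    fix m n :: nat assume "m < n"
    then have "p n \<subseteq> p (Suc m)" by (intro 3) simp
    then show "p m \<noteq> p n" using 2[of m] by auto
  qed
qed

text \<open>An injective chain runs through the finitely many members around a vertex only finitely
  often. Here point-finiteness makes the intersection of a branch empty.\<close>

lemma chain_avoids:
  assumes p: "chain p" and X: "finite X"
  shows "\<exists>N. \<forall>n\<ge>N. p n \<inter> X = {}"
proof -
  have "finite {n. v \<in> p n}" for v
  proof (cases "v \<in> verts G")
    case True
    have "finite (p -` {L \<in> \<L>. v \<in> L})" using pf[OF True] chainD(7)[OF p] by (rule finite_vimageI)
    then show ?thesis by (rule rev_finite_subset) (use chainD(2)[OF p] in auto)
  next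
    case False
    then have "{n. v \<in> p n} = {}" using memD[OF chainD(2)[OF p]] by blast
    then show ?thesis by simp
  qed
  then have "finite (\<Union>v\<in>X. {n. v \<in> p n})" using X by blast
  then obtain N where "\<forall>n\<in>(\<Union>v\<in>X. {n. v \<in> p n}). n < N" using finite_nat_set_iff_bounded by blast
  then have "\<forall>n\<ge>N. p n \<inter> X = {}" by (fastforce simp: not_less[symmetric])
  then show ?thesis ..
qed

text \<open>Used to follow a ray of \<open>G\<close>, or a ray of the tree, down the family;
  \<open>\<Phi>\<close> then says that the set holds a tail.\<close>

lemma chain_exists:
  assumes "\<Phi> (verts G)" "\<And>P. P \<in> \<L> \<Longrightarrow> \<Phi> P \<Longrightarrow> \<exists>D\<in>kid_sets P. \<Phi> D"
  shows "\<exists>p. chain p \<and> (\<forall>n. \<Phi> (p n))"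
proof -
  have "\<exists>p. \<forall>n. (p n \<in> \<L> \<and> \<Phi> (p n) \<and> (n = 0 \<longrightarrow> p n = verts G)) \<and> p (Suc n) \<in> kid_sets (p n)"
  proof (rule dependent_nat_choice)
    show "\<exists>P. P \<in> \<L> \<and> \<Phi> P \<and> (0 = 0 \<longrightarrow> P = verts G)" using V_mem assms(1) by blast
    fix P and n :: nat assume "P \<in> \<L> \<and> \<Phi> P \<and> (n = 0 \<longrightarrow> P = verts G)"
    then obtain D where "D \<in> kid_sets P" "\<Phi> D" using assms(2) by blast
    then show "\<exists>D. (D \<in> \<L> \<and> \<Phi> D \<and> (Suc n = 0 \<longrightarrow> D = verts G)) \<and> D \<in> kid_sets P"
      by (auto simp: kid_sets_def)
  qed
  then obtain p where "\<And>n. p n \<in> \<L> \<and> \<Phi> (p n) \<and> (n = 0 \<longrightarrow> p n = verts G)" "\<And>n. p (Suc n) \<in> kid_sets (p n)"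
    by blast
  then show ?thesis by (intro exI[of _ p]) (auto simp: chain_def kid_sets_def)
qed

lemma Union_kid_sets:
  assumes "P \<in> \<L>"
  shows "\<Union>{D \<in> \<L>. D \<subset> P} = \<Union>(kid_sets P)"
proof
  show "\<Union>{D \<in> \<L>. D \<subset> P} \<subseteq> \<Union>(kid_sets P)" using below_kid[OF assms] by blast
  show "\<Union>(kid_sets P) \<subseteq> \<Union>{D \<in> \<L>. D \<subset> P}" 
  proof
    fix v assume "v \<in> \<Union>(kid_sets P)"
    then obtain D where D: "D \<in> \<L>" "D \<noteq> verts G" "par D = P" "v \<in> D" by (auto simp: kid_sets_def)
    then show "v \<in> \<Union>{D \<in> \<L>. D \<subset> P}" using par(2)[OF D(1,2)] by auto
  qed
qed

lemma chain_of_ray: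
  assumes v: "v \<in> vrays G"
  shows "\<exists>p. chain p \<and> (\<forall>n. ev_in v (p n))"
proof (rule chain_exists)
  show "ev_in v (verts G)" using vrays_verts[OF v] by simp
  fix P assume P: "P \<in> \<L>" "ev_in v P"
  show "\<exists>D\<in>kid_sets P. ev_in v D"
  proof (rule ev_in_some[OF mg v P(2) finite_kid_sets[OF P(1)]])
    show "fincut D" if "D \<in> kid_sets P" for D using that memD by (auto simp: kid_sets_def)
    show "finite (P - \<Union>(kid_sets P))" using finite_rest[OF P(1)] Union_kid_sets[OF P(1)] by simp
  qed
qed

lemma chain_of_tree_ray:
  assumes s: "s \<in> vrays tree"
  shows "\<exists>p. chain p \<and> (\<forall>n. ev_in s (below (p n)))"
proof (rule chain_exists)
  show "ev_in s (below (verts G))" using vrays_verts[OF s] below_V by simp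
  fix P assume P: "P \<in> \<L>" "ev_in s (below P)"
  have "\<exists>D\<in>below ` kid_sets P. ev_in s D"
  proof (rule ev_in_some[OF multigraph_tree s P(2)])
    show "finite (below ` kid_sets P)" using finite_kid_sets[OF P(1)] by simp
    show "finite (edge_cut tree D)" if "D \<in> below ` kid_sets P" for D
      using that finite_cut_below by (auto simp: kid_sets_def)
    have "below P - \<Union>(below ` kid_sets P) \<subseteq> {c P}"
    proof
      fix x assume x: "x \<in> below P - \<Union>(below ` kid_sets P)"
      then obtain L where L: "L \<in> \<L>" "L \<subseteq> P" "x = c L" by (auto simp: below_def)
      have "\<not> L \<subset> P"
      proof
        assume "L \<subset> P"
        then obtain D where "D \<in> kid_sets P" "L \<subseteq> D" using below_kid[OF P(1) L(1)] by blast
        then show False using x L c_mem_below by blast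
      qed
      then show "x \<in> {c P}" using L by auto
    qed
    then show "finite (below P - \<Union>(below ` kid_sets P))" using finite_subset by blast
  qed
  then show "\<exists>D\<in>kid_sets P. ev_in s (below D)" by blast
qed

definition tray :: "(nat \<Rightarrow> 'v set) \<Rightarrow> (nat, nat) ray" where
  "tray p = (\<lambda>n. c (p n), \<lambda>n. c (p (Suc n)))"

lemma tray_ray:
  assumes p: "chain p"
  shows "tray p \<in> rays tree"
proof -
  have "inj (\<lambda>n. c (p n))"
    using chainD(7)[OF p] c_eq chainD(2)[OF p] by (auto simp: inj_def)
  moreover have "endpts tree (c (p (Suc n))) = {c (p n), c (p (Suc n))}" for n
    using endpts_tree[OF chainD(2)[OF p]] chainD(4)[OF p] by (simp add: insert_commute)
  ultimately show ?thesis
    using chainD(2,3)[OF p] by (auto simp: tray_def rays_def verts_tree edges_tree)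
qed

lemma tray_below:
  assumes p: "chain p"
  shows "ev_in (fst (tray p)) (below (p n))"
proof -
  have "\<forall>m\<ge>n. fst (tray p) m \<in> below (p n)"
    using chainD(2,6)[OF p] by (auto simp: tray_def c_mem_below)
  then show ?thesis unfolding eventually_sequentially by blast
qed

lemma rays_in_chain_equiv:
  assumes p: "chain p" and RS: "R \<in> rays G" "S \<in> rays G" "\<And>n. ev_in (fst R) (p n)" "\<And>n. ev_in (fst S) (p n)"
  shows "edge_equiv G R S"
proof (rule edge_equiv_of_connected_family[OF mg RS(1,2), where \<A> = "range p"])
  show "infinite (range p)" using range_inj_infinite[OF chainD(7)[OF p]] .
  show "finite {A \<in> range p. v \<in> A}" if "v \<in> verts G" for v
    by (rule finite_subset[OF _ pf[OF that]]) (use chainD(2)[OF p] in auto)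
qed (use RS memD chainD(2)[OF p] in auto)

lemma tree_rays_in_chain_equiv:
  assumes p: "chain p" and RS: "R \<in> rays tree" "S \<in> rays tree"
    "\<And>n. ev_in (fst R) (below (p n))" "\<And>n. ev_in (fst S) (below (p n))"
  shows "edge_equiv tree R S"
proof (rule edge_equiv_of_connected_family[OF multigraph_tree RS(1,2), where \<A> = "range (\<lambda>n. below (p n))"])
  have "inj (\<lambda>n. below (p n))"
  proof (rule injI)
    fix m n assume e: "below (p m) = below (p n)"
    have "p m \<subseteq> p n" "p n \<subseteq> p m" using c_mem_below chainD(2)[OF p] e by blast+
    then show "m = n" using chainD(7)[OF p] by (auto dest: injD)
  qed
  then show "infinite (range (\<lambda>n. below (p n)))" by (rule range_inj_infinite)
  fix t assume "t \<in> verts tree"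
  then obtain Q where Q: "Q \<in> \<L>" "t = c Q" by (auto simp: verts_tree)
  obtain x where x: "x \<in> Q" using memD[OF Q(1)] by blast
  obtain N where N: "\<forall>n\<ge>N. p n \<inter> {x} = {}" using chain_avoids[OF p, of "{x}"] by blast
  have "{A \<in> range (\<lambda>n. below (p n)). t \<in> A} \<subseteq> (\<lambda>n. below (p n)) ` {..<N}"
  proof
    fix A assume "A \<in> {A \<in> range (\<lambda>n. below (p n)). t \<in> A}"
    then obtain n where n: "A = below (p n)" "c Q \<in> below (p n)" using Q(2) by auto
    then have "x \<in> p n" using c_mem_below[OF Q(1)] x by blast
    then have "n < N" using N by (meson disjoint_insert(1) leI)
    then show "A \<in> (\<lambda>n. below (p n)) ` {..<N}" using n(1) by blast
  qed
  then show "finite {A \<in> range (\<lambda>n. below (p n)). t \<in> A}" using finite_surj by blast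
qed (use RS conn_in_below_tree chainD(2)[OF p] in auto)

definition tree_end :: "(nat \<Rightarrow> 'v set) \<Rightarrow> (nat, nat) ray set" where
  "tree_end p = {S \<in> rays tree. edge_equiv tree (tray p) S}"

lemma ends_tree: "graph_ends tree = edge_ends tree"
  by (rule graph_ends_eq_edge_ends[OF multigraph_tree locally_finite_tree])

lemma tree_end:
  assumes "chain p"
  shows "tree_end p \<in> edge_ends tree" "tray p \<in> tree_end p"
proof -
  show "tree_end p \<in> edge_ends tree" unfolding tree_end_def by (rule edge_endsI[OF tray_ray[OF assms]])
  have "edge_equiv tree (tray p) (tray p)"
    using edge_equiv_iff[OF multigraph_tree tray_ray[OF assms] tray_ray[OF assms]] by blast
  then show "tray p \<in> tree_end p" using tray_ray[OF assms] by (simp add: tree_end_def)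
qed

lemma oriented_towards_tree:
  "oriented_towards tree bag \<omega> x \<longleftrightarrow>
    (\<forall>P\<in>\<L>. P \<noteq> verts G \<longrightarrow>
      (lives_in \<omega> P \<and> (case x of Inl t \<Rightarrow> t \<in> below P | Inr \<eta> \<Rightarrow> lives_in \<eta> (below P))) \<or>
      (lives_in \<omega> (verts G - P) \<and>
        (case x of Inl t \<Rightarrow> t \<in> verts tree - below P | Inr \<eta> \<Rightarrow> lives_in \<eta> (verts tree - below P))))"
proof -
  let ?K = "\<lambda>A. case x of Inl t \<Rightarrow> t \<in> A | Inr \<eta> \<Rightarrow> lives_in \<eta> A"
  have key: "(\<exists>A\<in>graph_components (del_edges tree {c P}). lives_in \<omega> (bags_of bag A) \<and> ?K A) \<longleftrightarrow>
      (lives_in \<omega> P \<and> ?K (below P)) \<or> (lives_in \<omega> (verts G - P) \<and> ?K (verts tree - below P))"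
    if "P \<in> \<L>" "P \<noteq> verts G" for P
    using components_tree[OF that] bags_below[OF that(1)] bags_rest[OF that(1)] by simp
  have "oriented_towards tree bag \<omega> x \<longleftrightarrow>
      (\<forall>P\<in>\<L>. P \<noteq> verts G \<longrightarrow>
        (\<exists>A\<in>graph_components (del_edges tree {c P}). lives_in \<omega> (bags_of bag A) \<and> ?K A))"
    unfolding oriented_towards_def edges_tree by auto
  also have "\<dots> \<longleftrightarrow> (\<forall>P\<in>\<L>. P \<noteq> verts G \<longrightarrow>
      (lives_in \<omega> P \<and> ?K (below P)) \<or> (lives_in \<omega> (verts G - P) \<and> ?K (verts tree - below P)))"
    by (intro ball_cong refl imp_cong key)
  finally show ?thesis .
qed

text \<open>Existence and uniqueness for the definite description in \<open>end_map\<close>. The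
  branch whose sets all hold a tail of \<open>R\<close> gives an end that agrees with every
  orientation. Any other candidate must lie below every \<open>p n\<close>: no node does, and an end
  that does is the end of the branch.\<close>

lemma end_map_chain:
  assumes \<omega>: "\<omega> \<in> edge_ends G" and R: "R \<in> \<omega>" and p: "chain p" and Rp: "\<And>n. ev_in (fst R) (p n)"
  shows "end_map tree bag \<omega> = Inr (tree_end p)"
proof -
  have RG: "R \<in> rays G" by (rule edge_end_rays[OF mg \<omega> R])
  have lw: "lives_in \<omega> C \<longleftrightarrow> ev_in (fst R) C" if "fincut C" for C
    by (rule lives_in_iff[OF mg \<omega> R that])
  have lwc: "lives_in \<omega> (verts G - P) \<longleftrightarrow> ev_in (fst R) (verts G - P)" if "P \<in> \<L>" for P
    using lw edge_cut_compl[OF mg] memD[OF that] by simp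
  note te = tree_end[OF p]
  have lt: "lives_in \<eta> (below P) \<longleftrightarrow> ev_in (fst S) (below P)"
    "lives_in \<eta> (verts tree - below P) \<longleftrightarrow> ev_in (fst S) (verts tree - below P)"
    if "P \<in> \<L>" "\<eta> \<in> edge_ends tree" "S \<in> \<eta>" for P \<eta> S
    using lives_in_iff[OF multigraph_tree that(2,3)] finite_cut_below[OF that(1)] edge_cut_compl[OF multigraph_tree]
    by simp_all
  have or: "oriented_towards tree bag \<omega> (Inr (tree_end p))"
    unfolding oriented_towards_tree
  proof (intro ballI impI)
    fix P assume P: "P \<in> \<L>" "P \<noteq> verts G"
    show "(lives_in \<omega> P \<and> (case Inr (tree_end p) of Inl t \<Rightarrow> t \<in> below P | Inr \<eta> \<Rightarrow> lives_in \<eta> (below P))) \<or>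
      (lives_in \<omega> (verts G - P) \<and>
        (case Inr (tree_end p) of Inl t \<Rightarrow> t \<in> verts tree - below P | Inr \<eta> \<Rightarrow> lives_in \<eta> (verts tree - below P)))"
    proof (cases "ev_in (fst R) P")
      case True
      \<comment> \<open>Late members of the branch miss \<open>x\<close>, so they cannot contain
        \<open>P\<close>; being nested with \<open>P\<close> and sharing a tail of \<open>R\<close>
        with it, they lie inside \<open>P\<close>.\<close>
      obtain x where x: "x \<in> P" using memD[OF P(1)] by blast
      obtain N where "\<forall>n\<ge>N. p n \<inter> {x} = {}" using chain_avoids[OF p, of "{x}"] by blast
      then have "\<not> P \<subseteq> p N" using x by blast
      moreover have "P \<inter> p N \<noteq> {}" using ev_in_disjoint[OF True Rp] .
      ultimately have "p N \<subseteq> P" using nestL[OF P(1) chainD(2)[OF p, of N]] unfolding nest_def by blast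
      then have "below (p N) \<subseteq> below P" by (auto simp: below_def)
      then have "ev_in (fst (tray p)) (below P)" using tray_below[OF p] ev_in_mono by blast
      then show ?thesis using lt(1)[OF P(1) te] lw[of P] True memD[OF P(1)] by simp
    next
      case False
      then have "ev_in (fst R) (verts G - P)"
        using vray_dichotomy[OF mg ray_vray[OF RG]] memD[OF P(1)] by blast
      moreover have "\<not> p n \<subseteq> P" for n using False Rp[of n] ev_in_mono by blast
      then have "fst (tray p) n \<in> verts tree - below P" for n
        using chainD(2)[OF p, of n] c_mem_below by (auto simp: tray_def verts_tree)
      then have "ev_in (fst (tray p)) (verts tree - below P)" by simp
      ultimately show ?thesis using lt(2)[OF P(1) te] lwc[OF P(1)] by simp
    qed
  qed
  have uniq: "x = Inr (tree_end p)" if x: "x \<in> verts tree <+> graph_ends tree" "oriented_towards tree bag \<omega> x" for x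
  proof -
    have K: "case x of Inl t \<Rightarrow> t \<in> below (p (Suc n)) | Inr \<eta> \<Rightarrow> lives_in \<eta> (below (p (Suc n)))" for n
    proof -
      have "\<not> lives_in \<omega> (verts G - p (Suc n))"
        using lwc[OF chainD(2)[OF p, of "Suc n"]] Rp[of "Suc n"] ev_in_disjoint[of "fst R" "verts G - p (Suc n)" "p (Suc n)"]
        by blast
      then show ?thesis
        using x(2)[unfolded oriented_towards_tree, rule_format, OF chainD(2)[OF p, of "Suc n"] chainD(3)[OF p, of n]]
        by blast
    qed
    from x(1) show ?thesis
    proof (elim PlusE)
      fix t assume t: "t \<in> verts tree" "x = Inl t"
      then obtain Q where Q: "Q \<in> \<L>" "t = c Q" by (auto simp: verts_tree)
      obtain y where y: "y \<in> Q" using memD[OF Q(1)] by blast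
      obtain N where "\<forall>n\<ge>N. p n \<inter> {y} = {}" using chain_avoids[OF p, of "{y}"] by blast
      then have "\<not> Q \<subseteq> p (Suc N)" using y by (metis Int_insert_right_if1 insert_not_empty le_SucI order_refl subsetD)
      then show ?thesis using K[of N] t Q c_mem_below[OF Q(1)] by simp
    next
      fix \<eta> assume \<eta>: "\<eta> \<in> graph_ends tree" "x = Inr \<eta>"
      then have \<eta>': "\<eta> \<in> edge_ends tree" using ends_tree by simp
      obtain S where S: "S \<in> \<eta>" using edge_end_nonempty[OF multigraph_tree \<eta>'] by blast
      have SR: "S \<in> rays tree" by (rule edge_end_rays[OF multigraph_tree \<eta>' S])
      have "ev_in (fst S) (below (p n))" for n
      proof (cases n)
        case 0
        then show ?thesis using vrays_verts[OF ray_vray[OF SR]] below_V chainD(1)[OF p] by simp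
      next
        case (Suc m)
        then show ?thesis using K[of m] \<eta>(2) lt(1)[OF chainD(2)[OF p] \<eta>' S] by simp
      qed
      then have "edge_equiv tree (tray p) S"
        by (intro tree_rays_in_chain_equiv[OF p tray_ray[OF p] SR tray_below[OF p]])
      then have "tree_end p = \<eta>"
        by (rule edge_ends_eqI[OF multigraph_tree te(1) \<eta>' te(2) S])
      then show ?thesis using \<eta>(2) by simp
    qed
  qed
  show ?thesis
    unfolding end_map_def
  proof (rule the_equality)
    show "Inr (tree_end p) \<in> verts tree <+> graph_ends tree \<and> oriented_towards tree bag \<omega> (Inr (tree_end p))"
      using or te(1) ends_tree by auto
  qed (use uniq in blast)
qed

lemma chain_of_end:
  assumes "\<omega> \<in> edge_ends G"
  obtains R p where "R \<in> \<omega>" "chain p" "\<And>n. ev_in (fst R) (p n)" "end_map tree bag \<omega> = Inr (tree_end p)"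
proof -
  obtain R where R: "R \<in> \<omega>" using edge_end_nonempty[OF mg assms] by blast
  obtain p where p: "chain p" "\<forall>n. ev_in (fst R) (p n)"
    using chain_of_ray[OF ray_vray[OF edge_end_rays[OF mg assms R]]] by blast
  then show ?thesis using that[OF R p(1)] end_map_chain[OF assms R p(1)] by blast
qed

text \<open>One vertex is taken from every member of the branch; infinitely many arise since the
  branch leaves every finite set. A ray converging to them has no tail outside \<open>p n\<close>,
  where only finitely many of them lie.\<close>

lemma ray_in_chain:
  assumes p: "chain p"
  shows "\<exists>R\<in>rays G. \<forall>n. ev_in (fst R) (p n)"
proof -
  have "\<forall>n. \<exists>x. x \<in> p n" using memD[OF chainD(2)[OF p]] by blast
  then obtain u where u: "\<And>n. u n \<in> p n" by metis
  have "infinite (range u)"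
  proof
    assume "finite (range u)"
    then obtain N where "\<forall>n\<ge>N. p n \<inter> range u = {}" using chain_avoids[OF p] by blast
    then show False using u by blast
  qed
  moreover have "range u \<subseteq> verts G" using u memD[OF chainD(2)[OF p]] by blast
  ultimately obtain v where v: "v \<in> vrays G" "\<And>C. fincut C \<Longrightarrow> ev_in v C \<Longrightarrow> infinite (C \<inter> range u)"
    using koenig by metis
  have "ev_in v (p n)" for n
  proof (rule ccontr)
    assume n: "\<not> ev_in v (p n)"
    have f: "fincut (p n)" using memD[OF chainD(2)[OF p]] by blast
    then have "ev_in v (verts G - p n)" using vray_dichotomy[OF mg v(1)] n by blast
    then have inf: "infinite ((verts G - p n) \<inter> range u)" using v(2) f edge_cut_compl[OF mg] by simp
    have "(verts G - p n) \<inter> range u \<subseteq> u ` {..<n}"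
    proof
      fix x assume x: "x \<in> (verts G - p n) \<inter> range u"
      then obtain m where m: "x = u m" by blast
      have "\<not> n \<le> m"
      proof
        assume "n \<le> m"
        then have "p m \<subseteq> p n" by (rule chainD(6)[OF p])
        then show False using x m u[of m] by auto
      qed
      then show "x \<in> u ` {..<n}" using m by auto
    qed
    then show False using inf finite_surj by blast
  qed
  moreover obtain e where "(v, e) \<in> rays G" using v(1) by (rule vray_ray)
  ultimately show ?thesis by (intro bexI[of _ "(v, e)"]) auto
qed

lemma displays_tree: "displays G tree bag (edge_ends G)"
  unfolding displays_def
proof
  have mem: "end_map tree bag \<omega> \<in> Inr ` graph_ends tree" if \<omega>: "\<omega> \<in> edge_ends G" for \<omega>
  proof -
    obtain R p where "chain p" "end_map tree bag \<omega> = Inr (tree_end p)" using chain_of_end[OF \<omega>] by metis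
    then show ?thesis using tree_end(1) ends_tree by simp
  qed
  then show "{\<omega> \<in> edge_ends G. end_map tree bag \<omega> \<in> Inr ` graph_ends tree} = edge_ends G" by blast
  show "bij_betw (end_map tree bag) (edge_ends G) (Inr ` graph_ends tree)"
    unfolding bij_betw_def
  proof
    show "inj_on (end_map tree bag) (edge_ends G)"
    proof (rule inj_onI)
      fix \<omega> \<omega>' assume \<omega>: "\<omega> \<in> edge_ends G" "\<omega>' \<in> edge_ends G" and eq: "end_map tree bag \<omega> = end_map tree bag \<omega>'"
      obtain R p where R: "R \<in> \<omega>" "chain p" "\<And>n. ev_in (fst R) (p n)" "end_map tree bag \<omega> = Inr (tree_end p)"
        using chain_of_end[OF \<omega>(1)] by metis
      obtain S q where S: "S \<in> \<omega>'" "chain q" "\<And>n. ev_in (fst S) (q n)" "end_map tree bag \<omega>' = Inr (tree_end q)"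
        using chain_of_end[OF \<omega>(2)] by metis
      have "tree_end p = tree_end q" using eq R(4) S(4) by simp
      then have "tray q \<in> tree_end p" using tree_end(2)[OF S(2)] by simp
      then have pq: "edge_equiv tree (tray p) (tray q)" by (simp add: tree_end_def)
      \<comment> \<open>Equivalent tree rays have tails below the same members, so each
        \<open>p n\<close> contains some \<open>q m\<close>, hence a tail of
        \<open>S\<close>.\<close>
      have "ev_in (fst S) (p n)" for n
      proof -
        have "ev_in (fst (tray q)) (below (p n))"
          using edge_equivD[OF multigraph_tree tray_ray[OF R(2)] tray_ray[OF S(2)] pq finite_cut_below[OF chainD(2)[OF R(2)]]]
            tray_below[OF R(2)] by blast
        then obtain m where "c (q m) \<in> below (p n)"
          using eventually_happens'[OF sequentially_bot] by (auto simp: tray_def)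
        then have "q m \<subseteq> p n" using c_mem_below[OF chainD(2)[OF S(2)]] by blast
        then show ?thesis using S(3)[of m] ev_in_mono by blast
      qed
      then have "edge_equiv G R S"
        by (intro rays_in_chain_equiv[OF R(2) edge_end_rays[OF mg \<omega>(1) R(1)] edge_end_rays[OF mg \<omega>(2) S(1)] R(3)])
      then show "\<omega> = \<omega>'" by (rule edge_ends_eqI[OF mg \<omega> R(1) S(1)])
    qed
    show "end_map tree bag ` edge_ends G = Inr ` graph_ends tree"
    proof
      show "end_map tree bag ` edge_ends G \<subseteq> Inr ` graph_ends tree" using mem by blast
      show "Inr ` graph_ends tree \<subseteq> end_map tree bag ` edge_ends G"
      proof
        fix y :: "nat + (nat, nat) ray set" assume "y \<in> Inr ` graph_ends tree"
        then obtain \<eta> where \<eta>: "y = Inr \<eta>" "\<eta> \<in> edge_ends tree" using ends_tree by auto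
        obtain S where S: "S \<in> \<eta>" using edge_end_nonempty[OF multigraph_tree \<eta>(2)] by blast
        have SR: "S \<in> rays tree" by (rule edge_end_rays[OF multigraph_tree \<eta>(2) S])
        obtain p where p: "chain p" "\<And>n. ev_in (fst S) (below (p n))"
          using chain_of_tree_ray[OF ray_vray[OF SR]] by blast
        obtain R where R: "R \<in> rays G" "\<And>n. ev_in (fst R) (p n)" using ray_in_chain[OF p(1)] by blast
        let ?\<omega> = "{S \<in> rays G. edge_equiv G R S}"
        have \<omega>: "?\<omega> \<in> edge_ends G" by (rule edge_endsI[OF R(1)])
        have "R \<in> ?\<omega>" using R(1) edge_equiv_iff[OF mg R(1) R(1)] by blast
        then have "end_map tree bag ?\<omega> = Inr (tree_end p)" by (rule end_map_chain[OF \<omega> _ p(1) R(2)])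
        moreover have "edge_equiv tree (tray p) S"
          by (rule tree_rays_in_chain_equiv[OF p(1) tray_ray[OF p(1)] SR tray_below[OF p(1)] p(2)])
        then have "tree_end p = \<eta>"
          by (rule edge_ends_eqI[OF multigraph_tree tree_end(1)[OF p(1)] \<eta>(2) tree_end(2)[OF p(1)] S])
        ultimately have "y = end_map tree bag ?\<omega>" using \<eta>(1) by simp
        then show "y \<in> end_map tree bag ` edge_ends G" using \<omega> by (rule image_eqI)
      qed
    qed
  qed
qed

end

section \<open>Edge-degrees\<close>

context family
begin

text \<open>The number of linking paths is the size of the starting cut, so every edge of that cut is the
  first edge of exactly one of them.\<close>

lemma linkage_map:
  assumes PQ: "P \<in> \<L>" "Q \<in> \<L>" "Q \<subseteq> P" and k: "\<And>L. L \<in> \<L> \<Longrightarrow> Q \<subseteq> L \<Longrightarrow> L \<subseteq> P \<Longrightarrow> sz P \<le> sz L"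
  shows "\<exists>f. \<forall>e\<in>edge_cut G P. is_path G (fst (f e)) (snd (f e)) \<and> snd (f e) \<noteq> [] \<and> hd (snd (f e)) = e \<and>
    last (snd (f e)) \<in> edge_cut G Q \<and> last (fst (f e)) \<in> Q \<and>
    (\<forall>i<length (snd (f e)). fst (f e) ! i \<notin> Q \<and> fst (f e) ! Suc i \<in> P) \<and>
    (\<forall>e'\<in>edge_cut G P. e' \<noteq> e \<longrightarrow> set (snd (f e)) \<inter> set (snd (f e')) = {})"
proof -
  obtain \<P> where \<P>: "finite \<P>" "card \<P> = sz P" "pairwise (\<lambda>P Q. disjnt (set (snd P)) (set (snd Q))) \<P>"
    "\<forall>(vs, es)\<in>\<P>. is_path G vs es \<and> es \<noteq> [] \<and> hd es \<in> edge_cut G P \<and> last es \<in> edge_cut G Q \<and>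
       last vs \<in> Q \<and> hd vs \<notin> P \<and> (\<forall>i<length es. vs ! i \<notin> Q \<and> vs ! Suc i \<in> P)"
    by (rule linking_paths[OF PQ k])
  define h where "h p = hd (snd p)" for p :: "'v list \<times> 'e list"
  have facts: "is_path G (fst p) (snd p)" "snd p \<noteq> []" "h p \<in> edge_cut G P" "last (snd p) \<in> edge_cut G Q"
      "last (fst p) \<in> Q" "\<forall>i<length (snd p). fst p ! i \<notin> Q \<and> fst p ! Suc i \<in> P" if "p \<in> \<P>" for p
    using \<P>(4) that by (auto simp: h_def split_def)
  have inj: "inj_on h \<P>"
  proof (rule inj_onI, rule ccontr)
    fix p q assume pq: "p \<in> \<P>" "q \<in> \<P>" "h p = h q" "p \<noteq> q"
    have "h p \<in> set (snd p)" "h q \<in> set (snd q)" using facts(2) pq(1,2) by (simp_all add: h_def)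
    then have "h p \<in> set (snd p) \<inter> set (snd q)" using pq(3) by simp
    then show False using \<P>(3) pq unfolding pairwise_def disjnt_def by blast
  qed
  have "h ` \<P> \<subseteq> edge_cut G P" using facts(3) by blast
  moreover have "card (h ` \<P>) = card (edge_cut G P)" using inj \<P>(2) by (simp add: card_image cut_size_def)
  ultimately have surj: "h ` \<P> = edge_cut G P" using memD[OF PQ(1)] by (intro card_subset_eq) auto
  have "\<forall>e\<in>edge_cut G P. \<exists>p. p \<in> \<P> \<and> h p = e" unfolding surj[symmetric] by blast
  then obtain f where f: "\<And>e. e \<in> edge_cut G P \<Longrightarrow> f e \<in> \<P> \<and> h (f e) = e" by metis
  have "set (snd (f e)) \<inter> set (snd (f e')) = {}" if "e \<in> edge_cut G P" "e' \<in> edge_cut G P" "e' \<noteq> e" for e e'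
  proof -
    have "f e \<noteq> f e'" using f that by metis
    then show ?thesis using \<P>(3) f that unfolding pairwise_def disjnt_def by blast
  qed
  then show ?thesis using f facts by (intro exI[of _ f] ballI) (simp add: h_def)
qed

text \<open>The linkages between consecutive members of this subsequence use every edge of the first cut and
  meet only in the cuts, so they can be concatenated to edge-disjoint connected subgraphs.\<close>

lemma chain_subsequence:
  assumes p: "chain p"
  shows "\<exists>n. strict_mono n \<and> n 0 \<ge> N \<and> (\<forall>i m. n i \<le> m \<longrightarrow> sz (p (n i)) \<le> sz (p m)) \<and>
    (\<forall>i. p (n (Suc i)) \<inter> (\<Union>e\<in>edge_cut G (p (n i)). endpts G e) = {})"
proof -
  \<comment> \<open>Indices at which the cut size is a minimum over the rest of the branch. There is
    one beyond every bound because sizes are natural numbers.\<close>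
  define low where "low n \<longleftrightarrow> N \<le> n \<and> (\<forall>m\<ge>n. sz (p n) \<le> sz (p m))" for n
  have ex: "\<exists>n\<ge>M. low n" if "N \<le> M" for M
  proof -
    have "\<exists>n. n \<ge> M \<and> (\<forall>m. m \<ge> M \<longrightarrow> sz (p n) \<le> sz (p m))"
      by (rule ex_has_least_nat) (rule order_refl)
    then obtain n where "n \<ge> M" "\<And>m. m \<ge> M \<Longrightarrow> sz (p n) \<le> sz (p m)" by blast
    then have "low n" using that unfolding low_def by (meson le_trans)
    then show ?thesis using \<open>n \<ge> M\<close> by blast
  qed
  have "\<exists>n. \<forall>i. low (n i) \<and> (n i < n (Suc i) \<and> p (n (Suc i)) \<inter> (\<Union>e\<in>edge_cut G (p (n i)). endpts G e) = {})"
  proof (rule dependent_nat_choice)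
    show "\<exists>x. low x" using ex by blast
    fix x and i :: nat assume "low x"
    define X where "X = (\<Union>e\<in>edge_cut G (p x). endpts G e)"
    have "finite X"
      unfolding X_def using memD[OF chainD(2)[OF p]] by (intro finite_cut_endpoints[OF mg _ edge_cut_subset_edges]) simp
    then obtain M where M: "\<forall>n\<ge>M. p n \<inter> X = {}" using chain_avoids[OF p] by blast
    have "N \<le> max M (Suc x)" using \<open>low x\<close> unfolding low_def by linarith
    then obtain y where "y \<ge> max M (Suc x)" "low y" using ex by blast
    then show "\<exists>y. low y \<and> x < y \<and> p y \<inter> (\<Union>e\<in>edge_cut G (p x). endpts G e) = {}"
      using M unfolding X_def by (intro exI[of _ y]) auto
  qed
  then obtain n where n: "\<And>i. low (n i)" "\<And>i. n i < n (Suc i)"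
    "\<And>i. p (n (Suc i)) \<inter> (\<Union>e\<in>edge_cut G (p (n i)). endpts G e) = {}" by blast
  have "strict_mono n" using n(2) by (simp add: strict_mono_Suc_iff)
  then show ?thesis using n unfolding low_def by blast
qed

text \<open>Each edge of the cut of \<open>P 0\<close> starts a strand, continued at every level by
  the linking path whose first edge is the last edge reached so far. Different strands share no
  edge, and each contains a ray that stays in the branch.\<close>

lemma disjoint_rays:
  assumes p: "chain p" and k: "\<And>n. n \<ge> N \<Longrightarrow> k \<le> sz (p n)"
  obtains \<R> where "\<R> \<subseteq> rays G" "finite \<R>" "card \<R> = k"
    "pairwise (\<lambda>R S. disjnt (ray_edges R) (ray_edges S)) \<R>" "\<forall>R\<in>\<R>. \<forall>m. ev_in (fst R) (p m)"
proof -
  obtain n where n: "strict_mono n" "n 0 \<ge> N" "\<And>i m. n i \<le> m \<Longrightarrow> sz (p (n i)) \<le> sz (p m)"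
    "\<And>i. p (n (Suc i)) \<inter> (\<Union>e\<in>edge_cut G (p (n i)). endpts G e) = {}"
    using chain_subsequence[OF p, of N] by metis
  define P where "P i = p (n i)" for i
  have PL: "P i \<in> \<L>" for i using chainD(2)[OF p] by (simp add: P_def)
  have Pmono: "P j \<subseteq> P i" if "i \<le> j" for i j
    unfolding P_def using n(1) that by (intro chainD(6)[OF p]) (simp add: strict_mono_less_eq)
  have sep: "x \<notin> P (Suc i)" if "e \<in> edge_cut G (P i)" "x \<in> endpts G e" for x e i
    using n(4)[of i] that by (auto simp: P_def)
  have "\<exists>f. \<forall>e\<in>edge_cut G (P i). is_path G (fst (f e)) (snd (f e)) \<and> snd (f e) \<noteq> [] \<and> hd (snd (f e)) = e \<and>
    last (snd (f e)) \<in> edge_cut G (P (Suc i)) \<and> last (fst (f e)) \<in> P (Suc i) \<and>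
    (\<forall>t<length (snd (f e)). fst (f e) ! t \<notin> P (Suc i) \<and> fst (f e) ! Suc t \<in> P i) \<and>
    (\<forall>e'\<in>edge_cut G (P i). e' \<noteq> e \<longrightarrow> set (snd (f e)) \<inter> set (snd (f e')) = {})" for i
  proof (rule linkage_map[OF PL PL Pmono])
    fix L assume L: "L \<in> \<L>" "P (Suc i) \<subseteq> L" "L \<subseteq> P i"
    have "nested_seq p (n i) (n (Suc i))" unfolding nested_seq_def using chainD(2,3,4)[OF p] by blast
    moreover have "n i \<le> n (Suc i)" using n(1) by (simp add: strict_mono_less_eq)
    ultimately obtain m where "n i \<le> m" "L = p m"
      using nested_seq_between[of p "n i" "n (Suc i)" L] L by (auto simp: P_def)
    then show "sz (P i) \<le> sz L" using n(3) by (simp add: P_def)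
  qed simp
  then obtain F where F: "\<And>i e. e \<in> edge_cut G (P i) \<Longrightarrow> is_path G (fst (F i e)) (snd (F i e)) \<and> snd (F i e) \<noteq> [] \<and>
    hd (snd (F i e)) = e \<and> last (snd (F i e)) \<in> edge_cut G (P (Suc i)) \<and> last (fst (F i e)) \<in> P (Suc i) \<and>
    (\<forall>t<length (snd (F i e)). fst (F i e) ! t \<notin> P (Suc i) \<and> fst (F i e) ! Suc t \<in> P i) \<and>
    (\<forall>e'\<in>edge_cut G (P i). e' \<noteq> e \<longrightarrow> set (snd (F i e)) \<inter> set (snd (F i e')) = {})"
    by metis
  \<comment> \<open>\<open>b a i\<close> is the edge of the cut of \<open>P i\<close> at which the
    strand of \<open>a\<close> arrives.\<close>
  define b where "b a = rec_nat a (\<lambda>i e. last (snd (F i e)))" for a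
  have b0: "b a 0 = a" and bS: "b a (Suc i) = last (snd (F i (b a i)))" for a i by (simp_all add: b_def)
  have bcut: "b a i \<in> edge_cut G (P i)" if "a \<in> edge_cut G (P 0)" for a i
    by (induction i) (use that F b0 bS in auto)
  define vs where "vs a i = fst (F i (b a i))" for a i
  define es where "es a i = snd (F i (b a i))" for a i
  have path: "is_path G (vs a i) (es a i)" and ne: "es a i \<noteq> []" and hde: "hd (es a i) = b a i"
    and laste: "last (es a i) = b a (Suc i)" and lastv: "last (vs a i) \<in> P (Suc i)"
    and out: "\<And>t. t < length (es a i) \<Longrightarrow> vs a i ! t \<notin> P (Suc i)"
    and ins: "\<And>t. t < length (es a i) \<Longrightarrow> vs a i ! Suc t \<in> P i"
    if "a \<in> edge_cut G (P 0)" for a i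
    using F[OF bcut[OF that]] bS by (simp_all add: vs_def es_def)
  have disj: "set (es a i) \<inter> set (es a' i) = {}"
    if "a \<in> edge_cut G (P 0)" "a' \<in> edge_cut G (P 0)" "b a i \<noteq> b a' i" for a a' i
    using F[OF bcut[OF that(1), of i]] bcut[OF that(2), of i] that(3) by (simp add: es_def)
  have ends: "endpts G (es a i ! t) = {vs a i ! t, vs a i ! Suc t}" "es a i ! t \<in> edges G"
    "vs a i ! t \<in> set (vs a i)" "vs a i ! Suc t \<in> set (vs a i)"
    if "a \<in> edge_cut G (P 0)" "t < length (es a i)" for a i t
    using path[OF that(1), of i] that(2) unfolding is_path_def by auto
  have bneq: "b a i \<noteq> b a' i" if "a \<in> edge_cut G (P 0)" "a' \<in> edge_cut G (P 0)" "a \<noteq> a'" for a a' i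
  proof (induction i)
    case (Suc i)
    have "b a (Suc i) \<in> set (es a i)" "b a' (Suc i) \<in> set (es a' i)"
      using laste ne that(1,2) last_in_set by metis+
    then show ?case using disj[OF that(1,2) Suc] by auto
  qed (use that b0 in simp)
  \<comment> \<open>An edge common to level \<open>i\<close> of one strand and a later level
    \<open>j\<close> of another lies in the cut of \<open>P (Suc i)\<close>. If
    \<open>j = Suc i\<close>, it is the edge passed on within the strand of \<open>a\<close>, and
    disjointness at level \<open>j\<close> applies. For larger \<open>j\<close> it would have an end
    in \<open>P (Suc (Suc i))\<close>, which \<open>sep\<close> forbids.\<close>
  have cross: False
    if a: "a \<in> edge_cut G (P 0)" "a' \<in> edge_cut G (P 0)" "a \<noteq> a'" and ij: "i < j"
      and g: "g \<in> set (es a i)" "g \<in> set (es a' j)" for a a' i j g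
  proof -
    obtain s where s: "s < length (es a i)" "g = es a i ! s" using g(1) by (metis in_set_conv_nth)
    obtain t where t: "t < length (es a' j)" "g = es a' j ! t" using g(2) by (metis in_set_conv_nth)
    have gE: "g \<in> edges G" using ends(2)[OF a(1) s(1)] s(2) by simp
    have gs: "endpts G g = {vs a i ! s, vs a i ! Suc s}" using ends(1)[OF a(1) s(1)] s(2) by simp
    have gt: "endpts G g = {vs a' j ! t, vs a' j ! Suc t}" using ends(1)[OF a(2) t(1)] t(2) by simp
    have inj: "vs a' j ! Suc t \<in> P j" using ins[OF a(2) t(1)] .
    then have "vs a' j ! Suc t \<in> P (Suc i)" using Pmono[of "Suc i" j] ij by auto
    moreover have "vs a i ! s \<notin> P (Suc i)" using out[OF a(1) s(1)] .
    moreover have "vs a' j ! Suc t \<in> {vs a i ! s, vs a i ! Suc s}" using gs gt by auto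
    ultimately have inS: "vs a i ! Suc s \<in> P (Suc i)" by auto
    then have cut: "g \<in> edge_cut G (P (Suc i))"
      using edge_cut_pair[OF mg gE gs, of "P (Suc i)"] out[OF a(1) s(1)] by simp
    show False
    proof (cases "j = Suc i")
      case True
      have "\<not> Suc s < length (es a i)" using out[OF a(1), of "Suc s" i] inS by blast
      then have "s = length (es a i) - 1" using s(1) by simp
      then have "g = last (es a i)" using s(2) ne[OF a(1), of i] by (simp add: last_conv_nth)
      then have "g = b a j" using laste[OF a(1)] True by simp
      then have "g \<in> set (es a j)" using hde[OF a(1), of j] ne[OF a(1), of j] by (metis hd_in_set)
      then show False using disj[OF a(1,2) bneq[OF a]] g(2) by blast
    next
      case False
      have "vs a' j ! Suc t \<notin> P (Suc (Suc i))" by (rule sep[OF cut]) (simp add: gt)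
      moreover have "P j \<subseteq> P (Suc (Suc i))" using False ij by (intro Pmono) simp
      ultimately show False using inj by blast
    qed
  qed
  define H where "H a = (\<Union>i. set (es a i))" for a
  have Hdisj: "H a \<inter> H a' = {}" if a: "a \<in> edge_cut G (P 0)" "a' \<in> edge_cut G (P 0)" "a \<noteq> a'" for a a'
  proof (rule ccontr)
    assume "H a \<inter> H a' \<noteq> {}"
    then obtain g i j where g: "g \<in> set (es a i)" "g \<in> set (es a' j)" by (auto simp: H_def)
    consider "i = j" | "i < j" | "j < i" by linarith
    then show False
    proof cases
      case 1
      then show False using disj[OF a(1,2) bneq[OF a]] g by blast
    next
      case 2
      then show False using cross[OF a _ g] by blast
    next
      case 3
      then show False using cross[OF a(2,1) a(3)[symmetric] _ g(2,1)] by blast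
    qed
  qed
  have ray: "\<exists>R. R \<in> rays G \<and> ray_edges R \<subseteq> H a \<and> (\<forall>m. ev_in (fst R) (p m))" if a: "a \<in> edge_cut G (P 0)" for a
  proof -
    \<comment> \<open>The strand as a graph of its own. It is connected, locally finite and
      infinite, so Koenig's lemma yields a ray in it and the paths need not be glued vertex by
      vertex.\<close>
    define K where "K = \<lparr>verts = (\<Union>i. set (vs a i)), edges = H a, endpts = endpts G\<rparr>"
    have K: "verts K = (\<Union>i. set (vs a i))" "edges K = H a" "endpts K = endpts G" by (simp_all add: K_def)
    have KG: "verts K \<subseteq> verts G" "edges K \<subseteq> edges G"
      using path[OF a] unfolding is_path_def K H_def by blast+
    have edge: "\<exists>i t. t < length (es a i) \<and> e = es a i ! t" if "e \<in> edges K" for e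
      using that by (auto simp: K H_def in_set_conv_nth)
    have mgK: "multigraph K"
      unfolding multigraph_def
    proof
      fix e assume e: "e \<in> edges K"
      then obtain i t where t: "t < length (es a i)" "e = es a i ! t" using edge by blast
      have "endpts K e \<subseteq> verts K" using ends[OF a t(1)] t(2) by (auto simp: K)
      moreover have "card (endpts K e) = 2" using mg KG(2) e by (auto simp: multigraph_def K)
      ultimately show "endpts K e \<subseteq> verts K \<and> card (endpts K e) = 2" ..
    qed
    have pathK: "is_path K (vs a i) (es a i)" for i
      using path[OF a, of i] by (auto simp: is_path_def K H_def)
    \<comment> \<open>Consecutive paths of a strand share the edge \<open>b a (Suc i)\<close>, and
      with it both its ends.\<close>
    have start: "vs a (Suc i) ! 0 \<in> set (vs a i)" for i
    proof -
      have l: "0 < length (es a (Suc i))" "length (es a i) - 1 < length (es a i)" using ne[OF a] by auto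
      have "es a (Suc i) ! 0 = b a (Suc i)" using hde[OF a, of "Suc i"] ne[OF a] by (simp add: hd_conv_nth)
      moreover have "es a i ! (length (es a i) - 1) = b a (Suc i)"
        using laste[OF a, of i] ne[OF a] by (simp add: last_conv_nth)
      ultimately have "endpts G (es a (Suc i) ! 0) = endpts G (es a i ! (length (es a i) - 1))" by simp
      then have "vs a (Suc i) ! 0 \<in> {vs a i ! (length (es a i) - 1), vs a i ! Suc (length (es a i) - 1)}"
        using ends(1)[OF a l(1)] ends(1)[OF a l(2)] by auto
      then show ?thesis using ends(3,4)[OF a l(2)] by auto
    qed
    have len: "length (vs a i) = Suc (length (es a i))" for i using path[OF a, of i] by (simp add: is_path_def)
    have connK: "conn_in K (verts K)"
      unfolding conn_in_def
    proof (intro allI impI, rule ccontr)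
      fix B assume B: "B \<subseteq> verts K" "B \<noteq> {} \<and> B \<noteq> verts K"
        and no: "\<not> (\<exists>e\<in>edges K. \<exists>a\<in>B. \<exists>b\<in>verts K - B. endpts K e = {a, b})"
      have "edge_cut K B = {}"
      proof (rule equals0I)
        fix e assume "e \<in> edge_cut K B"
        then obtain x y where xy: "e \<in> edges K" "x \<in> B" "y \<notin> B" "endpts K e = {x, y}"
          by (auto simp: mem_edge_cut[OF mgK])
        moreover have "y \<in> verts K" using mgK xy(1,4) by (auto simp: multigraph_def)
        ultimately show False using no by blast
      qed
      then have same: "vs a i ! t \<in> B \<longleftrightarrow> vs a i ! 0 \<in> B" if "t \<le> length (es a i)" for i t
        using subpath_crosses[OF mgK pathK, of 0 t i B] that by blast
      have same': "x \<in> B \<longleftrightarrow> vs a i ! 0 \<in> B" if "x \<in> set (vs a i)" for i x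
        using that same len by (metis in_set_conv_nth less_Suc_eq_le)
      have "vs a i ! 0 \<in> B \<longleftrightarrow> vs a 0 ! 0 \<in> B" for i
        by (induction i) (use same'[OF start] in auto)
      then have "x \<in> B \<longleftrightarrow> vs a 0 ! 0 \<in> B" if "x \<in> verts K" for x
        using that same' by (auto simp: K)
      then show False using B by blast
    qed
    have lfK: "locally_finite K"
      unfolding locally_finite_def
    proof
      fix x assume "x \<in> verts K"
      then have "finite (incident_edges G x)" using lf KG(1) by (auto simp: locally_finite_def)
      then show "finite (incident_edges K x)"
        by (rule rev_finite_subset) (use KG(2) K(3) in \<open>auto simp: incident_edges_def\<close>)
    qed
    have vne: "vs a i \<noteq> []" for i using len[of i] by auto
    interpret k: lfc_graph K
    proof
      show "multigraph K" "locally_finite K" by (fact mgK, fact lfK)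
      show "connected_graph K"
        unfolding connected_graph_iff[OF mgK] using connK vne by (auto simp: K)
    qed
    have nge: "i \<le> n i" for i using n(1) by (rule strict_mono_imp_increasing)
    have infK: "infinite (verts K)"
    proof
      assume "finite (verts K)"
      then obtain M where M: "\<forall>m\<ge>M. p m \<inter> verts K = {}" using chain_avoids[OF p] by blast
      have "last (vs a M) \<in> verts K" using last_in_set[OF vne[of M]] unfolding K(1) by blast
      moreover have "M \<le> n (Suc M)" using nge[of "Suc M"] by simp
      ultimately show False using lastv[OF a, of M] M by (auto simp: P_def)
    qed
    obtain v where v: "v \<in> vrays K" using k.koenig[OF order_refl infK] by metis
    then obtain f where f: "(v, f) \<in> rays K" by (rule vray_ray)
    have fG: "(v, f) \<in> rays G" using f KG K(3) by (auto simp: rays_def)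
    \<comment> \<open>Beyond level \<open>i\<close> the strand stays in \<open>P i\<close>. The
      delicate vertex is the first one of a path, which need not lie in \<open>P j\<close>: its edge
      has an end in \<open>P j\<close>, so by \<open>sep\<close> it is not in the cut of the
      preceding member.\<close>
    have late: "x \<in> P i" if xj: "x \<in> set (vs a j)" and ij: "i < j" for x i j
    proof -
      obtain t where t: "t \<le> length (es a j)" "x = vs a j ! t"
        using xj len by (metis in_set_conv_nth less_Suc_eq_le)
      show ?thesis
      proof (cases t)
        case (Suc u)
        then have "x \<in> P j" using ins[OF a, of u j] t by simp
        then show ?thesis using Pmono[of i j] ij by auto
      next
        case 0
        obtain j' where j': "j = Suc j'" using ij by (cases j) auto
        have l: "0 < length (es a j)" using ne[OF a] by auto
        let ?e = "es a j ! 0"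
        have e: "?e \<in> edges G" "endpts G ?e = {vs a j ! 0, vs a j ! Suc 0}" using ends[OF a l] by auto
        have in1: "vs a j ! Suc 0 \<in> P (Suc j')" using ins[OF a l] j' by simp
        then have "?e \<notin> edge_cut G (P j')" using sep[of ?e j' "vs a j ! Suc 0"] e(2) by blast
        moreover have "vs a j ! Suc 0 \<in> P j'" using in1 Pmono[of j' "Suc j'"] by auto
        ultimately have "vs a j ! 0 \<in> P j'" using edge_cut_pair[OF mg e, of "P j'"] by simp
        moreover have "P j' \<subseteq> P i" using ij j' by (intro Pmono) simp
        ultimately show ?thesis using t(2) 0 by auto
      qed
    qed
    have "ev_in v (P i)" for i
    proof -
      have "\<forall>\<^sub>F m in sequentially. v m \<notin> (\<Union>j\<le>i. set (vs a j))"
        by (rule inj_ev_notin_finite[OF vrays_inj[OF v]]) simp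
      moreover have "x \<in> P i" if x: "x \<in> verts K" "x \<notin> (\<Union>j\<le>i. set (vs a j))" for x
      proof -
        obtain j where "x \<in> set (vs a j)" using x(1) unfolding K(1) by blast
        moreover from this have "i < j" using x(2) by (auto simp: not_le[symmetric])
        ultimately show ?thesis using late by blast
      qed
      ultimately show ?thesis using vrays_verts[OF v] by (auto elim: eventually_mono)
    qed
    moreover have "P m \<subseteq> p m" for m unfolding P_def by (rule chainD(6)[OF p nge])
    ultimately have "ev_in v (p m)" for m using ev_in_mono by blast
    moreover have "ray_edges (v, f) \<subseteq> H a" using f by (auto simp: rays_def ray_edges_def K)
    ultimately show ?thesis using fG by (intro exI[of _ "(v, f)"]) simp
  qed
  obtain \<rho> where \<rho>: "\<And>a. a \<in> edge_cut G (P 0) \<Longrightarrow> \<rho> a \<in> rays G \<and> ray_edges (\<rho> a) \<subseteq> H a \<and> (\<forall>m. ev_in (fst (\<rho> a)) (p m))"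
    using ray by metis
  have "k \<le> card (edge_cut G (P 0))" using k[OF n(2)] by (simp add: P_def cut_size_def)
  then obtain A where A: "A \<subseteq> edge_cut G (P 0)" "card A = k" "finite A"
    by (rule obtain_subset_with_card_n)
  have dis: "disjnt (ray_edges (\<rho> a)) (ray_edges (\<rho> a'))" if "a \<in> A" "a' \<in> A" "a \<noteq> a'" for a a'
    using Hdisj[of a a'] \<rho>[of a] \<rho>[of a'] that A(1) unfolding disjnt_def by blast
  have nonempty: "ray_edges R \<noteq> {}" for R :: "('v, 'e) ray" by (simp add: ray_edges_def)
  have inj: "inj_on \<rho> A"
  proof (rule inj_onI, rule ccontr)
    fix a a' assume "a \<in> A" "a' \<in> A" "\<rho> a = \<rho> a'" "a \<noteq> a'"
    then show False using dis[of a a'] nonempty by (simp add: disjnt_def)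
  qed
  show thesis
  proof (rule that[of "\<rho> ` A"])
    show "\<rho> ` A \<subseteq> rays G" using \<rho> A(1) by blast
    show "finite (\<rho> ` A)" using A(3) by simp
    show "card (\<rho> ` A) = k" using card_image[OF inj] A(2) by simp
    show "pairwise (\<lambda>R S. disjnt (ray_edges R) (ray_edges S)) (\<rho> ` A)"
      unfolding pairwise_def using dis by blast
    show "\<forall>R\<in>\<rho> ` A. \<forall>m. ev_in (fst R) (p m)" using \<rho> A(1) by blast
  qed
qed

section \<open>Comparing the edge-degree with the limit inferior\<close>

lemma ecard_cut: "L \<in> \<L> \<Longrightarrow> ecard (edge_cut G L) = enat (sz L)"
  using memD by (simp add: ecard_def cut_size_def)

text \<open>A degree below the limit inferior is a finite number \<open>d\<close>, and eventually
  the cuts have at least \<open>Suc d\<close> edges. The branch then carries \<open>Suc d\<close>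
  edge-disjoint rays, all of which belong to \<open>\<omega>\<close>.\<close>

lemma edge_degree_ge:
  assumes \<omega>: "\<omega> \<in> edge_ends G" and R: "R \<in> \<omega>" and p: "chain p" "\<And>n. ev_in (fst R) (p n)"
  shows "liminf (\<lambda>n. ecard (edge_cut G (p n))) \<le> edge_degree \<omega>"
proof (rule ccontr)
  assume "\<not> ?thesis"
  then have less: "edge_degree \<omega> < liminf (\<lambda>n. ecard (edge_cut G (p n)))" by simp
  then obtain d where d: "edge_degree \<omega> = enat d" by (cases "edge_degree \<omega>") auto
  have "\<forall>\<^sub>F n in sequentially. enat d < ecard (edge_cut G (p n))"
    using less unfolding d by (rule less_LiminfD)
  then obtain N where "\<And>n. n \<ge> N \<Longrightarrow> enat d < ecard (edge_cut G (p n))"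
    unfolding eventually_sequentially by blast
  then have N: "\<And>n. n \<ge> N \<Longrightarrow> Suc d \<le> sz (p n)"
    using ecard_cut[OF chainD(2)[OF p(1)]] by (simp add: Suc_le_eq)
  obtain \<R> where \<R>: "\<R> \<subseteq> rays G" "finite \<R>" "card \<R> = Suc d"
    "pairwise (\<lambda>R S. disjnt (ray_edges R) (ray_edges S)) \<R>" "\<forall>R\<in>\<R>. \<forall>m. ev_in (fst R) (p m)"
    by (rule disjoint_rays[OF p(1) N])
  have RG: "R \<in> rays G" by (rule edge_end_rays[OF mg \<omega> R])
  have "S \<in> \<omega>" if "S \<in> \<R>" for S
  proof -
    have "S \<in> rays G" using \<R>(1) that by blast
    moreover have "edge_equiv G R S"
      by (rule rays_in_chain_equiv[OF p(1) RG \<open>S \<in> rays G\<close> p(2)]) (use \<R>(5) that in blast)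
    ultimately show ?thesis using edge_end_mem_iff[OF mg \<omega> R] by blast
  qed
  then have "ecard \<R> \<le> edge_degree \<omega>"
    unfolding edge_degree_def using \<R>(4) by (intro SUP_upper) auto
  then show False using d \<R>(2,3) by (simp add: ecard_def)
qed

text \<open>Far along the branch finitely many given rays all start outside \<open>p n\<close> and
  have tails inside, so each uses its own edge of the cut. An infinite family is handled through its
  finite subfamilies.\<close>

lemma edge_degree_le:
  assumes \<omega>: "\<omega> \<in> edge_ends G" and R: "R \<in> \<omega>" and p: "chain p" "\<And>n. ev_in (fst R) (p n)"
  shows "edge_degree \<omega> \<le> liminf (\<lambda>n. ecard (edge_cut G (p n)))"
  unfolding edge_degree_def
proof (rule SUP_least)
  fix \<R> assume "\<R> \<in> {\<R>. \<R> \<subseteq> \<omega> \<and> pairwise (\<lambda>R S. disjnt (ray_edges R) (ray_edges S)) \<R>}"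
  then have \<R>: "\<R> \<subseteq> \<omega>" "pairwise (\<lambda>R S. disjnt (ray_edges R) (ray_edges S)) \<R>" by auto
  have fin: "enat (card \<R>0) \<le> liminf (\<lambda>n. ecard (edge_cut G (p n)))" if \<R>0: "finite \<R>0" "\<R>0 \<subseteq> \<R>" for \<R>0
  proof (rule Liminf_bounded)
    have "finite ((\<lambda>S. fst S 0) ` \<R>0)" using \<R>0(1) by simp
    then obtain N where N: "\<forall>n\<ge>N. p n \<inter> (\<lambda>S. fst S 0) ` \<R>0 = {}" using chain_avoids[OF p(1)] by blast
    have "enat (card \<R>0) \<le> ecard (edge_cut G (p n))" if n: "n \<ge> N" for n
    proof -
      have f: "fincut (p n)" using memD[OF chainD(2)[OF p(1)]] by blast
      have "\<exists>e. e \<in> ray_edges S \<and> e \<in> edge_cut G (p n)" if S: "S \<in> \<R>0" for S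
      proof -
        have SG: "S \<in> rays G" using edge_end_rays[OF mg \<omega>] \<R>(1) \<R>0(2) S by blast
        have RG: "R \<in> rays G" by (rule edge_end_rays[OF mg \<omega> R])
        have "edge_equiv G R S" using edge_end_mem_iff[OF mg \<omega> R SG] \<R>(1) \<R>0(2) S by blast
        then have "ev_in (fst S) (p n)" using edge_equivD[OF mg RG SG _ f] p(2) by blast
        then obtain j where "fst S j \<in> p n" using eventually_happens'[OF sequentially_bot] by blast
        moreover have "fst S 0 \<notin> p n" using N n S by blast
        moreover have "(fst S, snd S) \<in> rays G" using SG by simp
        ultimately obtain i where "snd S i \<in> edge_cut G (p n)" using ray_cut_edge[OF mg, of "fst S" "snd S" 0 "p n" j] by auto
        then show ?thesis by (auto simp: ray_edges_def)
      qed
      then obtain g where g: "\<And>S. S \<in> \<R>0 \<Longrightarrow> g S \<in> ray_edges S \<and> g S \<in> edge_cut G (p n)" by metis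
      have "inj_on g \<R>0"
      proof (rule inj_onI, rule ccontr)
        fix S S' assume S: "S \<in> \<R>0" "S' \<in> \<R>0" "g S = g S'" "S \<noteq> S'"
        then have "disjnt (ray_edges S) (ray_edges S')" using \<R>(2) \<R>0(2) unfolding pairwise_def by blast
        then show False using g[OF S(1)] g[OF S(2)] S(3) unfolding disjnt_def by auto
      qed
      then have "card \<R>0 \<le> sz (p n)"
        unfolding cut_size_def using f g by (intro card_inj_on_le[of g]) auto
      then show ?thesis using ecard_cut[OF chainD(2)[OF p(1)]] by simp
    qed
    then show "\<forall>\<^sub>F n in sequentially. enat (card \<R>0) \<le> ecard (edge_cut G (p n))"
      unfolding eventually_sequentially by blast
  qed
  show "ecard \<R> \<le> liminf (\<lambda>n. ecard (edge_cut G (p n)))"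
  proof (cases "finite \<R>")
    case True
    then show ?thesis using fin[of \<R>] by (simp add: ecard_def)
  next
    case False
    have all: "enat k \<le> liminf (\<lambda>n. ecard (edge_cut G (p n)))" for k
    proof -
      obtain \<R>0 where "\<R>0 \<subseteq> \<R>" "finite \<R>0" "card \<R>0 = k" using infinite_arbitrarily_large[OF False] by blast
      then show ?thesis using fin[of \<R>0] by simp
    qed
    have "liminf (\<lambda>n. ecard (edge_cut G (p n))) = \<infinity>"
    proof (cases "liminf (\<lambda>n. ecard (edge_cut G (p n)))")
      case (enat m)
      then show ?thesis using all[of "Suc m"] by simp
    qed
    then show ?thesis by simp
  qed
qed

lemma degrees_tree:
  assumes \<omega>: "\<omega> \<in> edge_ends G"
  shows "\<exists>R. corresponding_ray tree (c (verts G)) bag \<omega> R \<and>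
    edge_degree \<omega> = liminf (\<lambda>n. ecard (edge_cut G (part_above tree (c (verts G)) bag (fst R n))))"
proof -
  obtain R p where R: "R \<in> \<omega>" "chain p" "\<And>n. ev_in (fst R) (p n)" "end_map tree bag \<omega> = Inr (tree_end p)"
    using chain_of_end[OF \<omega>] by metis
  have "corresponding_ray tree (c (verts G)) bag \<omega> (tray p)"
    unfolding corresponding_ray_def
    using tray_ray[OF R(2)] tree_end[OF R(2)] R(4) ends_tree chainD(1)[OF R(2)] by (auto simp: tray_def)
  moreover have "edge_degree \<omega> = liminf (\<lambda>n. ecard (edge_cut G (p n)))"
    using edge_degree_ge[OF \<omega> R(1,2,3)] edge_degree_le[OF \<omega> R(1,2,3)] by (rule antisym[rotated])
  moreover have "part_above tree (c (verts G)) bag (fst (tray p) n) = p n" for n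
    using part_above_tree[OF chainD(2)[OF R(2)]] by (simp add: tray_def)
  ultimately show ?thesis by (intro exI[of _ "tray p"]) simp
qed

end

theorem theorem1p3:
  fixes G :: "('v, 'e) mgraph"
  assumes "multigraph G" and "connected_graph G" and "locally_finite G"
  shows "\<exists>(T :: (nat, nat) mgraph) r V.
           rooted_tree_cut_decomposition G T r V \<and>
           finite_adhesion G T V \<and>
           linked G T r V \<and>
           (\<forall>t\<in>verts T. finite (V t)) \<and>
           locally_finite T \<and>
           graph_ends G = edge_ends G \<and>
           displays G T V (edge_ends G) \<and>
           (\<forall>\<omega>\<in>edge_ends G. \<exists>R. corresponding_ray T r V \<omega> R \<and>
              edge_degree \<omega> = liminf (\<lambda>n. ecard (edge_cut G (part_above T r V (fst R n)))))"
proof -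
  interpret g: lfc_graph G using assms by unfold_locales
  obtain \<L> where \<L>: "g.linked_family \<L>" using g.linked_family_exists by blast
  have L: "\<And>L. L \<in> \<L> \<Longrightarrow> L \<subseteq> verts G \<and> L \<noteq> {}" "\<And>v. v \<in> verts G \<Longrightarrow> finite {L \<in> \<L>. v \<in> L}"
    using \<L> unfolding g.linked_family_def by simp_all
  \<comment> \<open>Every member contains a vertex and each vertex lies in finitely many members.
    The family is therefore countable, and its enumeration provides the nodes of the tree.\<close>
  have "\<L> \<subseteq> (\<Union>v\<in>verts G. {L \<in> \<L>. v \<in> L})" using L(1) by blast
  moreover have "countable (\<Union>v\<in>verts G. {L \<in> \<L>. v \<in> L})"
    by (rule countable_UN[OF g.countable_verts countable_finite[OF L(2)]])
  ultimately have "countable \<L>" by (rule countable_subset)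
  then interpret f: family G \<L> "to_nat_on \<L>"
    using \<L> by unfold_locales (auto intro: inj_on_to_nat_on)
  show ?thesis
    using f.decomposition_tree f.finite_adhesion_tree f.linked_tree f.finite_bags_tree f.locally_finite_tree
      graph_ends_eq_edge_ends[OF assms(1,3)] f.displays_tree f.degrees_tree
    by (intro exI[of _ f.tree] exI[of _ "to_nat_on \<L> (verts G)"] exI[of _ f.bag] conjI ballI) auto
qed

end
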